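(* Let $F$ be an SMT formula over a set of variables $V$, and let $S \subseteq V$ be a set of discrete (bit-vector) projection variables. Let $\varepsilon > 0$ and $0 < \delta < 1$. Let $\mathrm{est} = \mathsf{PACT}(F, S, \varepsilon, \delta)$ be the value returned by the algorithm $\mathsf{PACT}$ described in the context, and let $c = |\mathrm{Sol}(F)_{\downarrow S}|$. Then $$\Pr\left[\frac{c}{1+\varepsilon} \leq \mathrm{est} \leq (1+\varepsilon)\, c\right] \geq 1-\delta .$$ Moreover, $\mathsf{PACT}$ makes $\mathcal{O}\!\left(\log(|S|)\,\frac{1}{\varepsilon^2}\log\frac{1}{\delta}\right)$ calls to an SMT solver.
   Context: An SMT solver is an oracle that, given an SMT formula, either returns a satisfying assignment or reports unsatisfiability. For a formula $F$ and a projection set $S \subseteq \mathrm{vars}(F)$ of discrete variables, $\mathrm{Sol}(F)$ is the set of satisfying assignments of $F$ and $\mathrm{Sol}(F)_{\downarrow S}$ is the (finite) set of their restrictions to $S$. A hash family $\mathcal{H}$ of functions $h: U \to [m]$ is pairwise independent if for all distinct $x_1, x_2 \in U$ and all $i_1, i_2 \in [m]$, $\Pr_{h}[h(x_1)=i_1 \wedge h(x_2)=i_2] = 1/m^2$. The hash families used are: multiply-mod-prime $h_{\mathbf a,b}(\mathbf x)=(\sum_i a_i x_i + b) \bmod p$ with $a_i,b$ uniform in $[p]$; multiply-shift $h_{\mathbf a,b}(\mathbf x)=(\sum_i a_i x_i + b)[\bar w-\ell,\bar w)$ (bits $\bar w-\ell$ through $\bar w-1$) with $a_i,b$ uniform in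 $[2^{\bar w}]$, $\bar w \ge w+\ell-1$, for inputs in $[2^w]^d$; and XOR $h_{\mathbf a}(\mathbf x)=\bigoplus_{i: a_i=1} x_i$ (the case $p=2$); the hash inputs are the bit-vector variables of $S$ sliced into pieces whose values lie in the hash domain. A hash constraint is $h(\mathbf x)=\alpha$ with $\alpha$ uniform in the range; conjoining $i$ independently chosen such constraints $H_{[i]}$ to $F$ restricts to one "cell" of a partition of the projected solution space into (product of ranges) many cells. The algorithm $\mathsf{PACT}(F,S,\varepsilon,\delta)$: set $\mathrm{thresh} = 1 + 9.84\,(1+\frac{\varepsilon}{1+\varepsilon})(1+\frac1\varepsilon)^2$; set the number of iterations to $\lceil 17\log\frac3\delta\rceil$ (XOR family, range size $2$) or $\lceil 23\log\frac3\delta\rceil$ (multiply-shift or multiply-mod-prime, range parameter $\ell=4$, range size $2^\ell$, resp. smallest prime larger than $2^\ell$). A saturating counter enumerates projected solutions of a formula with an SMT solver, adding after each found solution $\tau$ the blocking constraint $\neg(\tau_{\downarrow S})$, stopping when $\mathrm{thresh}$ solutions are found (reporting "saturated") or the solver reports unsatisfiable (reporting the exact count). If $|\mathrm{Sol}(F)_{\downarrow S}| < \mathrm{thresh}$, $\mathsf{PACT}$ returns this exact count. Otherwise, in each iteration it draws a fresh sequence of independent random hash constraints $h_0,h_1,\dots$ from the chosen family, and using a galloping search over the index $i$ (with the saturating counter on $F\wedge H_{[i]}$, $H_{[i]}=h_0\wedge\dots\wedge h_i$) finds an $i$ such that the cell for $H_{[i]}$ has fewer than $\mathrm{thresh}$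 projected solutions while the cell for $H_{[i-1]}$ is saturated; for the non-XOR families the last hash is then replaced by hashes of successively halved range parameter $\ell \leftarrow \lfloor \ell/2\rfloor$ as long as the resulting cell stays unsaturated, keeping the last unsaturated one. The iteration's estimate is the final cell's count multiplied by the total number of cells (product of the ranges of the hashes used). $\mathsf{PACT}$ returns the median of the iteration estimates.
   Formalization: The call bound takes |S| in bits (or as number of variables, with constant depending on a bit-width bound), size at least 2, ε ≤ ε₀, δ ≤ δ₀ < 1; it fails otherwise. The search stops after as many hashes as S has bits; a failed iteration is left out of the median. Logs are base 2. *)

theory Defs
  imports "HOL-Probability.Probability" "HOL-Computational_Algebra.Primes"
begin

section \<open>SMT formulas, projected solutions, solvers\<close>

text \<open>
  A bit-vector of width \<open>w\<close> is represented by the natural number below \<open>2 ^ w\<close> it encodes;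
  values of all other sorts (reals, arrays, uninterpreted sorts, ...) are taken from \<open>'a\<close>.
\<close>

datatype 'a val = BV nat | Other 'a

datatype 'a srt = BitVec nat | Sort "'a set"

fun carrier_of :: "'a srt \<Rightarrow> 'a val set" where
  "carrier_of (BitVec w) = BV ` {..<2 ^ w}"
| "carrier_of (Sort D) = Other ` D"

fun width :: "'a srt \<Rightarrow> nat" where
  "width (BitVec w) = w"
| "width (Sort D) = 0"

fun bv_nat :: "'a val \<Rightarrow> nat" where
  "bv_nat (BV n) = n"
| "bv_nat (Other a) = 0"

type_synonym ('v, 'a) assignment = "'v \<Rightarrow> 'a val"

text \<open>
  Formulas are identified with their truth-value functions. They are only ever evaluated on
  well-sorted extensional assignments to the variable set \<open>V\<close> (see \<open>Sol\<close>), so a formula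
  cannot depend on anything outside \<open>V\<close>.
\<close>

type_synonym ('v, 'a) formula = "('v, 'a) assignment \<Rightarrow> bool"

definition Sol :: "'v set \<Rightarrow> ('v \<Rightarrow> 'a srt) \<Rightarrow> ('v, 'a) formula \<Rightarrow> ('v, 'a) assignment set" where
  "Sol V \<Gamma> F = {\<tau> \<in> (\<Pi>\<^sub>E v\<in>V. carrier_of (\<Gamma> v)). F \<tau>}"

definition proj_Sol ::
  "'v set \<Rightarrow> ('v \<Rightarrow> 'a srt) \<Rightarrow> ('v, 'a) formula \<Rightarrow> 'v set \<Rightarrow> ('v, 'a) assignment set" where
  "proj_Sol V \<Gamma> F S = (\<lambda>\<tau>. restrict \<tau> S) ` Sol V \<Gamma> F"

type_synonym ('v, 'a) solver = "('v, 'a) formula \<Rightarrow> ('v, 'a) assignment option"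

definition smt_solver :: "'v set \<Rightarrow> ('v \<Rightarrow> 'a srt) \<Rightarrow> ('v, 'a) solver \<Rightarrow> bool" where
  "smt_solver V \<Gamma> solve \<longleftrightarrow>
     (\<forall>F. case solve F of None \<Rightarrow> Sol V \<Gamma> F = {} | Some \<tau> \<Rightarrow> \<tau> \<in> Sol V \<Gamma> F)"

definition total_bits :: "('v \<Rightarrow> 'a srt) \<Rightarrow> 'v set \<Rightarrow> nat" where
  "total_bits \<Gamma> S = (\<Sum>v\<in>S. width (\<Gamma> v))"


section \<open>Hash families\<close>

text \<open>
  The arguments of \<open>Multiply_Shift\<close> give, for every range parameter \<open>\<ell>\<close>, the slice width
  \<open>w\<close> and the word size \<open>wbar\<close>.
\<close>

datatype hash_family =
  XOR
| Multiply_Shift "nat \<Rightarrow> nat" "nat \<Rightarrow> nat"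
| Multiply_Mod_Prime

fun valid_family :: "hash_family \<Rightarrow> bool" where
  "valid_family XOR = True"
| "valid_family (Multiply_Shift w wbar) = (\<forall>l\<ge>1. w l \<ge> 1 \<and> wbar l \<ge> w l + l - 1)"
| "valid_family Multiply_Mod_Prime = True"

fun init_range_param :: "hash_family \<Rightarrow> nat" where
  "init_range_param XOR = 1"
| "init_range_param (Multiply_Shift w wbar) = 4"
| "init_range_param Multiply_Mod_Prime = 4"

definition next_prime :: "nat \<Rightarrow> nat" where
  "next_prime n = (LEAST p. prime p \<and> n < p)"

fun range_size :: "hash_family \<Rightarrow> nat \<Rightarrow> nat" where
  "range_size XOR l = 2"
| "range_size (Multiply_Shift w wbar) l = 2 ^ l"
| "range_size Multiply_Mod_Prime l = next_prime (2 ^ l)"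

fun slice_width :: "hash_family \<Rightarrow> nat \<Rightarrow> nat" where
  "slice_width XOR l = 1"
| "slice_width (Multiply_Shift w wbar) l = w l"
| "slice_width Multiply_Mod_Prime l = l"

text \<open>
  The hash inputs are indexed by pairs \<open>(v, j)\<close>, standing for the \<open>j\<close>-th slice of \<open>k\<close> bits of
  the variable \<open>v\<close>.
\<close>

definition slice_index :: "('v \<Rightarrow> 'a srt) \<Rightarrow> 'v set \<Rightarrow> nat \<Rightarrow> ('v \<times> nat) set" where
  "slice_index \<Gamma> S k = (SIGMA v:S. {j. j * k < width (\<Gamma> v)})"

definition slice :: "nat \<Rightarrow> ('v, 'a) assignment \<Rightarrow> 'v \<times> nat \<Rightarrow> nat" where
  "slice k \<tau> = (\<lambda>(v, j). take_bit k (drop_bit (j * k) (bv_nat (\<tau> v))))"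

text \<open>
  A random hash function on inputs indexed by \<open>I\<close>. A uniform element of \<open>I \<rightarrow>\<^sub>E {..<m}\<close> is a
  family of independent uniform coefficients in \<open>{..<m}\<close>.
\<close>

fun hash_pmf :: "hash_family \<Rightarrow> nat \<Rightarrow> 'i set \<Rightarrow> (('i \<Rightarrow> nat) \<Rightarrow> nat) pmf" where
  "hash_pmf XOR l I = do {
     a \<leftarrow> pmf_of_set (I \<rightarrow>\<^sub>E {..<2 :: nat});
     return_pmf (\<lambda>x. (\<Sum>i\<in>{i\<in>I. a i = 1}. x i) mod 2) }"
| "hash_pmf (Multiply_Shift w wbar) l I = do {
     a \<leftarrow> pmf_of_set (I \<rightarrow>\<^sub>E {..<2 ^ wbar l});
     b \<leftarrow> pmf_of_set {..<2 ^ wbar l};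
     return_pmf (\<lambda>x. take_bit l (drop_bit (wbar l - l) ((\<Sum>i\<in>I. a i * x i) + b))) }"
| "hash_pmf Multiply_Mod_Prime l I = do {
     a \<leftarrow> pmf_of_set (I \<rightarrow>\<^sub>E {..<next_prime (2 ^ l)});
     b \<leftarrow> pmf_of_set {..<next_prime (2 ^ l)};
     return_pmf (\<lambda>x. ((\<Sum>i\<in>I. a i * x i) + b) mod next_prime (2 ^ l)) }"

definition hash_constraint_pmf ::
  "hash_family \<Rightarrow> ('v \<Rightarrow> 'a srt) \<Rightarrow> 'v set \<Rightarrow> nat \<Rightarrow> ('v, 'a) formula pmf" where
  "hash_constraint_pmf fam \<Gamma> S l = do {
     h \<leftarrow> hash_pmf fam l (slice_index \<Gamma> S (slice_width fam l));
     \<alpha> \<leftarrow> pmf_of_set {..<range_size fam l};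
     return_pmf (\<lambda>\<tau>. h (slice (slice_width fam l) \<tau>) = \<alpha>) }"

definition conj_all :: "('v, 'a) formula \<Rightarrow> ('v, 'a) formula list \<Rightarrow> ('v, 'a) formula" where
  "conj_all F hs = (\<lambda>\<tau>. F \<tau> \<and> (\<forall>h\<in>set hs. h \<tau>))"


section \<open>The algorithm\<close>

text \<open>
  Every procedure returns its result together with the number of solver calls it made.
  For the saturating counter, \<open>None\<close> means ``saturated''; \<open>n\<close> is the number of projected
  solutions found so far.
\<close>

function sat_count ::
  "('v, 'a) solver \<Rightarrow> 'v set \<Rightarrow> real \<Rightarrow> ('v, 'a) formula \<Rightarrow> nat \<Rightarrow> nat option \<times> nat" where
  "sat_count solve S T F n =
     (case solve F of
        None \<Rightarrow> (Some n, 1)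
      | Some \<tau> \<Rightarrow>
          if real (Suc n) \<ge> T then (None, 1)
          else let (r, q) = sat_count solve S T
                              (\<lambda>\<sigma>. F \<sigma> \<and> restrict \<sigma> S \<noteq> restrict \<tau> S) (Suc n)
               in (r, Suc q))"
  by pat_completeness auto
termination
  by (relation "Wellfounded.measure (\<lambda>(solve, S, T, F, n). nat \<lceil>T\<rceil> - n)") (auto, linarith)

declare sat_count.simps [simp del]

definition thresh :: "real \<Rightarrow> real" where
  "thresh \<epsilon> = 1 + 9.84 * (1 + \<epsilon> / (1 + \<epsilon>)) * (1 + 1 / \<epsilon>)\<^sup>2"

fun num_iterations :: "hash_family \<Rightarrow> real \<Rightarrow> nat" where
  "num_iterations XOR \<delta> = nat \<lceil>17 * log 2 (3 / \<delta>)\<rceil>"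
| "num_iterations (Multiply_Shift w wbar) \<delta> = nat \<lceil>23 * log 2 (3 / \<delta>)\<rceil>"
| "num_iterations Multiply_Mod_Prime \<delta> = nat \<lceil>23 * log 2 (3 / \<delta>)\<rceil>"

text \<open>
  The search is over the number \<open>k = i + 1\<close> of hash constraints; \<open>cnt k\<close> is the saturating
  counter on the cell cut out by the first \<open>k\<close> of them. Invariant of both procedures: the cell
  for \<open>lo\<close> is saturated; in \<open>bisect\<close>, moreover, the cell for \<open>hi\<close> has \<open>n\<close> projected solutions,
  fewer than the threshold. The result \<open>(k, n)\<close> is an unsaturated \<open>k\<close> with its count \<open>n\<close>, such
  that \<open>k - 1\<close> is saturated. The galloping phase probes \<open>1, 2, 4, \<dots>\<close> and fails if \<open>N\<close>
  constraints still leave a saturated cell.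
\<close>

function bisect ::
  "(nat \<Rightarrow> nat option \<times> nat) \<Rightarrow> nat \<Rightarrow> nat \<Rightarrow> nat \<Rightarrow> (nat \<times> nat) \<times> nat" where
  "bisect cnt lo hi n =
     (if hi \<le> Suc lo then ((hi, n), 0)
      else let mid = (lo + hi) div 2; (c, q) = cnt mid;
               (r, q') = (case c of None \<Rightarrow> bisect cnt mid hi n
                                  | Some n' \<Rightarrow> bisect cnt lo mid n')
           in (r, q + q'))"
  by pat_completeness auto
termination
  by (relation "Wellfounded.measure (\<lambda>(cnt, lo, hi, n). hi - lo)") auto

declare bisect.simps [simp del]

function gallop ::
  "(nat \<Rightarrow> nat option \<times> nat) \<Rightarrow> nat \<Rightarrow> nat \<Rightarrow> nat \<Rightarrow> (nat \<times> nat) option \<times> nat" where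
  "gallop cnt N lo hi =
     (case cnt hi of
        (Some n, q) \<Rightarrow> let (r, q') = bisect cnt lo hi n in (Some r, q + q')
      | (None, q) \<Rightarrow>
          if hi = 0 \<or> N \<le> hi then (None, q)
          else let (r, q') = gallop cnt N hi (min (2 * hi) N) in (r, q + q'))"
  by pat_completeness auto
termination
  by (relation "Wellfounded.measure (\<lambda>(cnt, N, lo, hi). N - hi)") auto

declare gallop.simps [simp del]

text \<open>
  \<open>refine\<close> replaces the last hash. \<open>G\<close> is the formula with all hash constraints but the last,
  \<open>l\<close> the range parameter of the current last hash and \<open>n\<close> the count of the current cell.
  The result is the final count and the range size of the final last hash.
\<close>

function refine ::
  "hash_family \<Rightarrow> ('v, 'a) solver \<Rightarrow> ('v \<Rightarrow> 'a srt) \<Rightarrow> 'v set \<Rightarrow> real \<Rightarrow> ('v, 'a) formula \<Rightarrow>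
   nat \<Rightarrow> nat \<Rightarrow> ((nat \<times> nat) \<times> nat) pmf" where
  "refine fam solve \<Gamma> S T G l n =
     (if l \<le> 1 then return_pmf ((n, range_size fam l), 0)
      else do {
        h \<leftarrow> hash_constraint_pmf fam \<Gamma> S (l div 2);
        case sat_count solve S T (conj_all G [h]) 0 of
          (None, q) \<Rightarrow> return_pmf ((n, range_size fam l), q)
        | (Some n', q) \<Rightarrow>
            map_pmf (\<lambda>(r, q'). (r, q + q')) (refine fam solve \<Gamma> S T G (l div 2) n') })"
  by pat_completeness auto
termination
  by (relation "Wellfounded.measure (\<lambda>(fam, solve, \<Gamma>, S, T, G, l, n). l)") auto

declare refine.simps [simp del]

definition pact_iteration ::
  "hash_family \<Rightarrow> ('v, 'a) solver \<Rightarrow> ('v \<Rightarrow> 'a srt) \<Rightarrow> 'v set \<Rightarrow> real \<Rightarrow> ('v, 'a) formula \<Rightarrow>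
   (nat option \<times> nat) pmf" where
  "pact_iteration fam solve \<Gamma> S T F = do {
     let l = init_range_param fam;
     let N = total_bits \<Gamma> S;
     hs \<leftarrow> replicate_pmf N (hash_constraint_pmf fam \<Gamma> S l);
     case gallop (\<lambda>k. sat_count solve S T (conj_all F (take k hs)) 0) N 0 1 of
       (None, q) \<Rightarrow> return_pmf (None, q)
     | (Some (k, n), q) \<Rightarrow>
         map_pmf (\<lambda>((n', m), q'). (Some (n' * (range_size fam l ^ (k - 1) * m)), q + q'))
           (refine fam solve \<Gamma> S T (conj_all F (take (k - 1) hs)) l n) }"

text \<open>The value on the empty list is only reached if the search fails in every iteration.\<close>

definition median :: "real list \<Rightarrow> real" where
  "median xs =
     (if xs = [] then 0
      else (sort xs ! ((length xs - 1) div 2) + sort xs ! (length xs div 2)) / 2)"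

definition pact ::
  "hash_family \<Rightarrow> ('v, 'a) solver \<Rightarrow> ('v \<Rightarrow> 'a srt) \<Rightarrow> ('v, 'a) formula \<Rightarrow> 'v set \<Rightarrow>
   real \<Rightarrow> real \<Rightarrow> (real \<times> nat) pmf" where
  "pact fam solve \<Gamma> F S \<epsilon> \<delta> =
     (case sat_count solve S (thresh \<epsilon>) F 0 of
        (Some n, q) \<Rightarrow> return_pmf (real n, q)
      | (None, q) \<Rightarrow> do {
          rs \<leftarrow> replicate_pmf (num_iterations fam \<delta>) (pact_iteration fam solve \<Gamma> S (thresh \<epsilon>) F);
          return_pmf (median (map real (List.map_filter fst rs)),
                      q + sum_list (map snd rs)) })"

definition pact_setting ::
  "hash_family \<Rightarrow> 'v set \<Rightarrow> ('v \<Rightarrow> 'a srt) \<Rightarrow> 'v set \<Rightarrow> ('v, 'a) solver \<Rightarrow> bool" where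
  "pact_setting fam V \<Gamma> S solve \<longleftrightarrow>
     valid_family fam \<and> finite V \<and> S \<subseteq> V \<and> (\<forall>v\<in>S. \<exists>w\<ge>1. \<Gamma> v = BitVec w) \<and>
     smt_solver V \<Gamma> solve"

end

theory Submission
  imports Defs "HOL-Number_Theory.Number_Theory"
begin

text \<open>
  Every hash constraint keeps each projected solution with probability \<open>1/r\<close>, pairwise
  independently, so a cell of mean size \<open>\<mu>\<close> has variance at most \<open>\<mu>\<close>. Put \<open>\<gamma> = \<epsilon> / (1 + \<epsilon>)\<close>; the
  threshold is \<open>1 + P (1 + \<gamma>)\<close> with the pivot \<open>P = 9.84 / \<gamma>\<^sup>2\<close>, and Cantelli's inequality bounds the
  probability that a cell of mean \<open>w P\<close> is off by a factor \<open>1 \<plusminus> \<gamma>\<close> to one side by \<open>1 / (1 + 9.84 w)\<close>.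
  The estimate of an iteration can only be bad if the cell at the level where the mean first drops
  to about \<open>P\<close> deviates, or a cell above it is too small, or a cell below it is saturated.

  Underestimates and overestimates are treated separately. Failures count as both. Each kind has
  probability at most \<open>0.36\<close> per iteration for XOR and at most \<open>0.378\<close> for the other families, and
  a Chernoff bound makes it a minority outside an event of probability \<open>\<delta>/3\<close>. For the
  other families the plain union bound over the levels is slightly too weak. It is repaired by
  exploiting that the last hash is independent of the cell it is applied to.
\<close>

text \<open>Write the number of projected solutions as b P r^j with 1 < b \<le> r, where r is the
  range size: the mean is b P at level j and b P / r, at most P, one level further. Nothing is known
  about b, so every bound must hold uniformly in it. An unsaturated cell of mean at least P is never
  an overestimate, because the threshold times 1 - \<gamma> is at most P, but it may be a severe
  underestimate. So underestimates are the hard half: all levels up to j must be charged, and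
  nestedness of the cells cuts this chain off. With ranges 16, 4, 2 a tight spot is a cell of range
  4 whose mean barely exceeds P. The cell of range 16 then has mean P/4, for which Cantelli charges
  0.289, and 0.092 for the other being too small lifts the sum above 0.378. If \<gamma> is large,
  the threshold leaves room to let the cell of range 4 play the role of the deviating one. If
  \<gamma> is small, cells of mean well above P lie many standard deviations above the threshold and
  cost almost nothing. The distinctions on \<gamma> balance these two effects.\<close>

section \<open>Expectations and probabilities over finitely supported distributions\<close>

lemma expectation_pair_pmf_finite:
  fixes f :: "'a \<times> 'b \<Rightarrow> real"
  assumes "finite (set_pmf A)" "finite (set_pmf B)"
  shows "measure_pmf.expectation (pair_pmf A B) f =
    measure_pmf.expectation A (\<lambda>a. measure_pmf.expectation B (\<lambda>b. f (a, b)))"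
proof -
  have "measure_pmf.expectation (pair_pmf A B) f =
      (\<Sum>p\<in>set_pmf A \<times> set_pmf B. f p * pmf (pair_pmf A B) p)"
    using assms by (subst integral_measure_pmf_real[of "set_pmf A \<times> set_pmf B"]) auto
  also have "\<dots> = (\<Sum>a\<in>set_pmf A. \<Sum>b\<in>set_pmf B. f (a, b) * (pmf A a * pmf B b))"
    unfolding sum.cartesian_product by (intro sum.cong) (auto simp: pmf_pair)
  also have "\<dots> = (\<Sum>a\<in>set_pmf A. measure_pmf.expectation B (\<lambda>b. f (a, b)) * pmf A a)"
    using assms
    by (subst integral_measure_pmf_real[of "set_pmf B"])
       (auto simp: sum_distrib_right intro!: sum.cong)
  also have "\<dots> = measure_pmf.expectation A (\<lambda>a. measure_pmf.expectation B (\<lambda>b. f (a, b)))"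
    using assms by (subst integral_measure_pmf_real[of "set_pmf A"]) auto
  finally show ?thesis .
qed

lemma prob_eq_expectation_of_bool:
  "measure_pmf.prob M {x. P x} = measure_pmf.expectation M (\<lambda>x. of_bool (P x))"
proof -
  have "measure_pmf.expectation M (\<lambda>x. of_bool (P x)) = measure_pmf.expectation M (indicator {x. P x})"
    by (intro Bochner_Integration.integral_cong) (auto simp: indicator_def)
  also have "\<dots> = measure_pmf.prob M {x. P x}" by simp
  finally show ?thesis ..
qed

lemma prob_pair_pmf_finite:
  assumes "finite (set_pmf A)" "finite (set_pmf B)"
  shows "measure_pmf.prob (pair_pmf A B) {p. P p} =
    measure_pmf.expectation A (\<lambda>a. measure_pmf.prob B {b. P (a, b)})"
  unfolding prob_eq_expectation_of_bool expectation_pair_pmf_finite[OF assms] ..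

lemma prob_pair_pmf_conj:
  assumes "finite (set_pmf A)" "finite (set_pmf B)"
  shows "measure_pmf.prob (pair_pmf A B) {p. P (fst p) \<and> Q (snd p)} =
    measure_pmf.prob A {a. P a} * measure_pmf.prob B {b. Q b}"
proof -
  have "measure_pmf.prob (pair_pmf A B) {p. P (fst p) \<and> Q (snd p)} =
      measure_pmf.expectation A (\<lambda>a. measure_pmf.prob B {b. P a \<and> Q b})"
    by (simp add: prob_pair_pmf_finite[OF assms])
  also have "\<dots> = measure_pmf.expectation A (\<lambda>a. of_bool (P a) * measure_pmf.prob B {b. Q b})"
    by (intro Bochner_Integration.integral_cong) auto
  also have "\<dots> = measure_pmf.expectation A (\<lambda>a. of_bool (P a)) * measure_pmf.prob B {b. Q b}"
    by (rule integral_mult_left_zero)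
  finally show ?thesis unfolding prob_eq_expectation_of_bool[of A] .
qed

lemma prob_bind_pmf_finite:
  assumes "finite (set_pmf A)"
  shows "measure_pmf.prob (bind_pmf A f) E = measure_pmf.expectation A (\<lambda>a. measure_pmf.prob (f a) E)"
proof -
  have "emeasure (bind_pmf A f) E = (\<integral>\<^sup>+x. ennreal (measure_pmf.prob (f x) E) \<partial>A)"
    unfolding emeasure_bind_pmf by (simp add: measure_pmf.emeasure_eq_measure)
  also have "\<dots> = ennreal (measure_pmf.expectation A (\<lambda>a. measure_pmf.prob (f a) E))"
    by (intro nn_integral_eq_integral integrable_measure_pmf_finite assms) auto
  finally show ?thesis
    by (simp add: measure_pmf.emeasure_eq_measure)
qed

text \<open>Markov's inequality for the square about a free centre \<open>m\<close>. With
  \<open>m\<close> at the mean it is Chebyshev's inequality, with \<open>m\<close> shifted by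
  variance over deviation it is Cantelli's, and a centre between two unequal gaps treats both tails
  at once.\<close>

lemma prob_Markov_square:
  assumes fin: "finite (set_pmf M)" and R: "(R::real) > 0"
    and imp: "\<And>\<omega>. P \<omega> \<Longrightarrow> R \<le> \<bar>Z \<omega> - m\<bar>"
  shows "measure_pmf.prob M {\<omega>. P \<omega>} \<le> measure_pmf.expectation M (\<lambda>\<omega>. (Z \<omega> - m)\<^sup>2) / R\<^sup>2"
proof -
  have *: "of_bool (P \<omega>) \<le> (Z \<omega> - m)\<^sup>2 / R\<^sup>2" for \<omega>
  proof (cases "P \<omega>")
    case True
    then have "R\<^sup>2 \<le> (Z \<omega> - m)\<^sup>2"
      using imp[OF True] R by (metis abs_of_pos power2_abs power_mono less_imp_le)
    with True R show ?thesis by simp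
  qed simp
  have "measure_pmf.prob M {\<omega>. P \<omega>} = measure_pmf.expectation M (\<lambda>\<omega>. of_bool (P \<omega>))"
    by (rule prob_eq_expectation_of_bool)
  also have "\<dots> \<le> measure_pmf.expectation M (\<lambda>\<omega>. (Z \<omega> - m)\<^sup>2 / R\<^sup>2)"
    using * by (intro integral_mono integrable_measure_pmf_finite fin)
  finally show ?thesis by simp
qed

section \<open>Pairwise independent random subsets and their second moments\<close>

text \<open>\<open>f \<omega> x\<close> reads: \<open>x\<close> survives the random constraint
  \<open>\<omega>\<close>. The law of pairs is what a second moment sees, and it is stable under
  independent conjunction. Finite support makes every real function integrable.\<close>

definition pairwise_sieve :: "'w pmf \<Rightarrow> ('w \<Rightarrow> 'x \<Rightarrow> bool) \<Rightarrow> 'x set \<Rightarrow> real \<Rightarrow> bool" where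
  "pairwise_sieve M f X q \<longleftrightarrow> finite (set_pmf M) \<and>
     (\<forall>x\<in>X. measure_pmf.prob M {\<omega>. f \<omega> x} = q) \<and>
     (\<forall>x\<in>X. \<forall>y\<in>X. x \<noteq> y \<longrightarrow> measure_pmf.prob M {\<omega>. f \<omega> x \<and> f \<omega> y} = q\<^sup>2)"

lemma pairwise_sieve_finite: "pairwise_sieve M f X q \<Longrightarrow> finite (set_pmf M)"
  by (simp add: pairwise_sieve_def)

lemma pairwise_sieve_subset:
  "pairwise_sieve M f X q \<Longrightarrow> Y \<subseteq> X \<Longrightarrow> pairwise_sieve M f Y q"
  by (auto simp: pairwise_sieve_def subset_eq)

text \<open>Bias-variance decomposition: the number of survivors has mean \<open>q * card X\<close>
  and variance \<open>q * (1 - q) * card X\<close>, as under full independence, because the square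
  of a sum of indicators involves only pairs.\<close>

lemma pairwise_sieve_second_moment:
  assumes "pairwise_sieve M f X q" "finite X"
  shows "measure_pmf.expectation M (\<lambda>\<omega>. (real (card {x\<in>X. f \<omega> x}) - m)\<^sup>2) =
    q * (1 - q) * real (card X) + (q * real (card X) - m)\<^sup>2"
proof -
  have fin: "finite (set_pmf M)"
    and p1: "\<And>x. x \<in> X \<Longrightarrow> measure_pmf.prob M {\<omega>. f \<omega> x} = q"
    and p2: "\<And>x y. x \<in> X \<Longrightarrow> y \<in> X \<Longrightarrow> x \<noteq> y \<Longrightarrow> measure_pmf.prob M {\<omega>. f \<omega> x \<and> f \<omega> y} = q\<^sup>2"
    using assms(1) by (auto simp: pairwise_sieve_def)
  let ?n = "real (card X)"
  note int = integrable_measure_pmf_finite[OF fin]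
  have card: "real (card {x\<in>X. f \<omega> x}) = (\<Sum>x\<in>X. of_bool (f \<omega> x))" for \<omega>
    using assms(2) by (simp add: Int_def)
  have sq: "(real (card {x\<in>X. f \<omega> x}) - m)\<^sup>2 =
      (\<Sum>x\<in>X. \<Sum>y\<in>X. of_bool (f \<omega> x \<and> f \<omega> y)) - 2 * m * (\<Sum>x\<in>X. of_bool (f \<omega> x)) + m\<^sup>2" for \<omega>
  proof -
    have "(\<Sum>x\<in>X. \<Sum>y\<in>X. of_bool (f \<omega> x \<and> f \<omega> y)) = (\<Sum>x\<in>X. of_bool (f \<omega> x) :: real)\<^sup>2"
      unfolding power2_eq_square sum_product by (simp only: of_bool_conj)
    then show ?thesis unfolding card power2_diff by simp
  qed
  have "measure_pmf.expectation M (\<lambda>\<omega>. (real (card {x\<in>X. f \<omega> x}) - m)\<^sup>2) =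
      (\<Sum>x\<in>X. \<Sum>y\<in>X. measure_pmf.prob M {\<omega>. f \<omega> x \<and> f \<omega> y})
      - 2 * m * (\<Sum>x\<in>X. measure_pmf.prob M {\<omega>. f \<omega> x}) + m\<^sup>2"
    unfolding sq prob_eq_expectation_of_bool
    by (simp add: int)
  also have "(\<Sum>x\<in>X. measure_pmf.prob M {\<omega>. f \<omega> x}) = ?n * q"
    using p1 by simp
  \<comment> \<open>The probability is \<open>q\<^sup>2\<close> off the diagonal and
    \<open>q\<close> on it; \<open>q - q\<^sup>2\<close> is the diagonal correction.\<close>
  also have "(\<Sum>x\<in>X. \<Sum>y\<in>X. measure_pmf.prob M {\<omega>. f \<omega> x \<and> f \<omega> y}) =
      (\<Sum>x\<in>X. \<Sum>y\<in>X. q\<^sup>2 + (if y = x then q - q\<^sup>2 else 0))"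
    using p1 p2 by (intro sum.cong refl) auto
  also have "\<dots> = (\<Sum>x\<in>X. ?n * q\<^sup>2 + (q - q\<^sup>2))"
    using assms(2) by (intro sum.cong refl) (simp add: sum.distrib)
  also have "\<dots> = ?n * (?n * q\<^sup>2 + (q - q\<^sup>2))"
    by simp
  finally show ?thesis
    by (simp add: power2_eq_square algebra_simps)
qed

text \<open>The factor \<open>1 - q\<close> in the variance is estimated by 1, so that the bound
  depends on the mean \<open>\<mu>\<close> alone.\<close>

lemma pairwise_sieve_deviation:
  assumes "pairwise_sieve M f X q" "finite X" "0 \<le> q" "R > 0" "\<mu> = q * real (card X)"
    and "\<And>\<omega>. P \<omega> \<Longrightarrow> R \<le> \<bar>real (card {x\<in>X. f \<omega> x}) - m\<bar>"
  shows "measure_pmf.prob M {\<omega>. P \<omega>} \<le> (\<mu> + (\<mu> - m)\<^sup>2) / R\<^sup>2"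
proof -
  have "measure_pmf.prob M {\<omega>. P \<omega>} \<le>
      (q * (1 - q) * real (card X) + (q * real (card X) - m)\<^sup>2) / R\<^sup>2"
    using prob_Markov_square[where Z = "\<lambda>\<omega>. real (card {x\<in>X. f \<omega> x})" and m = m,
        OF pairwise_sieve_finite[OF assms(1)] assms(4,6)]
    unfolding pairwise_sieve_second_moment[OF assms(1,2)] by blast
  also have "\<dots> \<le> (\<mu> + (\<mu> - m)\<^sup>2) / R\<^sup>2"
  proof (intro divide_right_mono add_mono)
    have "q * q * real (card X) \<ge> 0" by simp
    then show "q * (1 - q) * real (card X) \<le> \<mu>"
      using assms(5) by (simp add: algebra_simps)
  qed (use assms in auto)
  finally show ?thesis .
qed

lemma pairwise_sieve_pair:
  assumes "pairwise_sieve M f X q" "pairwise_sieve M' g X q'"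
  shows "pairwise_sieve (pair_pmf M M') (\<lambda>\<omega> x. f (fst \<omega>) x \<and> g (snd \<omega>) x) X (q * q')"
proof -
  have fin: "finite (set_pmf M)" "finite (set_pmf M')"
    using assms by (auto simp: pairwise_sieve_def)
  have *: "measure_pmf.prob (pair_pmf M M')
        {\<omega>. (f (fst \<omega>) x \<and> g (snd \<omega>) x) \<and> f (fst \<omega>) y \<and> g (snd \<omega>) y} =
      measure_pmf.prob M {\<omega>. f \<omega> x \<and> f \<omega> y} * measure_pmf.prob M' {\<omega>. g \<omega> x \<and> g \<omega> y}" for x y
    unfolding prob_pair_pmf_conj[OF fin, symmetric] by (intro arg_cong2[of _ _ _ _ measure]) auto
  have **: "measure_pmf.prob (pair_pmf M M') {\<omega>. f (fst \<omega>) x \<and> g (snd \<omega>) x} =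
      measure_pmf.prob M {\<omega>. f \<omega> x} * measure_pmf.prob M' {\<omega>. g \<omega> x}" for x
    by (rule prob_pair_pmf_conj[OF fin])
  show ?thesis
    using assms fin unfolding pairwise_sieve_def * **
    by (auto simp: power_mult_distrib)
qed

lemma finite_set_replicate_pmf:
  "finite (set_pmf p) \<Longrightarrow> finite (set_pmf (replicate_pmf n p))"
  by (induction n) auto

lemma pairwise_sieve_of_map:
  "finite (set_pmf M) \<Longrightarrow> pairwise_sieve (map_pmf h M) f X q \<Longrightarrow> pairwise_sieve M (\<lambda>\<omega>. f (h \<omega>)) X q"
  unfolding pairwise_sieve_def by (simp add: vimage_def)

text \<open>Isolates one hash: the prefix before position \<open>j\<close> and the hash at
  \<open>j\<close> are independent. This is what allows conditioning a cell on all of its hashes but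
  the last.\<close>

lemma map_take_nth_replicate_pmf:
  assumes "j < N"
  shows "map_pmf (\<lambda>hs. (take j hs, hs ! j)) (replicate_pmf N p) = pair_pmf (replicate_pmf j p) p"
  using assms
proof (induction N arbitrary: j)
  case (Suc N)
  show ?case
  proof (cases j)
    case 0
    then show ?thesis
      by (simp add: pair_pmf_def bind_return_pmf map_pmf_def bind_assoc_pmf)
  next
    case (Suc i)
    with Suc.prems have "i < N" by simp
    have "map_pmf (\<lambda>hs. (take j hs, hs ! j)) (replicate_pmf (Suc N) p) =
        do {x \<leftarrow> p; (xs, y) \<leftarrow> map_pmf (\<lambda>hs. (take i hs, hs ! i)) (replicate_pmf N p);
            return_pmf (x # xs, y)}"
      using Suc by (simp add: map_pmf_def bind_assoc_pmf bind_return_pmf)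
    also have "\<dots> = pair_pmf (replicate_pmf j p) p"
      unfolding Suc.IH[OF \<open>i < N\<close>] using Suc
      by (simp add: pair_pmf_def bind_assoc_pmf bind_return_pmf)
    finally show ?thesis .
  qed
qed simp

lemma map_take_replicate_pmf:
  assumes "k \<le> N"
  shows "map_pmf (take k) (replicate_pmf N p) = replicate_pmf k p"
proof (cases "k = N")
  case True
  have "map_pmf (take N) (replicate_pmf N p) = map_pmf id (replicate_pmf N p)"
    by (intro map_pmf_cong) (auto simp: set_replicate_pmf)
  with True show ?thesis by simp
next
  case False
  with assms have "map_pmf fst (map_pmf (\<lambda>hs. (take k hs, hs ! k)) (replicate_pmf N p)) = replicate_pmf k p"
    by (simp add: map_take_nth_replicate_pmf map_fst_pair_pmf)
  then show ?thesis by (simp add: pmf.map_comp o_def)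
qed

lemma pairwise_sieve_replicate:
  assumes "pairwise_sieve H (\<lambda>h. h) X q"
  shows "pairwise_sieve (replicate_pmf k H) (\<lambda>hs x. \<forall>h\<in>set hs. h x) X (q ^ k)"
proof (induction k)
  case 0
  then show ?case by (simp add: pairwise_sieve_def)
next
  case (Suc k)
  have fin: "finite (set_pmf H)" using assms by (simp add: pairwise_sieve_def)
  have rep: "replicate_pmf (Suc k) H = map_pmf (\<lambda>p. fst p # snd p) (pair_pmf H (replicate_pmf k H))"
    by (simp add: pair_pmf_def map_bind_pmf)
  have "{\<omega>. (fst \<omega> x \<and> (\<forall>h\<in>set (snd \<omega>). h x)) \<and> fst \<omega> y \<and> (\<forall>h\<in>set (snd \<omega>). h y)} =
      (\<lambda>p. fst p # snd p) -` {hs. (\<forall>h\<in>set hs. h x) \<and> (\<forall>h\<in>set hs. h y)}" for x y :: 'a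
    by auto
  moreover have "{\<omega>. fst \<omega> x \<and> (\<forall>h\<in>set (snd \<omega>). h x)} =
      (\<lambda>p. fst p # snd p) -` {hs. \<forall>h\<in>set hs. h x}" for x :: 'a
    by auto
  ultimately show ?case
    using pairwise_sieve_pair[OF assms Suc] unfolding rep pairwise_sieve_def
    by (simp add: fin finite_set_replicate_pmf del: replicate_pmf.simps)
qed

lemma pairwise_sieve_replicate_take:
  assumes "pairwise_sieve H (\<lambda>h. h) X q" "k \<le> N"
  shows "pairwise_sieve (replicate_pmf N H) (\<lambda>hs x. \<forall>h\<in>set (take k hs). h x) X (q ^ k)"
proof (rule pairwise_sieve_of_map[where f = "\<lambda>hs x. \<forall>h\<in>set hs. h x" and h = "take k"])
  show "finite (set_pmf (replicate_pmf N H))"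
    using assms by (simp add: pairwise_sieve_def finite_set_replicate_pmf)
  show "pairwise_sieve (map_pmf (take k) (replicate_pmf N H)) (\<lambda>hs x. \<forall>h\<in>set hs. h x) X (q ^ k)"
    unfolding map_take_replicate_pmf[OF assms(2)] by (rule pairwise_sieve_replicate[OF assms(1)])
qed

text \<open>
  Sharpens the union bound for a deviation of the last cell and an event \<open>E\<close> that is independent
  of the last hash: the random cell keeps a conditional variance, so the Chebyshev integrand has
  mass on \<open>E\<close> which the union bound would count twice.
\<close>

lemma prob_union_deviation:
  assumes M: "finite (set_pmf M)" and H: "pairwise_sieve H g X q" and q: "0 \<le> q" "q \<le> 1"
    and B: "\<And>\<omega>. B \<omega> \<subseteq> X" and X: "finite X" and R: "R > 0"
    and dev: "\<And>\<omega> h. P \<omega> h \<Longrightarrow> R \<le> \<bar>real (card {x\<in>B \<omega>. g h x}) - m\<bar>"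
    and \<kappa>: "\<kappa> * R\<^sup>2 \<le> (1 - q) * (m - 1 / 4)"
    and var: "measure_pmf.expectation (pair_pmf M H)
        (\<lambda>p. (real (card {x\<in>B (fst p). g (snd p) x}) - m)\<^sup>2) \<le> v"
  shows "measure_pmf.prob (pair_pmf M H) {p. E (fst p) \<or> P (fst p) (snd p)} \<le>
      (1 - \<kappa>) * measure_pmf.prob M {\<omega>. E \<omega>} + v / R\<^sup>2"
proof -
  have finH: "finite (set_pmf H)" by (rule pairwise_sieve_finite[OF H])
  define V where "V \<omega> = measure_pmf.expectation H (\<lambda>h. (real (card {x\<in>B \<omega>. g h x}) - m)\<^sup>2)" for \<omega>
  have V: "V \<omega> = q * (1 - q) * real (card (B \<omega>)) + (q * real (card (B \<omega>)) - m)\<^sup>2" for \<omega>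
    unfolding V_def
    by (rule pairwise_sieve_second_moment[OF pairwise_sieve_subset[OF H B] finite_subset[OF B X]])
  have V_ge: "\<kappa> * R\<^sup>2 \<le> V \<omega>" for \<omega>
  proof -
    \<comment> \<open>As a function of the conditional mean \<open>y\<close> the second moment is a
      quadratic; completing the square gives the minimum \<open>D * m - D\<^sup>2 / 4\<close>, which
      is at least \<open>D * (m - 1 / 4)\<close> because \<open>D \<le> 1\<close>.\<close>
    define y D where "y = q * real (card (B \<omega>))" and "D = 1 - q"
    have "V \<omega> = D * y + (y - m)\<^sup>2" unfolding V y_def D_def by simp
    also have "\<dots> = (y - m + D / 2)\<^sup>2 + D * m - D * D / 4"
      by (simp add: power2_eq_square field_simps)
    finally have "V \<omega> \<ge> D * m - D * D / 4" by simp
    moreover have "D * D \<le> D * 1"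
      using q by (intro mult_left_mono) (auto simp: D_def)
    moreover have "D * (m - 1 / 4) = D * m - D / 4" by (simp add: algebra_simps)
    ultimately show ?thesis
      using \<kappa> unfolding D_def[symmetric] by linarith
  qed
  \<comment> \<open>On \<open>E\<close> the probability is 1, paid as \<open>1 - \<kappa>\<close>
    plus a second moment that is at least \<open>\<kappa>\<close> after division by
    \<open>R\<^sup>2\<close>; off \<open>E\<close> the Markov bound applies.\<close>
  have step: "measure_pmf.prob H {h. E \<omega> \<or> P \<omega> h} \<le> (1 - \<kappa>) * of_bool (E \<omega>) + V \<omega> / R\<^sup>2" for \<omega>
  proof (cases "E \<omega>")
    case True
    have "\<kappa> \<le> V \<omega> / R\<^sup>2" using V_ge[of \<omega>] R by (simp add: field_simps)
    then show ?thesis using True by simp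
  next
    case False
    have "measure_pmf.prob H {h. P \<omega> h} \<le> V \<omega> / R\<^sup>2"
      unfolding V_def by (rule prob_Markov_square[OF finH R]) (rule dev)
    then show ?thesis using False by simp
  qed
  have "measure_pmf.prob (pair_pmf M H) {p. E (fst p) \<or> P (fst p) (snd p)} =
      measure_pmf.expectation M (\<lambda>\<omega>. measure_pmf.prob H {h. E \<omega> \<or> P \<omega> h})"
    by (simp add: prob_pair_pmf_finite[OF M finH])
  also have "\<dots> \<le> measure_pmf.expectation M (\<lambda>\<omega>. (1 - \<kappa>) * of_bool (E \<omega>) + V \<omega> / R\<^sup>2)"
    using step by (intro integral_mono integrable_measure_pmf_finite M)
  also have "\<dots> = (1 - \<kappa>) * measure_pmf.prob M {\<omega>. E \<omega>} + measure_pmf.expectation M V / R\<^sup>2"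
    by (simp add: integrable_measure_pmf_finite[OF M] prob_eq_expectation_of_bool)
  also have "measure_pmf.expectation M V = measure_pmf.expectation (pair_pmf M H)
        (\<lambda>p. (real (card {x\<in>B (fst p). g (snd p) x}) - m)\<^sup>2)"
    unfolding V_def by (simp add: expectation_pair_pmf_finite[OF M finH])
  finally show ?thesis
    using divide_right_mono[OF var, of "R\<^sup>2"] by simp
qed

section \<open>Hash families\<close>

text \<open>Adding \<open>t\<close> modulo \<open>n\<close> permutes the residues.\<close>

lemma card_shift_mod:
  fixes n :: nat
  assumes "n > 0"
  shows "card {c\<in>{..<n}. P ((c + t) mod n)} = card {c\<in>{..<n}. P c}"
proof -
  have inj: "inj_on (\<lambda>c. (c + t) mod n) {..<n}"
    by (auto simp: inj_on_def cong_def[symmetric] cong_add_rcancel_nat dest: cong_less_modulus_unique_nat)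
  have "(\<lambda>c. (c + t) mod n) ` {..<n} \<subseteq> {..<n}" using assms by auto
  then have surj: "(\<lambda>c. (c + t) mod n) ` {..<n} = {..<n}"
    using inj by (intro card_subset_eq) (auto simp: card_image)
  have "\<exists>c<n. x = (c + t) mod n" if "x < n" for x
  proof -
    have "x \<in> (\<lambda>c. (c + t) mod n) ` {..<n}" using that surj by simp
    then show ?thesis by auto
  qed
  then have "(\<lambda>c. (c + t) mod n) ` {c\<in>{..<n}. P ((c + t) mod n)} = {c\<in>{..<n}. P c}"
    using assms by fastforce
  moreover have "inj_on (\<lambda>c. (c + t) mod n) {c\<in>{..<n}. P ((c + t) mod n)}"
    using inj by (rule inj_on_subset) blast
  ultimately show ?thesis using card_image[of "\<lambda>c. (c + t) mod n" "{c\<in>{..<n}. P ((c + t) mod n)}"] by simp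
qed

text \<open>
  Translating \<open>c\<close> by a solution \<open>c\<^sub>0\<close> of \<open>c\<^sub>0 d = g\<close> modulo \<open>n\<close> moves the block of \<open>c d + k\<close>
  to the next one, so all blocks are hit equally often.
\<close>

lemma card_affine_block:
  fixes d k :: int and n g r :: nat
  assumes n: "n = g * r" "n > 0" and d: "[int c\<^sub>0 * d = int g] (mod int n)" and \<beta>: "\<beta> < r"
  shows "card {c\<in>{..<n}. (int c * d + k) mod int n div int g = int \<beta>} = g"
proof -
  define f where "f c = (c * d + k) mod int n div int g" for c
  have g: "g > 0" and r: "r > 0" using n by auto
  \<comment> \<open>Reducing modulo \<open>n = g * r\<close> and then taking the block of length
    \<open>g\<close> is taking the block number modulo \<open>r\<close>; adding \<open>g\<close>
    thus advances the block cyclically by one.\<close>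
  have blk: "u mod int n div int g = u div int g mod int r" for u :: int
  proof -
    have "u mod (int g * int r) = int g * (u div int g mod int r) + u mod int g"
      using g by (simp add: zmod_zmult2_eq)
    then show ?thesis using g n by simp
  qed
  have f_nonneg: "0 \<le> f c" "f c < int r" for c
    using r unfolding f_def blk by simp_all
  have shift: "f (int ((c + c\<^sub>0) mod n)) = (f (int c) + 1) mod int r" for c
  proof -
    have "[int ((c + c\<^sub>0) mod n) * d + k = (int c + int c\<^sub>0) * d + k] (mod int n)"
      by (intro cong_add cong_mult cong_refl) (simp add: cong_def zmod_int)
    also have "(int c + int c\<^sub>0) * d + k = (int c * d + k) + int c\<^sub>0 * d" by (simp add: algebra_simps)
    also have "[\<dots> = (int c * d + k) + int g] (mod int n)" using d by (intro cong_add cong_refl)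
    finally have "f (int ((c + c\<^sub>0) mod n)) = ((int c * d + k) + int g) mod int n div int g"
      by (simp add: f_def cong_def)
    also have "\<dots> = ((int c * d + k) div int g + 1) mod int r" unfolding blk using g by simp
    also have "\<dots> = (f (int c) + 1) mod int r" unfolding f_def blk by (simp add: mod_add_left_eq)
    finally show ?thesis .
  qed
  define N where "N \<beta> = card {c\<in>{..<n}. f (int c) = int \<beta>}" for \<beta>
  have step: "N (Suc \<beta>) = N \<beta>" if "Suc \<beta> < r" for \<beta>
  proof -
    have eq: "(f (int c) + 1) mod int r = int (Suc \<beta>) \<longleftrightarrow> f (int c) = int \<beta>" for c
    proof (cases "f (int c) + 1 = int r")
      case True
      then show ?thesis using that by auto
    next
      case False
      then have "f (int c) + 1 < int r" using f_nonneg[of "int c"] by simp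
      then show ?thesis using f_nonneg[of "int c"] by auto
    qed
    have "N (Suc \<beta>) = card {c\<in>{..<n}. f (int ((c + c\<^sub>0) mod n)) = int (Suc \<beta>)}"
      unfolding N_def by (rule card_shift_mod[OF n(2), symmetric])
    then show ?thesis unfolding shift eq N_def .
  qed
  have const: "\<beta> < r \<Longrightarrow> N \<beta> = N 0" for \<beta>
    by (induction \<beta>) (use step in auto)
  have "{..<n} = (\<Union>\<beta><r. {c\<in>{..<n}. f (int c) = int \<beta>})"
    using f_nonneg by (auto intro!: bexI[of _ "nat (f (int c))" for c] simp: nat_less_iff)
  then have "n = card (\<Union>\<beta><r. {c\<in>{..<n}. f (int c) = int \<beta>})" by (metis card_lessThan)
  also have "\<dots> = (\<Sum>\<beta><r. N \<beta>)"
    unfolding N_def by (intro card_UN_disjoint) auto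
  also have "\<dots> = (\<Sum>\<beta><r. N 0)" by (intro sum.cong refl const) simp
  also have "\<dots> = r * N 0" by simp
  finally have "N 0 = g" using n r by simp
  then show ?thesis using const[OF \<beta>] unfolding N_def f_def by simp
qed

text \<open>Bezout gives a multiple of \<open>d\<close> congruent to the gcd, which is scaled up to
  \<open>g\<close>; the coefficient is reduced modulo \<open>n\<close> to become a natural
  number.\<close>

lemma ex_mult_cong:
  fixes d :: int
  assumes "gcd d (int n) dvd int g" "n > 0"
  shows "\<exists>c\<^sub>0. [int c\<^sub>0 * d = int g] (mod int n)"
proof -
  obtain x where "[d * x = gcd d (int n)] (mod int n)" using cong_solve_int[of d "int n"] by auto
  moreover obtain e where "int g = gcd d (int n) * e" using assms by blast
  ultimately have "[d * x * e = int g] (mod int n)" by (metis cong_scalar_right)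
  then have "[int (nat ((x * e) mod int n)) * d = int g] (mod int n)"
    using assms(2) by (simp add: cong_def mod_mult_right_eq mult_ac)
  then show ?thesis by blast
qed

lemma pmf_of_set_PiE_insert:
  assumes "finite I" "i \<notin> I" "finite B" "B \<noteq> {}"
  shows "pmf_of_set (insert i I \<rightarrow>\<^sub>E B) =
    do {f \<leftarrow> pmf_of_set (I \<rightarrow>\<^sub>E B); y \<leftarrow> pmf_of_set B; return_pmf (f(i := y))}"
proof -
  have dflt: "pmf_of_set (J \<rightarrow>\<^sub>E B) = Pi_pmf J undefined (\<lambda>_. pmf_of_set B)" if "finite J" for J
  proof -
    have "PiE_dflt J undefined (\<lambda>_. B) = (J \<rightarrow>\<^sub>E B)"
      by (auto simp: PiE_dflt_def PiE_def extensional_def)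
    then show ?thesis using Pi_pmf_of_set[OF that, of "\<lambda>_. B" undefined] assms by simp
  qed
  show ?thesis
    using assms
    by (simp add: dflt Pi_pmf_insert' bind_commute_pmf[of "pmf_of_set B"])
qed

text \<open>Conditioning on all coordinates but \<open>i\<close>: if the probability over coordinate
  \<open>i\<close> is \<open>p\<close> whatever the others are, it is \<open>p\<close> overall. Used
  with \<open>i\<close> an index at which two hash inputs differ.\<close>

lemma prob_pmf_of_set_PiE_coordinate:
  assumes I: "finite I" "i \<in> I" and B: "finite B" "B \<noteq> {}"
    and c: "\<And>f. measure_pmf.prob (pmf_of_set B) {y. P (f(i := y))} = p"
  shows "measure_pmf.prob (pmf_of_set (I \<rightarrow>\<^sub>E B)) {a. P a} = p"
proof -
  let ?J = "I - {i}"
  have fin: "finite (?J \<rightarrow>\<^sub>E B)" and ne: "(?J \<rightarrow>\<^sub>E B) \<noteq> {}"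
    using I B by (auto intro!: finite_PiE simp: PiE_eq_empty_iff lessThan_empty_iff)
  have "pmf_of_set (I \<rightarrow>\<^sub>E B) =
      do {f \<leftarrow> pmf_of_set (?J \<rightarrow>\<^sub>E B); y \<leftarrow> pmf_of_set B; return_pmf (f(i := y))}"
    using pmf_of_set_PiE_insert[of ?J i B] I B by (simp add: insert_absorb)
  also have "\<dots> = do {f \<leftarrow> pmf_of_set (?J \<rightarrow>\<^sub>E B); map_pmf (\<lambda>y. f(i := y)) (pmf_of_set B)}"
    by (simp add: map_pmf_def)
  finally show ?thesis
    using c by (simp add: prob_bind_pmf_finite fin ne vimage_def)
qed

lemma sum_fun_upd_mult:
  fixes x :: "'i \<Rightarrow> nat"
  assumes "finite I" "i \<in> I"
  shows "(\<Sum>j\<in>I. (f(i := y)) j * x j) = y * x i + (\<Sum>j\<in>I - {i}. f j * x j)"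
proof -
  have "(\<Sum>j\<in>I. (f(i := y)) j * x j) = (f(i := y)) i * x i + (\<Sum>j\<in>I - {i}. (f(i := y)) j * x j)"
    using assms by (rule sum.remove)
  also have "(\<Sum>j\<in>I - {i}. (f(i := y)) j * x j) = (\<Sum>j\<in>I - {i}. f j * x j)"
    by (intro sum.cong) auto
  finally show ?thesis by simp
qed

text \<open>The inputs differ at \<open>i\<close> by a unit \<open>d\<close> modulo
  \<open>p\<close>. With the other coefficients fixed, the difference of the sums is
  \<open>c * d + k\<close> in the coefficient \<open>c\<close> at \<open>i\<close> and vanishes for
  exactly one \<open>c\<close>: the case of blocks of length 1. The offset \<open>b\<close> cancels,
  so it may be random or, as for XOR, zero.\<close>

lemma prob_linear_mod_prime_collision:
  fixes x y :: "'i \<Rightarrow> nat"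
  assumes p: "prime p" and I: "finite I" "i \<in> I" and xy: "x i < p" "y i < p" "x i \<noteq> y i"
  shows "measure_pmf.prob (pmf_of_set (I \<rightarrow>\<^sub>E {..<p}))
      {a. ((\<Sum>j\<in>I. a j * x j) + b) mod p = ((\<Sum>j\<in>I. a j * y j) + b) mod p} = 1 / p"
proof (rule prob_pmf_of_set_PiE_coordinate[OF I])
  have p0: "p > 0" using p by (simp add: prime_gt_0_nat)
  then show "{..<p} \<noteq> {}" by (simp add: lessThan_empty_iff)
  fix f :: "'i \<Rightarrow> nat"
  define s where "s z = (\<Sum>j\<in>I - {i}. f j * z j)" for z
  define d where "d = int (x i) - int (y i)"
  have "\<not> int p dvd d"
    using xy zdvd_not_zless[of "\<bar>d\<bar>" "int p"] by (auto simp: d_def)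
  then have "coprime d (int p)"
    using p by (intro coprime_commute[THEN iffD1, OF prime_imp_coprime]) auto
  then obtain c0 where c0: "[int c0 * d = int 1] (mod int p)"
    using ex_mult_cong[of d p 1] p0 by (auto simp: coprime_iff_gcd_eq_1)
  have eq: "(((\<Sum>j\<in>I. (f(i := c)) j * x j) + b) mod p = ((\<Sum>j\<in>I. (f(i := c)) j * y j) + b) mod p) \<longleftrightarrow>
      (int c * d + (int (s x) - int (s y))) mod int p div int 1 = int 0" for c
  proof -
    have "(((\<Sum>j\<in>I. (f(i := c)) j * x j) + b) mod p = ((\<Sum>j\<in>I. (f(i := c)) j * y j) + b) mod p) \<longleftrightarrow>
        [int (c * x i + s x + b) = int (c * y i + s y + b)] (mod int p)"
      unfolding sum_fun_upd_mult[OF I] s_def[symmetric] cong_int_iff by (simp add: cong_def)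
    also have "\<dots> \<longleftrightarrow> [int (c * x i + s x + b) - int (c * y i + s y + b) = 0] (mod int p)"
      by (simp add: cong_iff_dvd_diff)
    also have "int (c * x i + s x + b) - int (c * y i + s y + b) = int c * d + (int (s x) - int (s y))"
      by (simp add: d_def algebra_simps)
    finally show ?thesis by (simp add: cong_def)
  qed
  have "card {c\<in>{..<p}. (int c * d + (int (s x) - int (s y))) mod int p div int 1 = int 0} = 1"
    by (rule card_affine_block[OF _ p0 c0, of p 0]) (use p0 in auto)
  then have "card ({..<p} \<inter> {c. (int c * d + (int (s x) - int (s y))) mod int p div int 1 = int 0}) = 1"
    by (simp add: Int_def)
  then show "measure_pmf.prob (pmf_of_set {..<p})
      {c. ((\<Sum>j\<in>I. (f(i := c)) j * x j) + b) mod p = ((\<Sum>j\<in>I. (f(i := c)) j * y j) + b) mod p} = 1 / p"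
    unfolding eq using p0 by (subst measure_pmf_of_set) auto
qed auto

text \<open>Agreement of the top bits is not a condition on the difference of the two sums alone, so
  the uniform offset is first translated to make the second argument uniform and independent of the
  coefficients. Given that argument, \<open>c * d + k\<close> must fall into one prescribed block as
  the coefficient \<open>c\<close> at \<open>i\<close> varies. The blocks are hit equally often
  because the power of two in \<open>d\<close> is at most \<open>2 ^ (w - 1)\<close>, a divisor of
  the block length.\<close>

lemma prob_multiply_shift_collision:
  fixes x y :: "'i \<Rightarrow> nat"
  assumes I: "finite I" "i \<in> I" and xy: "x i < 2 ^ w" "y i < 2 ^ w" "x i \<noteq> y i"
    and W: "w + l - 1 \<le> W" "1 \<le> w" "1 \<le> l"
  shows "measure_pmf.prob (pair_pmf (pmf_of_set (I \<rightarrow>\<^sub>E {..<2 ^ W})) (pmf_of_set {..<2 ^ W}))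
      {p. take_bit l (drop_bit (W - l) ((\<Sum>j\<in>I. fst p j * x j) + snd p)) =
          take_bit l (drop_bit (W - l) ((\<Sum>j\<in>I. fst p j * y j) + snd p))} = 1 / 2 ^ l"
proof -
  define n g where "n = (2::nat) ^ W" and "g = (2::nat) ^ (W - l)"
  have lW: "l \<le> W" using W by simp
  have ng: "n = g * 2 ^ l" "n > 0" "g > 0"
    using lW by (auto simp: n_def g_def simp flip: power_add)
  define d where "d = int (x i) - int (y i)"
  have top: "take_bit l (drop_bit (W - l) u) = u mod n div g" for u :: nat
    using lW take_bit_drop_bit[of l "W - l" u]
    by (simp add: drop_bit_eq_div take_bit_eq_mod n_def g_def)
  have "gcd d (int n) dvd int g"
  proof -
    have "gcd d (int n) dvd (2::int) ^ W" by (simp add: n_def)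
    then obtain e where "normalize (gcd d (int n)) = normalize (2 ^ e)"
      by (rule divides_primepow_weak[rotated]) auto
    then have e': "gcd d (int n) = 2 ^ e" by simp
    have "2 ^ e dvd d" by (metis e' gcd_dvd1)
    \<comment> \<open>\<open>2 ^ e\<close> divides a nonzero difference of two \<open>w\<close>-bit
      numbers, hence \<open>e < w\<close>, and \<open>w + l - 1 \<le> W\<close> yields
      \<open>e \<le> W - l\<close>.\<close>
    then have "(2::int) ^ e \<le> \<bar>d\<bar>" using xy by (intro zdvd_imp_le) (auto simp: d_def)
    also have "\<bar>d\<bar> < 2 ^ w"
    proof -
      have "int (x i) < int (2 ^ w)" "int (y i) < int (2 ^ w)" using xy by (simp_all only: of_nat_less_iff)
      then have "\<bar>d\<bar> < int (2 ^ w)" unfolding d_def by linarith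
      then show ?thesis by simp
    qed
    finally have "e < w" by simp
    then have "e \<le> W - l" using W by simp
    then show ?thesis unfolding e' g_def by (simp add: le_imp_power_dvd)
  qed
  then obtain c0 where c0: "[int c0 * d = int g] (mod int n)"
    using ex_mult_cong[of d n g] ng by auto
  let ?E = "\<lambda>a b. ((\<Sum>j\<in>I. a j * x j) + b) mod n div g = ((\<Sum>j\<in>I. a j * y j) + b) mod n div g"
  let ?A = "pmf_of_set (I \<rightarrow>\<^sub>E {..<n})" and ?B = "pmf_of_set {..<n}"
  have nemp: "{..<n} \<noteq> {}" using ng by (simp add: lessThan_empty_iff)
  have finA: "finite (I \<rightarrow>\<^sub>E {..<n})" "(I \<rightarrow>\<^sub>E {..<n}) \<noteq> {}"
    using I nemp by (auto intro!: finite_PiE simp: PiE_eq_empty_iff lessThan_empty_iff)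
  have probB: "measure_pmf.prob ?B {b. Q b} = real (card {b\<in>{..<n}. Q b}) / n" for Q
    using nemp by (subst measure_pmf_of_set) (auto simp: Int_def)
  define s where "s a z = (\<Sum>j\<in>I. a j * z j)" for a z :: "'i \<Rightarrow> nat"
  define k where "k a = int (s a x) - int (s a y)" for a
  \<comment> \<open>With \<open>b\<close> standing for the translated offset, the second hash value
    is \<open>b div g\<close> and the first is the block of \<open>b + k a\<close>.\<close>
  define Z where "Z a b \<longleftrightarrow> (int b + k a) mod int n div int g = int (b div g)" for a and b :: nat
  have inner: "measure_pmf.prob ?B {b. ?E a b} = measure_pmf.prob ?B {b. Z a b}" for a
  proof -
    have eq: "?E a b \<longleftrightarrow> Z a ((b + s a y) mod n)" for b
    proof -
      have "[int (b + s a x) = int ((b + s a y) mod n) + k a] (mod int n)"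
      proof -
        have "int (b + s a x) = int (b + s a y) + k a" by (simp add: k_def)
        also have "[\<dots> = int ((b + s a y) mod n) + k a] (mod int n)"
          by (intro cong_add cong_refl) (simp add: cong_def zmod_int)
        finally show ?thesis .
      qed
      then have "int ((s a x + b) mod n div g) = (int ((b + s a y) mod n) + k a) mod int n div int g"
        by (simp add: cong_def zdiv_int zmod_int add.commute)
      moreover have "(s a x + b) mod n div g = v \<longleftrightarrow> int ((s a x + b) mod n div g) = int v" for v
        by (simp only: of_nat_eq_iff)
      ultimately show ?thesis unfolding Z_def s_def[symmetric] by (simp add: add.commute)
    qed
    show ?thesis unfolding probB eq using card_shift_mod[OF ng(2), of "Z a"] by simp
  qed
  have outer: "measure_pmf.prob ?A {a. Z a b} = 1 / 2 ^ l" if b: "b < n" for b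
  proof (rule prob_pmf_of_set_PiE_coordinate[OF I _ nemp])
    fix f :: "'i \<Rightarrow> nat"
    define k' where "k' = int b + int (\<Sum>j\<in>I - {i}. f j * x j) - int (\<Sum>j\<in>I - {i}. f j * y j)"
    have eq: "Z (f(i := c)) b \<longleftrightarrow> (int c * d + k') mod int n div int g = int (b div g)" for c
    proof -
      have "int b + k (f(i := c)) = int c * d + k'"
        unfolding k_def s_def sum_fun_upd_mult[OF I] by (simp add: k'_def d_def algebra_simps)
      then show ?thesis by (simp add: Z_def)
    qed
    have "card {c\<in>{..<n}. (int c * d + k') mod int n div int g = int (b div g)} = g"
      by (rule card_affine_block[OF ng(1,2) c0])
         (use b ng in \<open>simp add: div_less_iff_less_mult mult.commute\<close>)
    then show "measure_pmf.prob ?B {c. Z (f(i := c)) b} = 1 / 2 ^ l"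
      unfolding eq probB using ng by simp
  qed simp
  have "measure_pmf.prob (pair_pmf ?A ?B) {p. ?E (fst p) (snd p)} =
      measure_pmf.expectation ?A (\<lambda>a. measure_pmf.prob ?B {b. ?E a b})"
    using finA nemp by (subst prob_pair_pmf_finite) auto
  also have "\<dots> = measure_pmf.expectation ?A (\<lambda>a. measure_pmf.prob ?B {b. Z a b})"
    unfolding inner ..
  also have "\<dots> = measure_pmf.prob (pair_pmf ?A ?B) {p. Z (fst p) (snd p)}"
    using finA nemp by (subst prob_pair_pmf_finite) auto
  \<comment> \<open>Exchanging the order of integration fixes the offset, so that the coefficient at
    \<open>i\<close> becomes the last variable.\<close>
  also have "\<dots> = measure_pmf.prob (pair_pmf ?B ?A) {p. Z (snd p) (fst p)}"
    by (subst pair_commute_pmf) (simp add: vimage_def case_prod_beta)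
  also have "\<dots> = measure_pmf.expectation ?B (\<lambda>b. measure_pmf.prob ?A {a. Z a b})"
    using finA nemp by (subst prob_pair_pmf_finite) auto
  also have "\<dots> = measure_pmf.expectation ?B (\<lambda>b. 1 / 2 ^ l)"
    using nemp outer by (intro integral_cong_AE) (auto simp: AE_measure_pmf_iff)
  finally show ?thesis
    unfolding top n_def by simp
qed

section \<open>Range sizes and exact collision probabilities of the families\<close>

lemma prime_next_prime: "prime (next_prime n)" and next_prime_gt: "n < next_prime n"
proof -
  have "prime (next_prime n) \<and> n < next_prime n"
    unfolding next_prime_def by (rule LeastI_ex) (use bigger_prime in blast)
  then show "prime (next_prime n)" "n < next_prime n" by auto
qed

lemma next_prime_eqI:
  assumes "prime p" "n < p" "\<And>k. n < k \<Longrightarrow> k < p \<Longrightarrow> \<not> prime k"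
  shows "next_prime n = p"
  unfolding next_prime_def by (rule Least_equality) (use assms in \<open>auto simp: not_less[symmetric]\<close>)

lemma next_prime_2: "next_prime 2 = 3" and next_prime_4: "next_prime 4 = 5"
  and next_prime_16: "next_prime 16 = 17"
  by (rule next_prime_eqI; simp)+

lemma range_size_pos: "range_size fam l > 0"
  by (cases fam) (auto simp: prime_gt_0_nat prime_next_prime)

text \<open>Coefficients in \<open>{..<2}\<close> are 0 or 1, so XOR is multiply-mod-prime for the
  prime 2 with zero offset.\<close>

lemma hash_pmf_XOR_eq:
  "finite I \<Longrightarrow> hash_pmf XOR l I =
     map_pmf (\<lambda>a x. ((\<Sum>i\<in>I. a i * x i) + 0) mod 2) (pmf_of_set (I \<rightarrow>\<^sub>E {..<2::nat}))"
proof -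
  assume I: "finite I"
  have "hash_pmf XOR l I =
      map_pmf (\<lambda>a x. (\<Sum>i\<in>{i\<in>I. a i = 1}. x i) mod 2) (pmf_of_set (I \<rightarrow>\<^sub>E {..<2::nat}))"
    by (simp add: map_pmf_def)
  also have "\<dots> = map_pmf (\<lambda>a x. ((\<Sum>i\<in>I. a i * x i) + 0) mod 2) (pmf_of_set (I \<rightarrow>\<^sub>E {..<2::nat}))"
  proof (rule map_pmf_cong[OF refl])
    fix a assume "a \<in> set_pmf (pmf_of_set (I \<rightarrow>\<^sub>E {..<2::nat}))"
    moreover have "finite (I \<rightarrow>\<^sub>E {..<2::nat})" "(I \<rightarrow>\<^sub>E {..<2::nat}) \<noteq> {}"
      using I by (auto intro!: finite_PiE simp: PiE_eq_empty_iff lessThan_empty_iff)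
    ultimately have a: "a \<in> I \<rightarrow>\<^sub>E {..<2::nat}" by simp
    have a01: "a i = 0 \<or> a i = 1" if "i \<in> I" for i
      using PiE_mem[OF a that] by auto
    have "(\<Sum>i\<in>{i\<in>I. a i = 1}. x i) = (\<Sum>i\<in>I. if a i = 1 then x i else 0)" for x :: "'a \<Rightarrow> nat"
      by (rule sum.inter_filter[OF I])
    also have "\<dots> x = (\<Sum>i\<in>I. a i * x i)" for x :: "'a \<Rightarrow> nat"
      using a01 by (intro sum.cong refl) auto
    finally show "(\<lambda>x. (\<Sum>i\<in>{i\<in>I. a i = 1}. x i) mod 2) = (\<lambda>x. ((\<Sum>i\<in>I. a i * x i) + 0) mod 2)"
      by simp
  qed
  finally show ?thesis .
qed

text \<open>The collision probability is what is asked of the hash functions themselves: the uniform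
  right-hand side of a constraint supplies the uniformity of single values, which XOR lacks at the
  zero input.\<close>

lemma hash_pmf_collision:
  assumes fam: "valid_family fam" "1 \<le> l" and I: "finite I" "i \<in> I" "x i \<noteq> y i"
    and xy: "x i < 2 ^ slice_width fam l" "y i < 2 ^ slice_width fam l"
  shows "measure_pmf.prob (hash_pmf fam l I) {h. h x = h y} = 1 / range_size fam l"
proof (cases fam)
  case XOR
  have "measure_pmf.prob (hash_pmf XOR l I) {h. h x = h y} = 1 / real 2"
    unfolding hash_pmf_XOR_eq[OF I(1)] measure_map_pmf vimage_def mem_Collect_eq
    by (rule prob_linear_mod_prime_collision) (use I xy XOR in auto)
  with XOR show ?thesis by simp
next
  case (Multiply_Shift w wbar)
  have "hash_pmf fam l I = map_pmf (\<lambda>p x. take_bit l (drop_bit (wbar l - l) ((\<Sum>i\<in>I. fst p i * x i) + snd p)))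
      (pair_pmf (pmf_of_set (I \<rightarrow>\<^sub>E {..<2 ^ wbar l})) (pmf_of_set {..<2 ^ wbar l}))"
    by (simp add: Multiply_Shift map_pmf_def pair_pmf_def bind_assoc_pmf bind_return_pmf)
  moreover have "measure_pmf.prob (pair_pmf (pmf_of_set (I \<rightarrow>\<^sub>E {..<2 ^ wbar l})) (pmf_of_set {..<2 ^ wbar l}))
      {p. take_bit l (drop_bit (wbar l - l) ((\<Sum>j\<in>I. fst p j * x j) + snd p)) =
          take_bit l (drop_bit (wbar l - l) ((\<Sum>j\<in>I. fst p j * y j) + snd p))} = 1 / 2 ^ l"
    using fam xy Multiply_Shift I
    by (intro prob_multiply_shift_collision[where w = "w l" and i = i]) auto
  ultimately show ?thesis
    by (simp add: Multiply_Shift vimage_def)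
next
  case Multiply_Mod_Prime
  let ?p = "next_prime (2 ^ l)"
  have lt: "x i < ?p" "y i < ?p"
    using xy next_prime_gt[of "2 ^ l"] Multiply_Mod_Prime by auto
  have fin: "finite {..<?p}" "{..<?p} \<noteq> {}"
    using prime_gt_0_nat[OF prime_next_prime] by (simp_all add: lessThan_empty_iff)
  have "hash_pmf fam l I = do {
      b \<leftarrow> pmf_of_set {..<?p};
      map_pmf (\<lambda>a x. ((\<Sum>i\<in>I. a i * x i) + b) mod ?p) (pmf_of_set (I \<rightarrow>\<^sub>E {..<?p}))}"
    unfolding Multiply_Mod_Prime hash_pmf.simps map_pmf_def by (rule bind_commute_pmf)
  then have "measure_pmf.prob (hash_pmf fam l I) {h. h x = h y} =
      measure_pmf.expectation (pmf_of_set {..<?p}) (\<lambda>b. 1 / ?p)"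
    using fin prob_linear_mod_prime_collision[where x = x and y = y and i = i, OF prime_next_prime I(1,2) lt I(3)]
    by (simp add: prob_bind_pmf_finite vimage_def)
  then show ?thesis by (simp add: Multiply_Mod_Prime)
qed

lemma finite_set_hash_pmf: "finite I \<Longrightarrow> finite (set_pmf (hash_pmf fam l I))"
proof -
  assume I: "finite I"
  have *: "finite (I \<rightarrow>\<^sub>E {..<n})" "n > 0 \<Longrightarrow> (I \<rightarrow>\<^sub>E {..<n}) \<noteq> {}" "n > 0 \<Longrightarrow> {..<n} \<noteq> {}" for n :: nat
    using I by (auto intro!: finite_PiE simp: PiE_eq_empty_iff lessThan_empty_iff)
  have "0 < next_prime (2 ^ l)" using prime_gt_0_nat[OF prime_next_prime] .
  then show ?thesis
    by (cases fam) (simp_all add: *)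
qed

text \<open>Lets the uniform right-hand side match a hash value with probability exactly
  \<open>1 / range_size fam l\<close>.\<close>

lemma hash_pmf_less:
  assumes "h \<in> set_pmf (hash_pmf fam l I)"
  shows "h x < range_size fam l"
  using assms prime_gt_0_nat[OF prime_next_prime[of "2 ^ l"]]
  by (cases fam) auto

lemma hash_pmf_local:
  assumes "h \<in> set_pmf (hash_pmf fam l I)" "\<And>i. i \<in> I \<Longrightarrow> x i = y i"
  shows "h x = h y"
proof -
  have "(\<Sum>i\<in>{i\<in>I. a i = 1}. x i) = (\<Sum>i\<in>{i\<in>I. a i = 1}. y i)"
    "(\<Sum>i\<in>I. a i * x i) = (\<Sum>i\<in>I. a i * y i)" for a :: "'a \<Rightarrow> nat"
    using assms(2) by (auto intro!: sum.cong)
  then show ?thesis using assms(1) by (cases fam) auto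
qed

section \<open>Slicing bit-vectors, and hash constraints as pairwise independent sieves\<close>

lemma slice_width_pos: "valid_family fam \<Longrightarrow> 1 \<le> l \<Longrightarrow> 1 \<le> slice_width fam l"
  by (cases fam) auto

lemma finite_slice_index: "finite S \<Longrightarrow> 1 \<le> k \<Longrightarrow> finite (slice_index \<Gamma> S k)"
proof -
  assume "finite S" "1 \<le> k"
  have "{j. j * k < n} \<subseteq> {..<n}" for n
  proof
    fix j assume "j \<in> {j. j * k < n}"
    moreover from \<open>1 \<le> k\<close> obtain m where "k = Suc m" by (cases k) auto
    ultimately show "j \<in> {..<n}" by simp
  qed
  then have "finite {j. j * k < n}" for n by (rule finite_subset) simp
  then show ?thesis unfolding slice_index_def using \<open>finite S\<close> by (intro finite_SigmaI)
qed

lemma slice_less: "slice k \<tau> i < 2 ^ k"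
  by (simp add: slice_def case_prod_beta)

text \<open>Two distinct assignments differ in some bit \<open>n\<close> of some variable; that bit
  sits at position \<open>n mod k\<close> of slice \<open>n div k\<close>, which belongs to
  \<open>slice_index\<close> since \<open>n\<close> is below the width.\<close>

lemma slices_separate:
  assumes xy: "x \<in> (\<Pi>\<^sub>E v\<in>S. carrier_of (\<Gamma> v))" "y \<in> (\<Pi>\<^sub>E v\<in>S. carrier_of (\<Gamma> v))" "x \<noteq> y"
    and S: "\<forall>v\<in>S. \<exists>w\<ge>1. \<Gamma> v = BitVec w" and k: "1 \<le> k"
  shows "\<exists>i\<in>slice_index \<Gamma> S k. slice k x i \<noteq> slice k y i"
proof -
  obtain v where v: "v \<in> S" "x v \<noteq> y v"
    using xy by (meson PiE_ext)
  obtain w where w: "\<Gamma> v = BitVec w" using S v by auto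
  obtain a b where ab: "x v = BV a" "a < 2 ^ w" "y v = BV b" "b < 2 ^ w"
    using PiE_mem[OF xy(1) v(1)] PiE_mem[OF xy(2) v(1)] w by auto
  have "a \<noteq> b" using v ab by auto
  then obtain n where n: "bit a n \<noteq> bit b n" by (auto simp: bit_eq_iff)
  have "take_bit w a = a" "take_bit w b = b" using ab by (auto simp: take_bit_nat_eq_self)
  then have "n < w" using n by (metis bit_take_bit_iff)
  have div: "n div k * k + n mod k = n" by simp
  have "n div k * k < w" using div \<open>n < w\<close> by linarith
  then have i: "(v, n div k) \<in> slice_index \<Gamma> S k" using v w by (simp add: slice_index_def)
  have "bit (take_bit k (drop_bit (n div k * k) c)) (n mod k) = bit c n" for c :: nat
    using k by (simp add: bit_take_bit_iff bit_drop_bit_eq)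
  then have "take_bit k (drop_bit (n div k * k) a) \<noteq> take_bit k (drop_bit (n div k * k) b)"
    using n by metis
  then have "slice k x (v, n div k) \<noteq> slice k y (v, n div k)"
    using ab by (simp add: slice_def)
  with i show ?thesis by blast
qed

text \<open>The slices read only variables of \<open>S\<close>, so a constraint on an assignment is
  a constraint on its projection.\<close>

lemma hash_constraint_local:
  assumes "h \<in> set_pmf (hash_constraint_pmf fam \<Gamma> S l)"
  shows "h (restrict \<tau> S) = h \<tau>"
proof -
  let ?k = "slice_width fam l"
  obtain g \<alpha> where g: "g \<in> set_pmf (hash_pmf fam l (slice_index \<Gamma> S ?k))"
    and h: "h = (\<lambda>\<tau>. g (slice ?k \<tau>) = \<alpha>)"
    using assms unfolding hash_constraint_pmf_def by auto
  have "g (slice ?k (restrict \<tau> S)) = g (slice ?k \<tau>)"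
    by (rule hash_pmf_local[OF g]) (auto simp: slice_def slice_index_def)
  then show ?thesis by (simp add: h)
qed

text \<open>Whatever the hash function, the uniform right-hand side hits a given value with
  probability \<open>1 / r\<close>. Two points survive together iff they collide and the common
  value is hit, which has probability \<open>1 / r\<close> times \<open>1 / r\<close>.\<close>

lemma pairwise_sieve_hash_constraint:
  assumes fam: "valid_family fam" "1 \<le> l" and S: "finite S" "\<forall>v\<in>S. \<exists>w\<ge>1. \<Gamma> v = BitVec w"
    and X: "X \<subseteq> (\<Pi>\<^sub>E v\<in>S. carrier_of (\<Gamma> v))"
  shows "pairwise_sieve (hash_constraint_pmf fam \<Gamma> S l) (\<lambda>h. h) X (1 / range_size fam l)"
proof -
  define k r I where "k = slice_width fam l" and "r = range_size fam l" and "I = slice_index \<Gamma> S k"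
  have k: "1 \<le> k" unfolding k_def by (rule slice_width_pos[OF fam])
  have r: "r > 0" unfolding r_def by (rule range_size_pos)
  have I: "finite I" unfolding I_def by (rule finite_slice_index[OF S(1) k])
  let ?H = "hash_pmf fam l I" and ?U = "pmf_of_set {..<r}"
  have fin: "finite (set_pmf ?H)" "finite (set_pmf ?U)"
    using r finite_set_hash_pmf[OF I] by (simp_all add: set_pmf_of_set lessThan_empty_iff)
  have eq: "hash_constraint_pmf fam \<Gamma> S l = map_pmf (\<lambda>p \<tau>. fst p (slice k \<tau>) = snd p) (pair_pmf ?H ?U)"
    unfolding hash_constraint_pmf_def k_def[symmetric] r_def[symmetric] I_def[symmetric]
    by (simp add: map_pmf_def pair_pmf_def bind_assoc_pmf bind_return_pmf)
  have U: "measure_pmf.prob ?U {\<alpha>. c = \<alpha>} = 1 / r" if "c < r" for c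
  proof -
    have "{..<r} \<inter> {\<alpha>. c = \<alpha>} = {c}" using that by auto
    moreover have "{..<r} \<noteq> {}" using r by (simp add: lessThan_empty_iff)
    ultimately show ?thesis by (simp add: measure_pmf_of_set)
  qed
  have less: "h x < r" if "h \<in> set_pmf ?H" for h x
    using hash_pmf_less[OF that] by (simp add: r_def)
  have one: "measure_pmf.prob (pair_pmf ?H ?U) {p. fst p (slice k x) = snd p} = 1 / r" for x :: "('a, 'b) assignment"
  proof -
    have "measure_pmf.prob (pair_pmf ?H ?U) {p. fst p (slice k x) = snd p} =
        measure_pmf.expectation ?H (\<lambda>h. measure_pmf.prob ?U {\<alpha>. h (slice k x) = \<alpha>})"
      by (simp add: prob_pair_pmf_finite[OF fin])
    also have "\<dots> = measure_pmf.expectation ?H (\<lambda>h. 1 / r)"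
      using U less by (intro integral_cong_AE) (auto simp: AE_measure_pmf_iff)
    finally show ?thesis by simp
  qed
  have two: "measure_pmf.prob (pair_pmf ?H ?U) {p. fst p (slice k x) = snd p \<and> fst p (slice k y) = snd p}
      = (1 / r)\<^sup>2" if xy: "x \<in> X" "y \<in> X" "x \<noteq> y" for x y
  proof -
    obtain i where i: "i \<in> I" "slice k x i \<noteq> slice k y i"
      using slices_separate[of x S \<Gamma> y k] xy X S k unfolding I_def by blast
    have coll: "measure_pmf.prob ?H {h. h (slice k x) = h (slice k y)} = 1 / r"
      unfolding r_def
      by (rule hash_pmf_collision[OF fam I i(1)]) (use i slice_less[of k] in \<open>simp_all add: k_def\<close>)
    have "measure_pmf.prob (pair_pmf ?H ?U) {p. fst p (slice k x) = snd p \<and> fst p (slice k y) = snd p} =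
        measure_pmf.expectation ?H (\<lambda>h. measure_pmf.prob ?U {\<alpha>. h (slice k x) = \<alpha> \<and> h (slice k y) = \<alpha>})"
      by (simp add: prob_pair_pmf_finite[OF fin])
    also have "\<dots> = measure_pmf.expectation ?H (\<lambda>h. of_bool (h (slice k x) = h (slice k y)) * (1 / r))"
    proof (intro integral_cong_AE)
      have "measure_pmf.prob ?U {\<alpha>. h (slice k x) = \<alpha> \<and> h (slice k y) = \<alpha>} =
          of_bool (h (slice k x) = h (slice k y)) * (1 / r)" if "h \<in> set_pmf ?H" for h
      proof (cases "h (slice k x) = h (slice k y)")
        case True
        then show ?thesis using U[OF less[OF that, of "slice k y"]] by simp
      next
        case False
        then have "{\<alpha>. h (slice k x) = \<alpha> \<and> h (slice k y) = \<alpha>} = {}" by auto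
        then have "measure_pmf.prob ?U {\<alpha>. h (slice k x) = \<alpha> \<and> h (slice k y) = \<alpha>} = 0"
          by (simp only: measure_empty)
        then show ?thesis using False by (simp only: of_bool_eq mult_zero_left)
      qed
      then show "AE h in measure_pmf ?H. measure_pmf.prob ?U {\<alpha>. h (slice k x) = \<alpha> \<and> h (slice k y) = \<alpha>} =
          of_bool (h (slice k x) = h (slice k y)) * (1 / r)"
        by (simp add: AE_measure_pmf_iff)
    qed simp_all
    also have "\<dots> = measure_pmf.expectation ?H (\<lambda>h. of_bool (h (slice k x) = h (slice k y))) * (1 / r)"
      by (rule integral_mult_left_zero)
    also have "\<dots> = (1 / r)\<^sup>2"
      unfolding prob_eq_expectation_of_bool[symmetric] coll by (simp add: power2_eq_square)
    finally show ?thesis .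
  qed
  have "finite (set_pmf (map_pmf (\<lambda>p \<tau>. fst p (slice k \<tau>) = snd p) (pair_pmf ?H ?U)))"
    using fin by simp
  moreover have "(\<lambda>p \<tau>. fst p (slice k \<tau>) = snd p) -` {h. h x} = {p. fst p (slice k x) = snd p}"
    "(\<lambda>p \<tau>. fst p (slice k \<tau>) = snd p) -` {h. h x \<and> h y} =
      {p. fst p (slice k x) = snd p \<and> fst p (slice k y) = snd p}" for x y :: "('a, 'b) assignment"
    by auto
  ultimately show ?thesis
    using one two unfolding eq pairwise_sieve_def r_def[symmetric] measure_map_pmf by simp
qed

section \<open>Search procedures and their solver calls\<close>

text \<open>The blocking constraint removes exactly one projected solution, however many assignments
  project to it.\<close>

lemma proj_Sol_Some:
  assumes "smt_solver V \<Gamma> solve" "solve F = Some \<tau>"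
  shows "proj_Sol V \<Gamma> F S =
    insert (restrict \<tau> S) (proj_Sol V \<Gamma> (\<lambda>\<sigma>. F \<sigma> \<and> restrict \<sigma> S \<noteq> restrict \<tau> S) S)"
    and "restrict \<tau> S \<notin> proj_Sol V \<Gamma> (\<lambda>\<sigma>. F \<sigma> \<and> restrict \<sigma> S \<noteq> restrict \<tau> S) S"
proof -
  have "\<tau> \<in> Sol V \<Gamma> F"
    using assms unfolding smt_solver_def by (metis option.simps(5))
  then show "proj_Sol V \<Gamma> F S =
    insert (restrict \<tau> S) (proj_Sol V \<Gamma> (\<lambda>\<sigma>. F \<sigma> \<and> restrict \<sigma> S \<noteq> restrict \<tau> S) S)"
    unfolding proj_Sol_def Sol_def by auto
  show "restrict \<tau> S \<notin> proj_Sol V \<Gamma> (\<lambda>\<sigma>. F \<sigma> \<and> restrict \<sigma> S \<noteq> restrict \<tau> S) S"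
    unfolding proj_Sol_def Sol_def by auto
qed

text \<open>Every satisfiable call raises the count by one, and the count stops at the threshold. A
  run ending in an unsatisfiable call has found fewer than \<open>T\<close> solutions, so the extra
  call fits into the same bound.\<close>

lemma sat_count_correct:
  assumes "smt_solver V \<Gamma> solve" "finite (proj_Sol V \<Gamma> F S)" "real n < T"
  shows "fst (sat_count solve S T F n) =
      (if real (n + card (proj_Sol V \<Gamma> F S)) < T then Some (n + card (proj_Sol V \<Gamma> F S)) else None)
    \<and> snd (sat_count solve S T F n) \<le> nat \<lceil>T\<rceil> - n"
  using assms(2,3)
proof (induction "nat \<lceil>T\<rceil> - n" arbitrary: F n rule: less_induct)
  case less
  have Tn: "nat \<lceil>T\<rceil> - n \<ge> 1" using less.prems(2) by linarith
  show ?case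
  proof (cases "solve F")
    case None
    then have "Sol V \<Gamma> F = {}" using assms(1) unfolding smt_solver_def by (metis option.simps(4))
    then have "proj_Sol V \<Gamma> F S = {}" by (simp add: proj_Sol_def)
    then show ?thesis using None less.prems Tn by (simp add: sat_count.simps)
  next
    case (Some \<tau>)
    define G where "G = (\<lambda>\<sigma>. F \<sigma> \<and> restrict \<sigma> S \<noteq> restrict \<tau> S)"
    note proj = proj_Sol_Some[OF assms(1) Some, of S, folded G_def]
    have finG: "finite (proj_Sol V \<Gamma> G S)" using less.prems(1) proj(1) by simp
    have card: "card (proj_Sol V \<Gamma> F S) = Suc (card (proj_Sol V \<Gamma> G S))"
      using proj finG by simp
    show ?thesis
    proof (cases "real (Suc n) \<ge> T")
      case True
      have "sat_count solve S T F n = (None, 1)"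
        using Some True by (subst sat_count.simps) simp
      then show ?thesis using True card Tn by simp
    next
      case False
      have eq: "sat_count solve S T F n =
          (fst (sat_count solve S T G (Suc n)), Suc (snd (sat_count solve S T G (Suc n))))"
        using Some False by (subst sat_count.simps) (simp add: G_def case_prod_beta)
      have lt: "nat \<lceil>T\<rceil> - Suc n < nat \<lceil>T\<rceil> - n" using Tn by linarith
      have "real (Suc n) < T" using False by simp
      note IH = less.hyps[OF lt finG this]
      then have "Suc (snd (sat_count solve S T G (Suc n))) \<le> nat \<lceil>T\<rceil> - n"
        using Tn by linarith
      with IH show ?thesis unfolding eq card by simp
    qed
  qed
qed

text \<open>\<open>z k\<close> is the size of the cell cut out by \<open>k\<close> constraints, and
  \<open>Q\<close> bounds the solver calls of one probe.\<close>

locale saturating_count =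
  fixes cnt :: "nat \<Rightarrow> nat option \<times> nat" and z :: "nat \<Rightarrow> nat" and T :: real and Q :: nat
  assumes cnt_eq: "fst (cnt k) = (if real (z k) < T then Some (z k) else None)"
    and cnt_calls: "snd (cnt k) \<le> Q"
begin

definition first_below :: "nat \<Rightarrow> bool" where
  "first_below k \<longleftrightarrow> 0 < k \<and> real (z k) < T \<and> T \<le> real (z (k - 1))"

text \<open>Each probe moves the saturated end up or the unsaturated end down, and the search stops
  when they are adjacent.\<close>

lemma bisect_correct:
  assumes "lo < hi" "real (z hi) < T" "T \<le> real (z lo)"
  shows "\<exists>k. fst (bisect cnt lo hi (z hi)) = (k, z k) \<and> first_below k \<and> k \<le> hi"
  using assms
proof (induction "hi - lo" arbitrary: lo hi rule: less_induct)
  case less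
  show ?case
  proof (cases "hi \<le> Suc lo")
    case True
    then have "hi = Suc lo" using less.prems by simp
    then show ?thesis using less.prems by (subst bisect.simps) (simp add: first_below_def)
  next
    case False
    define mid where "mid = (lo + hi) div 2"
    have mid: "lo < mid" "mid < hi" using False by (auto simp: mid_def)
    show ?thesis
    proof (cases "real (z mid) < T")
      case True
      then have "fst (bisect cnt lo hi (z hi)) = fst (bisect cnt lo mid (z mid))"
        using False cnt_eq[of mid]
        by (subst bisect.simps) (simp add: case_prod_beta Let_def flip: mid_def)
      then show ?thesis using less.hyps[of mid lo] mid True less.prems by fastforce
    next
      case F: False
      then have "fst (bisect cnt lo hi (z hi)) = fst (bisect cnt mid hi (z hi))"
        using False cnt_eq[of mid]
        by (subst bisect.simps) (simp add: case_prod_beta Let_def flip: mid_def)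
      then show ?thesis using less.hyps[of hi mid] mid F less.prems by fastforce
    qed
  qed
qed

lemma bisect_calls:
  assumes "hi - lo \<le> 2 ^ d"
  shows "snd (bisect cnt lo hi n) \<le> Q * d"
  using assms
proof (induction d arbitrary: lo hi n)
  case 0
  then show ?case by (subst bisect.simps) simp
next
  case (Suc d)
  show ?case
  proof (cases "hi \<le> Suc lo")
    case True
    then show ?thesis by (subst bisect.simps) simp
  next
    case False
    define mid where "mid = (lo + hi) div 2"
    have "mid - lo \<le> 2 ^ d" "hi - mid \<le> 2 ^ d" using Suc.prems False by (auto simp: mid_def)
    then have "snd (bisect cnt lo mid n') \<le> Q * d" "snd (bisect cnt mid hi n') \<le> Q * d" for n'
      using Suc.IH by auto
    then have "snd (case fst (cnt mid) of None \<Rightarrow> bisect cnt mid hi n | Some n' \<Rightarrow> bisect cnt lo mid n') \<le> Q * d"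
      by (auto split: option.split)
    moreover have "snd (bisect cnt lo hi n) = snd (cnt mid) +
        snd (case fst (cnt mid) of None \<Rightarrow> bisect cnt mid hi n | Some n' \<Rightarrow> bisect cnt lo mid n')"
      using False by (subst bisect.simps) (simp add: case_prod_beta Let_def flip: mid_def)
    ultimately show ?thesis using cnt_calls[of mid] by simp
  qed
qed

lemma gallop_correct:
  assumes "T \<le> real (z lo)" "lo < hi" "hi \<le> N"
  shows "(\<exists>k. fst (gallop cnt N lo hi) = Some (k, z k) \<and> first_below k \<and> k \<le> N) \<or>
    (fst (gallop cnt N lo hi) = None \<and> T \<le> real (z N))"
  using assms
proof (induction "N - hi" arbitrary: lo hi rule: less_induct)
  case less
  show ?case
  proof (cases "real (z hi) < T")
    case True
    then have "fst (gallop cnt N lo hi) = Some (fst (bisect cnt lo hi (z hi)))"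
      using cnt_eq[of hi] by (subst gallop.simps) (cases "cnt hi", simp add: case_prod_beta)
    then show ?thesis using bisect_correct[OF less.prems(2) True less.prems(1)] less.prems(3) by fastforce
  next
    case False
    show ?thesis
    proof (cases "N \<le> hi")
      case True
      then have "fst (gallop cnt N lo hi) = None"
        using False cnt_eq[of hi] by (subst gallop.simps) (cases "cnt hi", simp)
      then show ?thesis using True False less.prems(3) by simp
    next
      case F: False
      define hi' where "hi' = min (2 * hi) N"
      have hi': "hi < hi'" "hi' \<le> N" using F less.prems by (auto simp: hi'_def)
      have "fst (gallop cnt N lo hi) = fst (gallop cnt N hi hi')"
        using False F less.prems cnt_eq[of hi]
        by (subst gallop.simps) (cases "cnt hi", simp add: case_prod_beta hi'_def)
      then show ?thesis
        using less.hyps[of hi' hi] hi' F False less.prems by simp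
    qed
  qed
qed

text \<open>At most \<open>d\<close> doublings bring \<open>hi\<close> up to \<open>N\<close>, and
  the bracket reached then has length at most \<open>N \<le> 2 ^ e\<close>, which bisection closes
  in \<open>e\<close> probes.\<close>

lemma gallop_calls:
  assumes "0 < hi" "hi \<le> N" "N \<le> hi * 2 ^ d" "N \<le> 2 ^ e"
  shows "snd (gallop cnt N lo hi) \<le> Q * (Suc d + e)"
  using assms(1-3)
proof (induction d arbitrary: lo hi)
  case 0
  have "snd (bisect cnt lo hi n) \<le> Q * e" for n
    by (rule bisect_calls) (use assms(4) 0 in linarith)
  then show ?case
    using 0 cnt_calls[of hi]
    by (subst gallop.simps) (cases "cnt hi", auto simp: case_prod_beta add_mono split: option.split)
next
  case (Suc d)
  define hi' where "hi' = min (2 * hi) N"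
  have "snd (gallop cnt N hi hi') \<le> Q * (Suc d + e)"
    by (rule Suc.IH) (use Suc.prems in \<open>auto simp: hi'_def min_def\<close>)
  moreover have "snd (bisect cnt lo hi n) \<le> Q * e" for n
    by (rule bisect_calls) (use assms(4) Suc in linarith)
  moreover have "snd (gallop cnt N lo hi) \<le> snd (cnt hi) + max (snd (gallop cnt N hi hi'))
      (case fst (cnt hi) of Some n \<Rightarrow> snd (bisect cnt lo hi n) | None \<Rightarrow> 0)"
    by (subst gallop.simps) (cases "cnt hi", auto simp: case_prod_beta hi'_def split: option.split)
  moreover have "(case fst (cnt hi) of Some n \<Rightarrow> snd (bisect cnt lo hi n) | None \<Rightarrow> 0) \<le> Q * e"
    using calculation(2) by (simp split: option.split)
  ultimately have "snd (gallop cnt N lo hi) \<le> Q + max (Q * (Suc d + e)) (Q * e)"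
    using cnt_calls[of hi] by linarith
  also have "max (Q * (Suc d + e)) (Q * e) = Q * (Suc d + e)"
    by (intro max_absorb1 mult_le_mono2) simp
  finally show ?case by simp
qed

end

text \<open>The parameter is halved at most \<open>l\<close> times. This crude bound suffices
  because the initial range parameter is at most 4.\<close>

lemma refine_calls:
  assumes "\<And>G'. snd (sat_count solve S T G' 0) \<le> Q"
  shows "\<forall>p\<in>set_pmf (refine fam solve \<Gamma> S T G l n). snd p \<le> Q * l"
proof (induction l arbitrary: n rule: less_induct)
  case (less l)
  show ?case
  proof (cases "l \<le> 1")
    case True
    then show ?thesis by (subst refine.simps) simp
  next
    case False
    show ?thesis
    proof
      fix p assume "p \<in> set_pmf (refine fam solve \<Gamma> S T G l n)"
      then obtain h where p: "p \<in> set_pmf (case sat_count solve S T (conj_all G [h]) 0 of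
          (None, q) \<Rightarrow> return_pmf ((n, range_size fam l), q)
        | (Some n', q) \<Rightarrow>
            map_pmf (\<lambda>(r, q'). (r, q + q')) (refine fam solve \<Gamma> S T G (l div 2) n'))"
        using False by (subst (asm) refine.simps) auto
      obtain r q where rq: "sat_count solve S T (conj_all G [h]) 0 = (r, q)" by fastforce
      have q: "q \<le> Q" using assms[of "conj_all G [h]"] rq by simp
      show "snd p \<le> Q * l"
      proof (cases r)
        case None
        then show ?thesis using p rq q False by (auto intro: order_trans)
      next
        case (Some n')
        then obtain p' where p': "p' \<in> set_pmf (refine fam solve \<Gamma> S T G (l div 2) n')" "snd p = q + snd p'"
          using p rq by (auto simp: case_prod_beta)
        have "snd p' \<le> Q * (l div 2)" using less.IH[of "l div 2" n'] p' False by auto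
        then have "snd p \<le> Q * Suc (l div 2)" using p' q by simp
        also have "\<dots> \<le> Q * l" using False by (intro mult_le_mono2) linarith
        finally show ?thesis .
      qed
    qed
  qed
qed

section \<open>Deviation of cell sizes\<close>

lemma prob_mono_support:
  assumes "\<And>\<omega>. \<omega> \<in> set_pmf M \<Longrightarrow> P \<omega> \<Longrightarrow> Q \<omega>"
  shows "measure_pmf.prob M {\<omega>. P \<omega>} \<le> measure_pmf.prob M {\<omega>. Q \<omega>}"
  by (rule measure_pmf.finite_measure_mono_AE) (auto simp: AE_measure_pmf_iff assms)

lemma prob_disj_le:
  assumes "measure_pmf.prob M {\<omega>. P \<omega>} \<le> p" "measure_pmf.prob M {\<omega>. Q \<omega>} \<le> q"
  shows "measure_pmf.prob M {\<omega>. P \<omega> \<or> Q \<omega>} \<le> p + q"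
proof -
  have "{\<omega>. P \<omega> \<or> Q \<omega>} = {\<omega>. P \<omega>} \<union> {\<omega>. Q \<omega>}" by auto
  then show ?thesis
    using measure_Un_le[of "{\<omega>. P \<omega>}" M "{\<omega>. Q \<omega>}"] assms by simp
qed

definition pivot :: "real \<Rightarrow> real" where
  "pivot \<gamma> = (246/25) / \<gamma>\<^sup>2"

definition sat_bound :: "real \<Rightarrow> real" where
  "sat_bound \<gamma> = 1 + pivot \<gamma> * (1 + \<gamma>)"

text \<open>For variance \<open>\<mu>\<close> and deviation \<open>\<Delta>\<close>, the best centre
  for the square lies \<open>\<mu> / \<Delta>\<close> beyond the mean, on the side away from the
  tail; it gives Cantelli's bound.\<close>

lemma Cantelli_eq:
  fixes \<mu> \<Delta> :: real
  assumes "\<Delta> > 0" "\<mu> > 0"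
  shows "(\<mu> + (\<mu> / \<Delta>)\<^sup>2) / (\<Delta> + \<mu> / \<Delta>)\<^sup>2 = \<mu> / (\<mu> + \<Delta>\<^sup>2)"
proof -
  have "\<mu> + (\<mu> / \<Delta>)\<^sup>2 = \<mu> * (\<mu> + \<Delta>\<^sup>2) / \<Delta>\<^sup>2"
    using assms by (simp add: power2_eq_square field_simps)
  moreover have "(\<Delta> + \<mu> / \<Delta>)\<^sup>2 = (\<mu> + \<Delta>\<^sup>2)\<^sup>2 / \<Delta>\<^sup>2"
    using assms by (simp add: power2_eq_square field_simps)
  moreover have "\<mu> + \<Delta>\<^sup>2 > 0" using assms by (simp add: add_pos_nonneg)
  ultimately show ?thesis using assms by (simp add: power2_eq_square)
qed

text \<open>\<open>w\<close> is the mean cell size in units of the pivot; the levels of the search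
  differ in \<open>w\<close>.\<close>

locale cell_sieve =
  fixes M :: "'w pmf" and f :: "'w \<Rightarrow> 'x \<Rightarrow> bool" and X :: "'x set" and q \<gamma> w :: real
  assumes sieve: "pairwise_sieve M f X q" and finite_X: "finite X" and q_nonneg: "0 \<le> q"
    and \<gamma>_pos: "0 < \<gamma>" and \<gamma>_less: "\<gamma> < 1"
    and w_pos: "0 < w" and mean: "q * real (card X) = w * pivot \<gamma>"
begin

abbreviation Z :: "'w \<Rightarrow> real" where "Z \<omega> \<equiv> real (card {x\<in>X. f \<omega> x})"
abbreviation \<mu> :: real where "\<mu> \<equiv> w * pivot \<gamma>"

lemma pivot_gt: "pivot \<gamma> > 246/25"
proof -
  have "\<gamma> * \<gamma> < 1 * 1" using \<gamma>_pos \<gamma>_less by (intro mult_strict_mono) auto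
  then have "\<gamma>\<^sup>2 < 1" by (simp add: power2_eq_square)
  then show ?thesis using \<gamma>_pos by (simp add: pivot_def field_simps)
qed

lemma pivot_\<gamma>: "\<gamma>\<^sup>2 * pivot \<gamma> = 246/25" using \<gamma>_pos by (simp add: pivot_def)

lemma \<mu>_pos: "\<mu> > 0" using w_pos pivot_gt by simp

lemma deviation:
  assumes "R > 0" "\<And>\<omega>. P \<omega> \<Longrightarrow> R \<le> \<bar>Z \<omega> - m\<bar>"
  shows "measure_pmf.prob M {\<omega>. P \<omega>} \<le> (\<mu> + (\<mu> - m)\<^sup>2) / R\<^sup>2"
  by (rule pairwise_sieve_deviation[OF sieve finite_X q_nonneg assms(1) mean[symmetric] assms(2)])

lemma Cantelli_below:
  assumes "\<Delta> > 0" "\<And>\<omega>. P \<omega> \<Longrightarrow> Z \<omega> \<le> \<mu> - \<Delta>"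
  shows "measure_pmf.prob M {\<omega>. P \<omega>} \<le> \<mu> / (\<mu> + \<Delta>\<^sup>2)"
proof -
  have "\<mu> / \<Delta> > 0" using \<mu>_pos assms(1) by simp
  then have "measure_pmf.prob M {\<omega>. P \<omega>} \<le> (\<mu> + (\<mu> - (\<mu> + \<mu> / \<Delta>))\<^sup>2) / (\<Delta> + \<mu> / \<Delta>)\<^sup>2"
  proof (intro deviation)
    fix \<omega> assume "P \<omega>"
    from assms(2)[OF this] show "\<Delta> + \<mu> / \<Delta> \<le> \<bar>Z \<omega> - (\<mu> + \<mu> / \<Delta>)\<bar>" using \<open>\<mu> / \<Delta> > 0\<close> by linarith
  qed (use assms(1) in linarith)
  then show ?thesis using Cantelli_eq[OF assms(1) \<mu>_pos] by simp
qed

lemma Cantelli_above: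
  assumes "\<Delta> > 0" "\<And>\<omega>. P \<omega> \<Longrightarrow> \<mu> + \<Delta> \<le> Z \<omega>"
  shows "measure_pmf.prob M {\<omega>. P \<omega>} \<le> \<mu> / (\<mu> + \<Delta>\<^sup>2)"
proof -
  have "\<mu> / \<Delta> > 0" using \<mu>_pos assms(1) by simp
  then have "measure_pmf.prob M {\<omega>. P \<omega>} \<le> (\<mu> + (\<mu> - (\<mu> - \<mu> / \<Delta>))\<^sup>2) / (\<Delta> + \<mu> / \<Delta>)\<^sup>2"
  proof (intro deviation)
    fix \<omega> assume "P \<omega>"
    from assms(2)[OF this] show "\<Delta> + \<mu> / \<Delta> \<le> \<bar>Z \<omega> - (\<mu> - \<mu> / \<Delta>)\<bar>" using \<open>\<mu> / \<Delta> > 0\<close> by linarith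
  qed (use assms(1) in linarith)
  then show ?thesis using Cantelli_eq[OF assms(1) \<mu>_pos] by simp
qed

lemma Cantelli_bound:
  assumes "0 \<le> y" "\<mu> * y \<le> \<Delta>\<^sup>2"
  shows "\<mu> / (\<mu> + \<Delta>\<^sup>2) \<le> 1 / (1 + y)"
proof -
  have "\<mu> * (1 + y) \<le> 1 * (\<mu> + \<Delta>\<^sup>2)" using assms by (simp add: algebra_simps)
  moreover have "\<mu> + \<Delta>\<^sup>2 > 0" using \<mu>_pos by (simp add: add_pos_nonneg)
  ultimately show ?thesis using assms by (simp add: divide_le_eq le_divide_eq mult.commute)
qed

text \<open>Missing the mean by the factor \<open>\<gamma>\<close> makes squared deviation over mean
  equal to \<open>9.84 * w\<close>: the pivot is scaled so that \<open>\<gamma>\<close> drops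
  out.\<close>

lemma \<mu>_square: "(\<gamma> * \<mu>)\<^sup>2 = \<mu> * ((246/25) * w)"
proof -
  have "(\<gamma> * \<mu>)\<^sup>2 = \<mu> * (w * (\<gamma>\<^sup>2 * pivot \<gamma>))" by (simp add: power2_eq_square)
  then show ?thesis unfolding pivot_\<gamma> by simp
qed

text \<open>The bound falls with \<open>w\<close>, so a lower estimate \<open>w\<^sub>0\<close>
  suffices; the exact \<open>w\<close> depends on the unknown position of the pivot between two
  levels.\<close>

lemma prob_low:
  assumes "0 < w\<^sub>0" "w\<^sub>0 \<le> w"
  shows "measure_pmf.prob M {\<omega>. Z \<omega> \<le> (1 - \<gamma>) * \<mu>} \<le> 1 / (1 + (246/25) * w\<^sub>0)"
proof -
  have "measure_pmf.prob M {\<omega>. Z \<omega> \<le> (1 - \<gamma>) * \<mu>} \<le> \<mu> / (\<mu> + (\<gamma> * \<mu>)\<^sup>2)"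
    using \<mu>_pos \<gamma>_pos by (intro Cantelli_below) (auto simp: algebra_simps)
  also have "\<dots> \<le> 1 / (1 + (246/25) * w\<^sub>0)"
  proof (rule Cantelli_bound)
    show "\<mu> * ((246/25) * w\<^sub>0) \<le> (\<gamma> * \<mu>)\<^sup>2"
      unfolding \<mu>_square using assms \<mu>_pos by (intro mult_left_mono) auto
  qed (use assms in simp)
  finally show ?thesis .
qed

lemma prob_high:
  assumes "0 < w\<^sub>0" "w\<^sub>0 \<le> w"
  shows "measure_pmf.prob M {\<omega>. (1 + \<gamma>) * \<mu> \<le> Z \<omega>} \<le> 1 / (1 + (246/25) * w\<^sub>0)"
proof -
  have "measure_pmf.prob M {\<omega>. (1 + \<gamma>) * \<mu> \<le> Z \<omega>} \<le> \<mu> / (\<mu> + (\<gamma> * \<mu>)\<^sup>2)"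
    using \<mu>_pos \<gamma>_pos by (intro Cantelli_above) (auto simp: algebra_simps)
  also have "\<dots> \<le> 1 / (1 + (246/25) * w\<^sub>0)"
  proof (rule Cantelli_bound)
    show "\<mu> * ((246/25) * w\<^sub>0) \<le> (\<gamma> * \<mu>)\<^sup>2"
      unfolding \<mu>_square using assms \<mu>_pos by (intro mult_left_mono) auto
  qed (use assms in simp)
  finally show ?thesis .
qed

text \<open>With the threshold equal to \<open>D\<close> pivots, squared deviation over mean is
  \<open>(w - D)\<^sup>2 / w\<close> pivots. It grows for \<open>w \<ge> D\<close>, so it is
  smallest at \<open>w\<^sub>0\<close>, where the gap is at least
  \<open>y * \<gamma>\<close>.\<close>

lemma prob_unsaturated:
  assumes "0 < y" "1 + \<gamma> + \<gamma>\<^sup>2 / (246/25) + y * \<gamma> \<le> w\<^sub>0" "w\<^sub>0 \<le> w"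
  shows "measure_pmf.prob M {\<omega>. Z \<omega> < sat_bound \<gamma>} \<le> 1 / (1 + (246/25) * y\<^sup>2 / w\<^sub>0)"
proof -
  define D where "D = 1 + \<gamma> + \<gamma>\<^sup>2 / (246/25)"
  have D: "0 < D" using \<gamma>_pos by (simp add: D_def add_pos_nonneg)
  have yg: "0 < y * \<gamma>" using assms \<gamma>_pos by simp
  have Dw: "D + y * \<gamma> \<le> w\<^sub>0" using assms by (simp add: D_def)
  have T: "sat_bound \<gamma> = D * pivot \<gamma>"
    using pivot_\<gamma> by (simp add: sat_bound_def D_def field_simps)
  have "measure_pmf.prob M {\<omega>. Z \<omega> < sat_bound \<gamma>} \<le> \<mu> / (\<mu> + ((w - D) * pivot \<gamma>)\<^sup>2)"
    using pivot_gt Dw yg assms(3) by (intro Cantelli_below) (auto simp: T algebra_simps)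
  also have "\<dots> \<le> 1 / (1 + (246/25) * y\<^sup>2 / w\<^sub>0)"
  proof (rule Cantelli_bound)
    have w0: "0 < w\<^sub>0" using Dw D yg by linarith
    then show "0 \<le> (246/25) * y\<^sup>2 / w\<^sub>0" by simp
    have "w * (w\<^sub>0 - D)\<^sup>2 \<le> w\<^sub>0 * (w - D)\<^sup>2"
    proof -
      have "w\<^sub>0 * (w - D)\<^sup>2 - w * (w\<^sub>0 - D)\<^sup>2 = (w - w\<^sub>0) * (w * w\<^sub>0 - D * D)"
        by (simp add: power2_eq_square algebra_simps)
      moreover have "D * D \<le> w * w\<^sub>0" using D Dw yg assms(3) by (intro mult_mono) auto
      ultimately show ?thesis using assms(3) by (smt (verit) mult_nonneg_nonneg)
    qed
    moreover have "w * (y * \<gamma>)\<^sup>2 \<le> w * (w\<^sub>0 - D)\<^sup>2"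
      using Dw yg w_pos by (intro mult_left_mono power_mono) auto
    ultimately have "w * (y * \<gamma>)\<^sup>2 / w\<^sub>0 \<le> (w - D)\<^sup>2"
      using w0 by (simp add: divide_le_eq mult.commute)
    then have "(pivot \<gamma>)\<^sup>2 * (w * (y * \<gamma>)\<^sup>2 / w\<^sub>0) \<le> (pivot \<gamma>)\<^sup>2 * (w - D)\<^sup>2"
      by (intro mult_left_mono) auto
    moreover have "(pivot \<gamma>)\<^sup>2 * (w * (y * \<gamma>)\<^sup>2 / w\<^sub>0) = \<mu> * ((\<gamma>\<^sup>2 * pivot \<gamma>) * y\<^sup>2 / w\<^sub>0)"
      by (simp add: power2_eq_square)
    ultimately show "\<mu> * ((246/25) * y\<^sup>2 / w\<^sub>0) \<le> ((w - D) * pivot \<gamma>)\<^sup>2"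
      unfolding pivot_\<gamma> by (simp add: power_mult_distrib mult.commute)
  qed
  finally show ?thesis .
qed

text \<open>The gap \<open>1 + \<gamma> - w\<close> in pivots is at least
  \<open>\<gamma> * (2 - w)\<close>, as the two differ by \<open>(1 - \<gamma>) * (1 - w)\<close>.
  This frees the bound of \<open>\<gamma>\<close>; the summand 1 in the threshold is given
  away.\<close>

lemma prob_saturated:
  assumes "w \<le> w\<^sub>0" "w\<^sub>0 \<le> 1"
  shows "measure_pmf.prob M {\<omega>. sat_bound \<gamma> \<le> Z \<omega>} \<le> 1 / (1 + (246/25) * (2 - w\<^sub>0)\<^sup>2 / w\<^sub>0)"
proof -
  define \<Delta> where "\<Delta> = (1 + \<gamma> - w) * pivot \<gamma>"
  have l: "\<Delta> > 0" using assms \<gamma>_pos pivot_gt by (simp add: \<Delta>_def)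
  have w0: "0 < w\<^sub>0" using assms w_pos by simp
  have "measure_pmf.prob M {\<omega>. sat_bound \<gamma> \<le> Z \<omega>} \<le> \<mu> / (\<mu> + \<Delta>\<^sup>2)"
    by (rule Cantelli_above[OF l]) (auto simp: sat_bound_def \<Delta>_def algebra_simps)
  also have "\<dots> \<le> 1 / (1 + (246/25) * (2 - w\<^sub>0)\<^sup>2 / w\<^sub>0)"
  proof (rule Cantelli_bound)
    show "0 \<le> (246/25) * (2 - w\<^sub>0)\<^sup>2 / w\<^sub>0" using w0 by simp
    have "\<gamma> * (1 - w) \<le> 1 * (1 - w)"
      using assms \<gamma>_less by (intro mult_right_mono) auto
    then have "\<gamma> * (2 - w) \<le> 1 + \<gamma> - w" by (simp add: algebra_simps)
    moreover have "\<gamma> * (2 - w\<^sub>0) \<le> \<gamma> * (2 - w)" using assms \<gamma>_pos by (intro mult_left_mono) auto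
    ultimately have "\<gamma> * (2 - w\<^sub>0) \<le> 1 + \<gamma> - w" by linarith
    moreover have "0 \<le> \<gamma> * (2 - w\<^sub>0)" using assms \<gamma>_pos by simp
    ultimately have "(\<gamma> * (2 - w\<^sub>0))\<^sup>2 \<le> (1 + \<gamma> - w)\<^sup>2" by (rule power_mono)
    moreover have "w * (\<gamma> * (2 - w\<^sub>0))\<^sup>2 / w\<^sub>0 \<le> 1 * (\<gamma> * (2 - w\<^sub>0))\<^sup>2"
      using assms w0 by (simp add: divide_le_eq mult_right_mono mult.commute)
    ultimately have "(pivot \<gamma>)\<^sup>2 * (w * (\<gamma> * (2 - w\<^sub>0))\<^sup>2 / w\<^sub>0) \<le> (pivot \<gamma>)\<^sup>2 * (1 + \<gamma> - w)\<^sup>2"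
      by (intro mult_left_mono) auto
    moreover have "(pivot \<gamma>)\<^sup>2 * (w * (\<gamma> * (2 - w\<^sub>0))\<^sup>2 / w\<^sub>0) = \<mu> * ((\<gamma>\<^sup>2 * pivot \<gamma>) * (2 - w\<^sub>0)\<^sup>2 / w\<^sub>0)"
      by (simp add: power2_eq_square)
    ultimately show "\<mu> * ((246/25) * (2 - w\<^sub>0)\<^sup>2 / w\<^sub>0) \<le> \<Delta>\<^sup>2"
      unfolding pivot_\<gamma> \<Delta>_def by (simp add: power_mult_distrib mult.commute)
  qed
  finally show ?thesis .
qed

text \<open>Cantelli's centre for the lower tail is \<open>\<mu> + 1 / \<gamma>\<close>. The lower
  limit reflected in it is \<open>\<mu> + \<gamma> * \<mu> + 2 / \<gamma>\<close>, and for
  \<open>w \<le> 0.89\<close> the threshold lies beyond. So the same quadratic covers saturation at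
  no extra cost.\<close>

lemma saturated_dev:
  assumes "w \<le> 89/100" "Z \<omega> \<le> (1 - \<gamma>) * \<mu> \<or> sat_bound \<gamma> \<le> Z \<omega>"
  shows "\<gamma> * \<mu> + 1 / \<gamma> \<le> \<bar>Z \<omega> - (\<mu> + 1 / \<gamma>)\<bar>"
proof -
  have inv: "1 / \<gamma> = \<gamma> * pivot \<gamma> / (246/25)"
    using \<gamma>_pos by (simp add: pivot_def power2_eq_square field_simps)
  have "(1 + \<gamma>) * \<mu> + 2 * (1 / \<gamma>) \<le> sat_bound \<gamma>"
  proof -
    have "(1 + \<gamma>) * w \<le> (1 + \<gamma>) * (89/100)"
      using assms(1) \<gamma>_pos by (intro mult_left_mono) auto
    \<comment> \<open>In units of the pivot \<open>2 / \<gamma>\<close> is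
      \<open>2 * \<gamma> / 9.84\<close>, at most 11 percent of \<open>1 + \<gamma>\<close>: the
      room left by the limit 0.89.\<close>
    moreover have "2 * \<gamma> / (246/25) \<le> (1 + \<gamma>) * (11/100)" using \<gamma>_less by simp
    moreover have "(1 + \<gamma>) * (89/100) + (1 + \<gamma>) * (11/100) = 1 + \<gamma>" by (simp add: field_simps)
    ultimately have "(1 + \<gamma>) * w + 2 * \<gamma> / (246/25) \<le> 1 + \<gamma>" by linarith
    then have "((1 + \<gamma>) * w + 2 * \<gamma> / (246/25)) * pivot \<gamma> \<le> (1 + \<gamma>) * pivot \<gamma>"
      using pivot_gt by (intro mult_right_mono) auto
    then show ?thesis unfolding inv sat_bound_def by (simp add: algebra_simps)
  qed
  then have hi: "\<mu> + \<gamma> * \<mu> + 2 * (1 / \<gamma>) \<le> sat_bound \<gamma>" by (simp add: algebra_simps)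
  have lo: "(1 - \<gamma>) * \<mu> = \<mu> - \<gamma> * \<mu>" by (simp add: algebra_simps)
  have pos: "0 < 1 / \<gamma>" using \<gamma>_pos by simp
  have "g + u \<le> \<bar>z - (m + u)\<bar>" if "m + g + 2 * u \<le> s" "0 < u" "z \<le> m - g \<or> s \<le> z" for g u z m s :: real
    using that by linarith
  from this[OF hi pos assms(2)[unfolded lo]] show ?thesis .
qed

lemma Cantelli_center:
  "(\<mu> + (\<mu> - (\<mu> + 1 / \<gamma>))\<^sup>2) / (\<gamma> * \<mu> + 1 / \<gamma>)\<^sup>2 = 1 / (1 + (246/25) * w)"
proof -
  have "\<gamma> * \<mu> > 0" using \<mu>_pos \<gamma>_pos by simp
  moreover have "\<mu> / (\<gamma> * \<mu>) = 1 / \<gamma>" using w_pos pivot_gt by simp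
  ultimately have "(\<mu> + (\<mu> - (\<mu> + 1 / \<gamma>))\<^sup>2) / (\<gamma> * \<mu> + 1 / \<gamma>)\<^sup>2 = \<mu> / (\<mu> + (\<gamma> * \<mu>)\<^sup>2)"
    using Cantelli_eq[OF _ \<mu>_pos, of "\<gamma> * \<mu>"] by simp
  also have "\<mu> + (\<gamma> * \<mu>)\<^sup>2 = \<mu> * (1 + (246/25) * w)" unfolding \<mu>_square by (simp add: algebra_simps)
  finally show ?thesis using pivot_gt w_pos by simp
qed

text \<open>Up to \<open>w = 0.89\<close> Cantelli's bound covers both tails. Between 0.89 and 1
  Chebyshev's inequality gives \<open>1 / (9.84 * w)\<close>, and
  \<open>9.84 * 0.89 \<ge> 1 + 9.84 * 0.78\<close> explains the limit 0.78 on
  \<open>w\<^sub>0\<close>.\<close>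

lemma prob_low_or_saturated:
  assumes "0 < w\<^sub>0" "w\<^sub>0 \<le> w" "w\<^sub>0 \<le> 78/100" "w \<le> 1"
  shows "measure_pmf.prob M {\<omega>. Z \<omega> \<le> (1 - \<gamma>) * \<mu> \<or> sat_bound \<gamma> \<le> Z \<omega>} \<le> 1 / (1 + (246/25) * w\<^sub>0)"
proof (cases "w \<le> 89/100")
  case True
  have "measure_pmf.prob M {\<omega>. Z \<omega> \<le> (1 - \<gamma>) * \<mu> \<or> sat_bound \<gamma> \<le> Z \<omega>} \<le>
      (\<mu> + (\<mu> - (\<mu> + 1 / \<gamma>))\<^sup>2) / (\<gamma> * \<mu> + 1 / \<gamma>)\<^sup>2"
    using \<mu>_pos \<gamma>_pos by (intro deviation saturated_dev[OF True]) (auto intro: add_pos_pos)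
  also have "\<dots> \<le> 1 / (1 + (246/25) * w\<^sub>0)"
    unfolding Cantelli_center using assms by (simp add: frac_le)
  finally show ?thesis .
next
  case False
  have "w * pivot \<gamma> * (1 + \<gamma>) \<le> 1 * pivot \<gamma> * (1 + \<gamma>)"
    using assms pivot_gt \<gamma>_pos by (intro mult_right_mono) auto
  then have "(1 + \<gamma>) * \<mu> \<le> sat_bound \<gamma>" by (simp add: sat_bound_def algebra_simps)
  moreover define g where "g = \<gamma> * \<mu>"
  moreover have "(1 - \<gamma>) * \<mu> = \<mu> - \<gamma> * \<mu>" "(1 + \<gamma>) * \<mu> = \<mu> + \<gamma> * \<mu>" by (simp_all add: algebra_simps)
  ultimately have lo: "(1 - \<gamma>) * \<mu> = \<mu> - g" and hi: "\<mu> + g \<le> sat_bound \<gamma>" by simp_all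
  have g: "g > 0" using \<mu>_pos \<gamma>_pos by (simp add: g_def)
  have "measure_pmf.prob M {\<omega>. Z \<omega> \<le> (1 - \<gamma>) * \<mu> \<or> sat_bound \<gamma> \<le> Z \<omega>} \<le> (\<mu> + (\<mu> - \<mu>)\<^sup>2) / g\<^sup>2"
  proof (rule deviation[OF g])
    fix \<omega> assume "Z \<omega> \<le> (1 - \<gamma>) * \<mu> \<or> sat_bound \<gamma> \<le> Z \<omega>"
    then show "g \<le> \<bar>Z \<omega> - \<mu>\<bar>" unfolding lo using hi by linarith
  qed
  also have "\<dots> = 1 / ((246/25) * w)" unfolding g_def \<mu>_square using pivot_gt w_pos by simp
  also have "\<dots> \<le> 1 / (1 + (246/25) * w\<^sub>0)" using False assms by (intro frac_le) auto
  finally show ?thesis .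
qed

text \<open>For a mean slightly above the pivot the lower limit is at distance at least
  \<open>G\<close> and the threshold at least \<open>G * (1 - t)\<close>. The square is taken about
  the midpoint of this asymmetric interval, with its half-length \<open>G * (2 - t) / 2\<close> as
  radius.\<close>

lemma prob_low_or_saturated_above_pivot:
  assumes "1 \<le> w" "w \<le> w\<^sub>1" "w\<^sub>1 - 1 \<le> t * \<gamma>" "0 \<le> t" "t \<le> 1"
  shows "measure_pmf.prob M {\<omega>. Z \<omega> \<le> (1 - \<gamma>) * \<mu> \<or> sat_bound \<gamma> \<le> Z \<omega>} \<le>
    (4 * w\<^sub>1 / (246/25) + t\<^sup>2) / (2 - t)\<^sup>2"
proof -
  define G where "G = \<gamma> * pivot \<gamma>"
  have G: "G > 0" using \<gamma>_pos pivot_gt by (simp add: G_def)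
  have "G * 1 \<le> G * w" using G assms by (intro mult_left_mono) auto
  then have lo: "(1 - \<gamma>) * \<mu> \<le> \<mu> - G" by (simp add: G_def algebra_simps)
  have "(1 + \<gamma> - w) * pivot \<gamma> \<ge> (\<gamma> * (1 - t)) * pivot \<gamma>"
    using assms pivot_gt by (intro mult_right_mono) (auto simp: algebra_simps)
  then have hi: "\<mu> + G * (1 - t) \<le> sat_bound \<gamma>" by (simp add: sat_bound_def G_def algebra_simps)
  let ?m = "\<mu> - G * t / 2" and ?R = "G * (2 - t) / 2"
  have "measure_pmf.prob M {\<omega>. Z \<omega> \<le> (1 - \<gamma>) * \<mu> \<or> sat_bound \<gamma> \<le> Z \<omega>} \<le> (\<mu> + (\<mu> - ?m)\<^sup>2) / ?R\<^sup>2"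
  proof (intro deviation)
    show "?R > 0" using G assms by simp
    fix \<omega> assume "Z \<omega> \<le> (1 - \<gamma>) * \<mu> \<or> sat_bound \<gamma> \<le> Z \<omega>"
    moreover have "?R = G - G * t / 2" "G * (1 - t) = G - G * t" by (simp_all add: field_simps)
    ultimately show "?R \<le> \<bar>Z \<omega> - ?m\<bar>" using lo hi by linarith
  qed
  also have "\<mu> + (\<mu> - ?m)\<^sup>2 = G\<^sup>2 * ((4 * w / (246/25) + t\<^sup>2) / 4)"
  proof -
    have "G\<^sup>2 = (\<gamma>\<^sup>2 * pivot \<gamma>) * pivot \<gamma>" by (simp add: G_def power2_eq_square)
    then have "\<mu> = G\<^sup>2 * (w / (246/25))" unfolding pivot_\<gamma> by simp
    moreover have "(\<mu> - ?m)\<^sup>2 = G\<^sup>2 * (t\<^sup>2 / 4)" by (simp add: power2_eq_square)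
    ultimately show ?thesis by (simp add: algebra_simps)
  qed
  also have "?R\<^sup>2 = G\<^sup>2 * ((2 - t)\<^sup>2 / 4)"
    by (simp add: power2_eq_square field_simps)
  also have "G\<^sup>2 * ((4 * w / (246/25) + t\<^sup>2) / 4) / (G\<^sup>2 * ((2 - t)\<^sup>2 / 4)) = (4 * w / (246/25) + t\<^sup>2) / (2 - t)\<^sup>2"
    using G by simp
  also have "\<dots> \<le> (4 * w\<^sub>1 / (246/25) + t\<^sup>2) / (2 - t)\<^sup>2"
    using assms by (intro divide_right_mono) auto
  finally show ?thesis .
qed

end

section \<open>The sharpened union bound for a critical cell\<close>

text \<open>Monotone in \<open>e\<close> because its coefficient is nonnegative, and in
  \<open>s\<close> because the difference quotient is
  \<open>1 - (1 - q) * e * (1 - s - s\<^sub>0) \<ge> 0\<close>. It lets the true mean be replaced by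
  a lower estimate.\<close>

lemma union_bound_mono:
  fixes s e q :: real
  assumes "0 < s" "s \<le> s\<^sub>0" "s\<^sub>0 \<le> 1" "e \<le> e\<^sub>0" "0 \<le> e" "e\<^sub>0 \<le> 1" "0 \<le> q" "q \<le> 1"
  shows "s + (1 - (1 - q) * (s * (1 - s))) * e \<le> s\<^sub>0 + (1 - (1 - q) * (s\<^sub>0 * (1 - s\<^sub>0))) * e\<^sub>0"
proof -
  have "s\<^sub>0 * (1 - s\<^sub>0) \<le> 1 * 1" using assms by (intro mult_mono) auto
  then have "(1 - q) * (s\<^sub>0 * (1 - s\<^sub>0)) \<le> 1 * 1" using assms by (intro mult_mono) auto
  then have 1: "(1 - (1 - q) * (s\<^sub>0 * (1 - s\<^sub>0))) * e \<le> (1 - (1 - q) * (s\<^sub>0 * (1 - s\<^sub>0))) * e\<^sub>0"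
    using assms by (intro mult_left_mono) auto
  have "(1 - q) * e \<le> 1 * 1" using assms by (intro mult_mono) auto
  then have "(1 - q) * e * (1 - s - s\<^sub>0) \<le> 1"
    using assms by (smt (verit) mult_left_le mult_nonneg_nonneg)
  then have "0 \<le> (s\<^sub>0 - s) * (1 - (1 - q) * e * (1 - s - s\<^sub>0))" using assms by simp
  also have "\<dots> = (s\<^sub>0 + (1 - (1 - q) * (s\<^sub>0 * (1 - s\<^sub>0))) * e) - (s + (1 - (1 - q) * (s * (1 - s))) * e)"
    by (simp add: algebra_simps)
  finally show ?thesis using 1 by linarith
qed

text \<open>Uses Cantelli's centre: as \<open>?R = 1 / (s' * \<gamma>)\<close>, the choice
  \<open>\<kappa> = (1 - q) * (s' * (1 - s'))\<close> makes \<open>\<kappa> * ?R\<^sup>2\<close>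
  equal to \<open>(1 - q) * \<mu>\<close>, and the centre exceeds \<open>\<mu> + 1 / 4\<close>
  because \<open>1 / \<gamma> \<ge> 1\<close>.\<close>

lemma prob_low_or_saturated_union:
  assumes M: "pairwise_sieve M f X q'" and H: "pairwise_sieve H g X q"
    and X: "finite X" and q: "0 \<le> q'" "0 \<le> q" "q \<le> 1"
    and \<gamma>: "0 < \<gamma>" "\<gamma> < 1" and w: "0 < w\<^sub>0" "w\<^sub>0 \<le> w" "w \<le> 89/100"
    and mean: "q' * q * real (card X) = w * pivot \<gamma>"
    and E: "measure_pmf.prob M {\<omega>. E \<omega>} \<le> e" "e \<le> 1"
    and s: "s = 1 / (1 + (246/25) * w\<^sub>0)"
  shows "measure_pmf.prob (pair_pmf M H) {p. E (fst p) \<or>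
      (let Z = real (card {x\<in>X. f (fst p) x \<and> g (snd p) x}) in
        Z \<le> (1 - \<gamma>) * (w * pivot \<gamma>) \<or> sat_bound \<gamma> \<le> Z)} \<le> s + (1 - (1 - q) * (s * (1 - s))) * e"
proof -
  interpret cell_sieve "pair_pmf M H" "\<lambda>p x. f (fst p) x \<and> g (snd p) x" X "q' * q" \<gamma> w
    using pairwise_sieve_pair[OF M H] X q \<gamma> w mean by unfold_locales auto
  define s' where "s' = 1 / (1 + (246/25) * w)"
  let ?m = "\<mu> + 1 / \<gamma>" and ?R = "\<gamma> * \<mu> + 1 / \<gamma>"
  have R: "?R > 0" using \<mu>_pos \<gamma> by (intro add_pos_pos) auto
  have "measure_pmf.prob (pair_pmf M H) {p. E (fst p) \<or>
      (let Z = real (card {x\<in>{x\<in>X. f (fst p) x}. g (snd p) x}) in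
        Z \<le> (1 - \<gamma>) * (w * pivot \<gamma>) \<or> sat_bound \<gamma> \<le> Z)} \<le>
      (1 - (1 - q) * (s' * (1 - s'))) * measure_pmf.prob M {\<omega>. E \<omega>} + (\<mu> + (\<mu> - ?m)\<^sup>2) / ?R\<^sup>2"
  proof (rule prob_union_deviation[OF pairwise_sieve_finite[OF M] H q(2,3) _ X R])
    show "{x\<in>X. f \<omega> x} \<subseteq> X" for \<omega> by auto
    have cell: "{x\<in>{x\<in>X. f \<omega> x}. g h x} = {x\<in>X. f \<omega> x \<and> g h x}" for \<omega> h by auto
    show "?R \<le> \<bar>real (card {x\<in>{x\<in>X. f \<omega> x}. g h x}) - ?m\<bar>"
      if "let Z = real (card {x\<in>{x\<in>X. f \<omega> x}. g h x}) in
        Z \<le> (1 - \<gamma>) * (w * pivot \<gamma>) \<or> sat_bound \<gamma> \<le> Z" for \<omega> h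
      using saturated_dev[OF w(3), of "(\<omega>, h)"] that unfolding cell Let_def by simp
    show "(1 - q) * (s' * (1 - s')) * ?R\<^sup>2 \<le> (1 - q) * (?m - 1 / 4)"
    proof -
      have "?R = 1 / (s' * \<gamma>)"
      proof -
        have "\<gamma> * ?R = \<gamma>\<^sup>2 * pivot \<gamma> * w + 1" using \<gamma> by (simp add: power2_eq_square field_simps)
        then have "\<gamma> * ?R = 1 / s'" unfolding pivot_\<gamma> s'_def by simp
        moreover have "?R = (\<gamma> * ?R) / \<gamma>" using \<gamma>(1) by simp
        ultimately show ?thesis by simp
      qed
      moreover have s': "s' > 0" using w by (simp add: s'_def)
      ultimately have "s' * (1 - s') * ?R\<^sup>2 = (1 - s') / s' / \<gamma>\<^sup>2"
        using \<gamma> by (simp add: power2_eq_square)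
      also have "(1 - s') / s' = (246/25) * w" using w by (simp add: s'_def field_simps)
      also have "(246/25) * w / \<gamma>\<^sup>2 = \<mu>" by (simp add: pivot_def)
      finally have "s' * (1 - s') * ?R\<^sup>2 = \<mu>" .
      moreover have "1 / \<gamma> \<ge> 1" using \<gamma> by simp
      ultimately have "(1 - q) * (s' * (1 - s') * ?R\<^sup>2) \<le> (1 - q) * (?m - 1 / 4)"
        using q by (intro mult_left_mono) auto
      then show ?thesis by (simp add: mult.assoc)
    qed
    have "q' * q * (1 - q' * q) * real (card X) \<le> \<mu>"
    proof -
      have "0 \<le> q' * q * (q' * q) * real (card X)" using q by simp
      then show ?thesis unfolding mean[symmetric] by (simp add: algebra_simps)
    qed
    then show "measure_pmf.expectation (pair_pmf M H)
        (\<lambda>p. (real (card {x\<in>{x\<in>X. f (fst p) x}. g (snd p) x}) - ?m)\<^sup>2) \<le> \<mu> + (\<mu> - ?m)\<^sup>2"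
      unfolding cell pairwise_sieve_second_moment[OF sieve X] mean by simp
  qed
  also have "\<dots> = s' + (1 - (1 - q) * (s' * (1 - s'))) * measure_pmf.prob M {\<omega>. E \<omega>}"
    unfolding Cantelli_center s'_def by simp
  also have "\<dots> \<le> s + (1 - (1 - q) * (s * (1 - s))) * e"
    by (rule union_bound_mono) (use w q E in \<open>auto simp: s s'_def field_simps\<close>)
  finally show ?thesis by (simp add: conj_ac)
qed

section \<open>Error probability of one iteration\<close>

lemma pairwise_sieve_fst:
  assumes "pairwise_sieve M f X q" "finite (set_pmf M')"
  shows "pairwise_sieve (pair_pmf M M') (\<lambda>\<omega>. f (fst \<omega>)) X q"
  by (rule pairwise_sieve_of_map[where h = fst])
     (use assms pairwise_sieve_finite[OF assms(1)] in \<open>auto simp: map_fst_pair_pmf\<close>)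

lemma pairwise_sieve_snd:
  assumes "pairwise_sieve M' f X q" "finite (set_pmf M)"
  shows "pairwise_sieve (pair_pmf M M') (\<lambda>\<omega>. f (snd \<omega>)) X q"
  by (rule pairwise_sieve_of_map[where h = snd])
     (use assms pairwise_sieve_finite[OF assms(1)] in \<open>auto simp: map_snd_pair_pmf\<close>)

text \<open>\<open>j\<close> is the predecessor of the least level whose mean is at most
  \<open>p\<close>; \<open>b\<close> is the mean at level \<open>j\<close> in units of
  \<open>p\<close>.\<close>

lemma geometric_level:
  fixes c p r :: real
  assumes "p > 0" "p < c" "r \<ge> 2" "c \<le> p * r ^ N"
  shows "\<exists>j b. j < N \<and> 1 < b \<and> b \<le> r \<and> c = b * p * r ^ j"
proof -
  define k where "k = (LEAST k. c \<le> p * r ^ k)"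
  have k: "c \<le> p * r ^ k" "k \<le> N"
    unfolding k_def by (rule LeastI, rule assms(4)) (rule Least_le, rule assms(4))
  have "k \<noteq> 0" using k(1) assms(2) by (cases k) auto
  then obtain j where j: "k = Suc j" by (cases k) auto
  have "\<not> c \<le> p * r ^ j" using not_less_Least[of j "\<lambda>k. c \<le> p * r ^ k"] j by (simp add: k_def)
  then have lt: "p * r ^ j < c" by simp
  have pos: "p * r ^ j > 0" using assms by simp
  define b where "b = c / (p * r ^ j)"
  have "c = b * p * r ^ j" using assms by (simp add: b_def)
  moreover have "1 < b" using lt pos by (simp add: b_def)
  moreover have "b \<le> r"
  proof -
    have "c \<le> r * (p * r ^ j)" using k(1) j by (simp add: mult_ac)
    then show ?thesis unfolding b_def using pos by (simp add: divide_le_eq)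
  qed
  moreover have "j < N" using k(2) j by simp
  ultimately show ?thesis by blast
qed

section \<open>Levels of nested cells\<close>

locale hashing =
  fixes X :: "'x set" and H :: "('x \<Rightarrow> bool) pmf" and r N :: nat and \<gamma> :: real
  assumes finite_X: "finite X" and H: "pairwise_sieve H (\<lambda>h. h) X (1 / real r)"
    and r_ge: "2 \<le> r" and \<gamma>_pos: "0 < \<gamma>" and \<gamma>_less: "\<gamma> < 1"
    and card_le: "card X \<le> 2 ^ N" and card_ge: "sat_bound \<gamma> \<le> real (card X)"
begin

abbreviation T :: real where "T \<equiv> sat_bound \<gamma>"

definition A :: "('x \<Rightarrow> bool) list \<Rightarrow> nat \<Rightarrow> real" where
  "A hs k = real (card {x\<in>X. \<forall>h\<in>set (take k hs). h x})"

lemma A_antimono: "k \<le> k' \<Longrightarrow> A hs k' \<le> A hs k"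
proof -
  assume "k \<le> k'"
  then have sub: "set (take k hs) \<subseteq> set (take k' hs)" by (rule set_take_subset_set_take)
  have "(\<forall>h\<in>set (take k' hs). h x) \<longrightarrow> (\<forall>h\<in>set (take k hs). h x)" for x
  proof (intro impI ballI)
    fix h assume all: "\<forall>h\<in>set (take k' hs). h x" and h: "h \<in> set (take k hs)"
    show "h x" by (rule bspec[OF all subsetD[OF sub h]])
  qed
  then have "{x\<in>X. \<forall>h\<in>set (take k' hs). h x} \<subseteq> {x\<in>X. \<forall>h\<in>set (take k hs). h x}"
    by (intro Collect_mono conj_mono imp_refl)
  moreover have "finite {x\<in>X. \<forall>h\<in>set (take k hs). h x}" using finite_X by simp
  ultimately show ?thesis unfolding A_def of_nat_le_iff by (rule card_mono[rotated])
qed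

lemma A_take: "k \<le> j \<Longrightarrow> A (take j hs) k = A hs k"
  by (simp add: A_def min_def)

definition first_unsat :: "('x \<Rightarrow> bool) list \<Rightarrow> nat \<Rightarrow> bool" where
  "first_unsat hs k \<longleftrightarrow> 0 < k \<and> k \<le> N \<and> A hs k < T \<and> T \<le> A hs (k - 1)"

lemma pivot_gt: "pivot \<gamma> > 246/25"
proof -
  have "\<gamma> * \<gamma> < 1 * 1" using \<gamma>_pos \<gamma>_less by (intro mult_strict_mono) auto
  then show ?thesis using \<gamma>_pos by (simp add: pivot_def power2_eq_square field_simps)
qed

text \<open>The whole space is saturated and so exceeds the pivot, while \<open>N\<close>
  constraints bring the mean down to at most 1; the mean crosses the pivot in between.\<close>

lemma ex_level:
  "\<exists>j b. j < N \<and> 1 < b \<and> b \<le> real r \<and> real (card X) = b * pivot \<gamma> * real r ^ j"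
proof (rule geometric_level)
  show "pivot \<gamma> > 0" using pivot_gt by simp
  have "pivot \<gamma> * 1 \<le> pivot \<gamma> * (1 + \<gamma>)" using pivot_gt \<gamma>_pos by (intro mult_left_mono) auto
  then show "pivot \<gamma> < real (card X)" using card_ge by (simp add: sat_bound_def)
  show "2 \<le> real r" using r_ge by simp
  have "real (card X) \<le> real (2 ^ N)" using card_le by (simp only: of_nat_le_iff)
  also have "\<dots> \<le> 1 * real r ^ N" using r_ge by (simp add: power_mono)
  also have "1 * real r ^ N \<le> pivot \<gamma> * real r ^ N" using pivot_gt by (intro mult_right_mono) auto
  finally show "real (card X) \<le> pivot \<gamma> * real r ^ N" .
qed

text \<open>An unsaturated cell of mean size above the pivot cannot be too large by a factor
  \<open>1 / (1 - \<gamma>) = 1 + \<epsilon>\<close>.\<close>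

lemma sat_bound_le:
  assumes "1 \<le> w"
  shows "T \<le> w * pivot \<gamma> / (1 - \<gamma>)"
proof -
  have "\<gamma>\<^sup>2 * pivot \<gamma> = 246/25" using \<gamma>_pos by (simp add: pivot_def)
  then have "T * (1 - \<gamma>) = (1 - \<gamma>) + pivot \<gamma> - 246/25"
    by (simp add: sat_bound_def power2_eq_square algebra_simps)
  also have "\<dots> \<le> 1 * pivot \<gamma>" using \<gamma>_pos by simp
  also have "\<dots> \<le> w * pivot \<gamma>" using assms pivot_gt by (intro mult_right_mono) auto
  finally show ?thesis using \<gamma>_less by (simp add: le_divide_eq)
qed

lemma le_div_one_minus: "0 \<le> m \<Longrightarrow> (1 + \<gamma>) * m \<le> m / (1 - \<gamma>)"
proof -
  assume "0 \<le> m"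
  then have "(1 + \<gamma>) * m * (1 - \<gamma>) \<le> m" using \<gamma>_pos
    by (simp add: algebra_simps)
  then show ?thesis using \<gamma>_less by (simp add: le_divide_eq)
qed

text \<open>Below the pivot, a count above \<open>1 / (1 - \<gamma>)\<close> times the mean and
  saturation both push the cell to at least \<open>1 + \<gamma>\<close> times its mean, so one
  Cantelli event pays for both.\<close>

lemma high_le:
  assumes "w * pivot \<gamma> / (1 - \<gamma>) < z \<or> T \<le> z" "0 \<le> w" "w \<le> 1"
  shows "(1 + \<gamma>) * (w * pivot \<gamma>) \<le> z"
proof -
  have "w * (pivot \<gamma> * (1 + \<gamma>)) \<le> 1 * (pivot \<gamma> * (1 + \<gamma>))"
    using assms(3) pivot_gt \<gamma>_pos by (intro mult_right_mono) auto
  moreover have "(1 + \<gamma>) * (w * pivot \<gamma>) = w * (pivot \<gamma> * (1 + \<gamma>))" by simp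
  ultimately have "(1 + \<gamma>) * (w * pivot \<gamma>) \<le> T" unfolding sat_bound_def by linarith
  moreover have "(1 + \<gamma>) * (w * pivot \<gamma>) \<le> w * pivot \<gamma> / (1 - \<gamma>)"
    using assms(2) pivot_gt by (intro le_div_one_minus) auto
  ultimately show ?thesis using assms(1) by linarith
qed

end

text \<open>\<open>j\<close> is the last level whose mean exceeds the pivot. Levels are indexed from
  there: \<open>j - i\<close> constraints give a mean of \<open>b * r ^ i\<close> pivots, and
  \<open>Suc j\<close> constraints give \<open>b / r\<close>.\<close>

locale hashing_level = hashing X H r N \<gamma>
  for X :: "'x set" and H r N \<gamma> +
  fixes j :: nat and b :: real
  assumes j_less: "j < N" and b_gt: "1 < b" and b_le: "b \<le> real r"
    and card_eq: "real (card X) = b * pivot \<gamma> * real r ^ j"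
begin

lemma mean_up:
  assumes "i \<le> j"
  shows "(1 / real r) ^ (j - i) * real (card X) = (b * real r ^ i) * pivot \<gamma>"
proof -
  have "real r ^ j = real r ^ i * real r ^ (j - i)" using assms by (simp flip: power_add)
  then show ?thesis using r_ge by (simp add: card_eq power_one_over)
qed

lemma mean_next: "(1 / real r) ^ Suc j * real (card X) = (b / real r) * pivot \<gamma>"
  using r_ge unfolding card_eq by (simp add: power_one_over)

lemma cell_sieve_up:
  assumes "i \<le> j"
  shows "cell_sieve (replicate_pmf N H) (\<lambda>hs x. \<forall>h\<in>set (take (j - i) hs). h x) X
    ((1 / real r) ^ (j - i)) \<gamma> (b * real r ^ i)"
proof
  show "pairwise_sieve (replicate_pmf N H) (\<lambda>hs x. \<forall>h\<in>set (take (j - i) hs). h x) X ((1 / real r) ^ (j - i))"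
    using j_less by (intro pairwise_sieve_replicate_take H) simp
qed (use finite_X \<gamma>_pos \<gamma>_less b_gt r_ge mean_up[OF assms] in auto)

lemma cell_sieve_next:
  "cell_sieve (replicate_pmf N H) (\<lambda>hs x. \<forall>h\<in>set (take (Suc j) hs). h x) X
    ((1 / real r) ^ Suc j) \<gamma> (b / real r)"
proof
  show "pairwise_sieve (replicate_pmf N H) (\<lambda>hs x. \<forall>h\<in>set (take (Suc j) hs). h x) X ((1 / real r) ^ Suc j)"
    using j_less by (intro pairwise_sieve_replicate_take H) simp
qed (use finite_X \<gamma>_pos \<gamma>_less b_gt r_ge mean_next in auto)

end

subsection \<open>XOR hashing\<close>

context hashing
begin

definition bad_low :: "('x \<Rightarrow> bool) list \<Rightarrow> bool" where
  "bad_low hs \<longleftrightarrow> T \<le> A hs N \<or>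
    (\<exists>k. first_unsat hs k \<and> A hs k < (1 - \<gamma>) * (real (card X) / real r ^ k))"

definition bad_high :: "('x \<Rightarrow> bool) list \<Rightarrow> bool" where
  "bad_high hs \<longleftrightarrow> T \<le> A hs N \<or>
    (\<exists>k. first_unsat hs k \<and> real (card X) / real r ^ k / (1 - \<gamma>) < A hs k)"

end

context hashing_level
begin

abbreviation M :: "('x \<Rightarrow> bool) list pmf" where "M \<equiv> replicate_pmf N H"

lemma size_up: "i \<le> j \<Longrightarrow> real (card X) / real r ^ (j - i) = b * real r ^ i * pivot \<gamma>"
  using mean_up by (simp add: power_one_over)

lemma size_next: "real (card X) / real r ^ Suc j = b / real r * pivot \<gamma>"
  using mean_next by (simp add: power_one_over)

text \<open>The conjunct \<open>i \<le> j\<close> inside the event makes the bound usable for all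
  \<open>i\<close>: a level that does not exist contributes probability 0.\<close>

lemma prob_A_low:
  assumes "0 < w" "w \<le> b * real r ^ i"
  shows "measure_pmf.prob M {hs. i \<le> j \<and> A hs (j - i) \<le> (1 - \<gamma>) * (b * real r ^ i * pivot \<gamma>)} \<le>
    1 / (1 + 246/25 * w)"
proof (cases "i \<le> j")
  case True
  interpret cell_sieve M "\<lambda>hs x. \<forall>h\<in>set (take (j - i) hs). h x" X "(1 / real r) ^ (j - i)" \<gamma> "b * real r ^ i"
    by (rule cell_sieve_up[OF True])
  show ?thesis using prob_low[OF assms] True by (simp add: A_def)
qed (use assms in simp)

lemma prob_A_unsat:
  assumes "0 < y" "1 + \<gamma> + \<gamma>\<^sup>2 / (246/25) + y * \<gamma> \<le> w" "w \<le> b * real r ^ i"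
  shows "measure_pmf.prob M {hs. i \<le> j \<and> A hs (j - i) < T} \<le> 1 / (1 + 246/25 * y\<^sup>2 / w)"
proof (cases "i \<le> j")
  case True
  interpret cell_sieve M "\<lambda>hs x. \<forall>h\<in>set (take (j - i) hs). h x" X "(1 / real r) ^ (j - i)" \<gamma> "b * real r ^ i"
    by (rule cell_sieve_up[OF True])
  show ?thesis using prob_unsaturated[OF assms] True by (simp add: A_def)
next
  case False
  have "0 < y * \<gamma>" using assms \<gamma>_pos by simp
  moreover have "0 \<le> \<gamma>\<^sup>2 / (246/25)" by simp
  ultimately have "0 < w" using assms(2) \<gamma>_pos by linarith
  then show ?thesis using False by simp
qed

text \<open>For \<open>\<gamma> < 1\<close> the threshold stays below 2.11 pivots, since
  \<open>1 + 1 + 1 / 9.84\<close> is about 2.102.\<close>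

lemma unsat_margin:
  assumes "y + 211/100 \<le> w" "0 < y"
  shows "1 + \<gamma> + \<gamma>\<^sup>2 / (246/25) + y * \<gamma> \<le> w"
proof -
  have "\<gamma>\<^sup>2 \<le> 1" using \<gamma>_pos \<gamma>_less by (simp add: power_le_one)
  moreover have "y * \<gamma> \<le> y * 1" using assms \<gamma>_less by (intro mult_left_mono) auto
  moreover have "\<gamma>\<^sup>2 / (246/25) \<le> 11/100" using calculation(1) by simp
  ultimately show ?thesis using assms \<gamma>_less by linarith
qed

text \<open>Level \<open>Suc j\<close> has a mean of at least half a pivot and is charged for both
  tails, which includes searches ending beyond it. Levels \<open>j\<close> to \<open>j - 3\<close>
  have means of at least 1, 2, 4, 8 pivots. A search ending at \<open>j - 4\<close> or earlier
  leaves the cell at \<open>j - 4\<close> unsaturated, whose mean exceeds 16 pivots. The six charges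
  sum to about 0.356.\<close>

lemma prob_bad_low_XOR:
  assumes r: "r = 2"
  shows "measure_pmf.prob M {hs. bad_low hs} \<le> 36/100"
proof -
  interpret nxt: cell_sieve M "\<lambda>hs x. \<forall>h\<in>set (take (Suc j) hs). h x" X "(1 / real r) ^ Suc j" \<gamma> "b / real r"
    by (rule cell_sieve_next)
  define low where "low i hs \<longleftrightarrow> i \<le> j \<and> A hs (j - i) \<le> (1 - \<gamma>) * (b * real r ^ i * pivot \<gamma>)" for i hs
  define crit where "crit hs \<longleftrightarrow> A hs (Suc j) \<le> (1 - \<gamma>) * (b / real r * pivot \<gamma>) \<or> T \<le> A hs (Suc j)" for hs
  have crit: "measure_pmf.prob M {hs. crit hs} \<le> 1 / (1 + 246/25 * (1/2))"
    using nxt.prob_low_or_saturated[of "1/2"] b_gt b_le r by (simp add: crit_def A_def)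
  have low: "measure_pmf.prob M {hs. low i hs} \<le> 1 / (1 + 246/25 * 2 ^ i)" for i
    using prob_A_low[of "2 ^ i" i] b_gt r by (simp add: low_def)
  \<comment> \<open>\<open>13 + 2.11 \<le> 16\<close>: the gap that 16 pivots leave above the
    threshold.\<close>
  have unsat: "measure_pmf.prob M {hs. 4 \<le> j \<and> A hs (j - 4) < T} \<le> 1 / (1 + 246/25 * (13::real)\<^sup>2 / 16)"
    by (rule prob_A_unsat[OF _ unsat_margin]) (use b_gt r in auto)
  have "measure_pmf.prob M {hs. bad_low hs} \<le> measure_pmf.prob M
      {hs. crit hs \<or> low 0 hs \<or> low 1 hs \<or> low 2 hs \<or> low 3 hs \<or> (4 \<le> j \<and> A hs (j - 4) < T)}"
  proof (rule prob_mono_support)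
    fix hs assume "bad_low hs"
    then consider "T \<le> A hs N"
      | k where "first_unsat hs k" "A hs k < (1 - \<gamma>) * (real (card X) / real r ^ k)"
      unfolding bad_low_def by blast
    then show "crit hs \<or> low 0 hs \<or> low 1 hs \<or> low 2 hs \<or> low 3 hs \<or> (4 \<le> j \<and> A hs (j - 4) < T)"
    proof cases
      case 1
      then have "T \<le> A hs (Suc j)" using A_antimono[of "Suc j" N hs] j_less by simp
      then show ?thesis by (simp add: crit_def)
    next
      case (2 k)
      consider "k > Suc j" | "k = Suc j" | "k \<le> j" by linarith
      then show ?thesis
      proof cases
        case 1
        then have "A hs (k - 1) \<le> A hs (Suc j)" by (intro A_antimono) simp
        then have "T \<le> A hs (Suc j)" using 2(1) by (simp add: first_unsat_def)
        then show ?thesis by (simp add: crit_def)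
      next
        case k: 2
        then show ?thesis using 2(2) unfolding k size_next by (simp add: crit_def)
      next
        case 3
        define i where "i = j - k"
        have i: "i \<le> j" "k = j - i" using 3 by (auto simp: i_def)
        have "low i hs" using 2(2) i unfolding i(2) size_up[OF i(1)] low_def by simp
        moreover have "A hs (j - 4) < T" if "i \<ge> 4"
        proof -
          have "A hs (j - 4) \<le> A hs k" using i that by (intro A_antimono) simp
          then show ?thesis using 2(1) by (simp add: first_unsat_def)
        qed
        moreover have "i = 0 \<or> i = 1 \<or> i = 2 \<or> i = 3 \<or> 4 \<le> i" by linarith
        ultimately show ?thesis using i by auto
      qed
    qed
  qed
  also have "\<dots> \<le> 1 / (1 + 246/25 * (1/2)) + (1 / (1 + 246/25 * 2 ^ 0) + (1 / (1 + 246/25 * 2 ^ 1) +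
      (1 / (1 + 246/25 * 2 ^ 2) + (1 / (1 + 246/25 * 2 ^ 3) + 1 / (1 + 246/25 * (13::real)\<^sup>2 / 16)))))"
    by (intro prob_disj_le crit low unsat)
  also have "\<dots> \<le> 36/100" by simp
  finally show ?thesis .
qed

text \<open>A search ending at level \<open>j\<close> or earlier cannot overestimate, the mean there
  being above the pivot. Every other way of being too high makes the cell at \<open>Suc j\<close>
  too large.\<close>

lemma prob_bad_high_XOR:
  assumes r: "r = 2"
  shows "measure_pmf.prob M {hs. bad_high hs} \<le> 36/100"
proof -
  interpret nxt: cell_sieve M "\<lambda>hs x. \<forall>h\<in>set (take (Suc j) hs). h x" X "(1 / real r) ^ Suc j" \<gamma> "b / real r"
    by (rule cell_sieve_next)
  have "measure_pmf.prob M {hs. bad_high hs} \<le>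
      measure_pmf.prob M {hs. (1 + \<gamma>) * (b / real r * pivot \<gamma>) \<le> A hs (Suc j)}"
  proof (rule prob_mono_support, rule high_le)
    fix hs assume "bad_high hs"
    then consider "T \<le> A hs N"
      | k where "first_unsat hs k" "real (card X) / real r ^ k / (1 - \<gamma>) < A hs k"
      unfolding bad_high_def by blast
    then show "b / real r * pivot \<gamma> / (1 - \<gamma>) < A hs (Suc j) \<or> T \<le> A hs (Suc j)"
    proof cases
      case 1
      then show ?thesis using A_antimono[of "Suc j" N hs] j_less by simp
    next
      case (2 k)
      consider "k > Suc j" | "k = Suc j" | "k \<le> j" by linarith
      then show ?thesis
      proof cases
        case 1
        then have "A hs (k - 1) \<le> A hs (Suc j)" by (intro A_antimono) simp
        then show ?thesis using 2(1) by (simp add: first_unsat_def)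
      next
        case k: 2
        then show ?thesis using 2(2) unfolding k size_next by simp
      next
        case 3
        define i where "i = j - k"
        have i: "i \<le> j" "k = j - i" using 3 by (auto simp: i_def)
        have "1 \<le> b * real r ^ i" using b_gt r_ge mult_mono[of 1 b 1 "real r ^ i"] by simp
        then have "T < A hs k"
          using sat_bound_le[of "b * real r ^ i"] 2(2) unfolding i(2) size_up[OF i(1)] by simp
        then show ?thesis using 2(1) by (simp add: first_unsat_def)
      qed
    qed
  qed (use b_gt b_le r in auto)
  also have "\<dots> \<le> 1 / (1 + 246/25 * (1/2))"
    using nxt.prob_high[of "1/2"] b_gt r by (simp add: A_def)
  also have "\<dots> \<le> 36/100" by simp
  finally show ?thesis .
qed

end

subsection \<open>Multiply-shift and multiply-mod-prime hashing\<close>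

text \<open>
  An outcome consists of the hashes of range parameter 4 used by the search and of the two hashes of
  range parameters 2 and 1 that may replace the last one. The cells \<open>C\<close> and
  \<open>D\<close> below extend the first \<open>k\<close> search hashes by these.
\<close>

type_synonym 'x outcome = "(('x \<Rightarrow> bool) list \<times> ('x \<Rightarrow> bool) \<times> ('x \<Rightarrow> bool))"

definition sat_tail :: "real \<Rightarrow> real" where
  "sat_tail w = 1 / (1 + 246/25 * (2 - w)\<^sup>2 / w)"

text \<open>Charges for a search ending at level \<open>j\<close> or earlier when the mean at
  \<open>j\<close> is at least \<open>w\<close> pivots: the cell of \<open>j\<close> constraints,
  the two refined cells on top of \<open>j - 1\<close> constraints, and an unsaturated cell of
  \<open>j - 1\<close> constraints, which lies \<open>w * r - 2.11\<close> pivots or more above the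
  threshold on average.\<close>

definition early_tail :: "nat \<Rightarrow> nat \<Rightarrow> nat \<Rightarrow> real \<Rightarrow> real" where
  "early_tail r r2 r1 w = 1 / (1 + 246/25 * w) + (1 / (1 + 246/25 * (w * real r / real r2)) +
    (1 / (1 + 246/25 * (w * real r / real r1)) +
     1 / (1 + 246/25 * (w * real r - 211/100)\<^sup>2 / (w * real r))))"

locale refined_hashing = hashing X H r N \<gamma>
  for X :: "'x set" and H r N \<gamma> +
  fixes H2 H1 :: "('x \<Rightarrow> bool) pmf" and r2 r1 :: nat
  assumes H2: "pairwise_sieve H2 (\<lambda>h. h) X (1 / real r2)"
    and H1: "pairwise_sieve H1 (\<lambda>h. h) X (1 / real r1)"
    and ranges: "(r = 16 \<and> r2 = 4 \<and> r1 = 2) \<or> (r = 17 \<and> r2 = 5 \<and> r1 = 3)"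
begin

definition C :: "'x outcome \<Rightarrow> nat \<Rightarrow> real" where
  "C \<omega> k = real (card {x\<in>X. (\<forall>h\<in>set (take k (fst \<omega>)). h x) \<and> fst (snd \<omega>) x})"

definition D :: "'x outcome \<Rightarrow> nat \<Rightarrow> real" where
  "D \<omega> k = real (card {x\<in>X. (\<forall>h\<in>set (take k (fst \<omega>)). h x) \<and> snd (snd \<omega>) x})"

text \<open>\<open>Suc k\<close> is the result of the search. The alternatives are the range
  parameters 4, 2 and 1 at which the refinement can stop. \<open>C\<close> and \<open>D\<close>
  replace the last hash by a fresh one and are not nested in the cell of \<open>Suc k\<close>
  constraints.\<close>

definition bad_low_refined :: "'x outcome \<Rightarrow> bool" where
  "bad_low_refined \<omega> \<longleftrightarrow> T \<le> A (fst \<omega>) N \<or>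
    (\<exists>k. first_unsat (fst \<omega>) (Suc k) \<and>
      (T \<le> C \<omega> k \<and> A (fst \<omega>) (Suc k) < (1 - \<gamma>) * (real (card X) / real r ^ Suc k) \<or>
       T \<le> D \<omega> k \<and> C \<omega> k < T \<and> C \<omega> k < (1 - \<gamma>) * (real (card X) / (real r ^ k * real r2)) \<or>
       D \<omega> k < T \<and> D \<omega> k < (1 - \<gamma>) * (real (card X) / (real r ^ k * real r1))))"

definition bad_high_refined :: "'x outcome \<Rightarrow> bool" where
  "bad_high_refined \<omega> \<longleftrightarrow> T \<le> A (fst \<omega>) N \<or>
    (\<exists>k. first_unsat (fst \<omega>) (Suc k) \<and>
      (T \<le> C \<omega> k \<and> real (card X) / real r ^ Suc k / (1 - \<gamma>) < A (fst \<omega>) (Suc k) \<or>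
       T \<le> D \<omega> k \<and> C \<omega> k < T \<and> real (card X) / (real r ^ k * real r2) / (1 - \<gamma>) < C \<omega> k \<or>
       D \<omega> k < T \<and> real (card X) / (real r ^ k * real r1) / (1 - \<gamma>) < D \<omega> k))"

lemma finite_H12: "finite (set_pmf H2)" "finite (set_pmf H1)"
  using H2 H1 by (auto simp: pairwise_sieve_def)

lemma r21_pos: "0 < real r1" "0 < real r2" "0 < real r" using ranges by auto

end

locale refined_level = refined_hashing X H r N \<gamma> H2 H1 r2 r1 + hashing_level X H r N \<gamma> j b
  for X :: "'x set" and H r N \<gamma> H2 H1 r2 r1 j b
begin

abbreviation \<Omega> :: "'x outcome pmf" where
  "\<Omega> \<equiv> pair_pmf M (pair_pmf H2 H1)"

lemma finite_K: "finite (set_pmf (pair_pmf H2 H1))" using finite_H12 by simp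

lemma prob_fst: "measure_pmf.prob \<Omega> {\<omega>. P (fst \<omega>)} = measure_pmf.prob M {hs. P hs}"
proof -
  have "measure_pmf.prob M {hs. P hs} = measure_pmf.prob (map_pmf fst \<Omega>) {hs. P hs}"
    by (simp add: map_fst_pair_pmf)
  then show ?thesis by (simp add: vimage_def)
qed

lemma size_C: "i \<le> j \<Longrightarrow> real (card X) / (real r ^ (j - i) * real r2) = b * real r ^ i / real r2 * pivot \<gamma>"
  using size_up[of i] by (simp flip: divide_divide_eq_left)

lemma size_D: "i \<le> j \<Longrightarrow> real (card X) / (real r ^ (j - i) * real r1) = b * real r ^ i / real r1 * pivot \<gamma>"
  using size_up[of i] by (simp flip: divide_divide_eq_left)

lemma cell_sieve_C:
  assumes "i \<le> j"
  shows "cell_sieve \<Omega> (\<lambda>\<omega> x. (\<forall>h\<in>set (take (j - i) (fst \<omega>)). h x) \<and> fst (snd \<omega>) x) X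
    ((1 / real r) ^ (j - i) * (1 / real r2)) \<gamma> (b * real r ^ i / real r2)"
proof
  show "pairwise_sieve \<Omega> (\<lambda>\<omega> x. (\<forall>h\<in>set (take (j - i) (fst \<omega>)). h x) \<and> fst (snd \<omega>) x) X
      ((1 / real r) ^ (j - i) * (1 / real r2))"
    using j_less
    by (intro pairwise_sieve_pair pairwise_sieve_replicate_take H pairwise_sieve_fst H2 finite_H12) simp
  have "(1 / real r) ^ (j - i) * (1 / real r2) * real (card X) = ((1 / real r) ^ (j - i) * real (card X)) / real r2"
    by simp
  then show "(1 / real r) ^ (j - i) * (1 / real r2) * real (card X) = b * real r ^ i / real r2 * pivot \<gamma>"
    unfolding mean_up[OF assms] by simp
qed (use finite_X \<gamma>_pos \<gamma>_less b_gt r21_pos in auto)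

lemma cell_sieve_D:
  assumes "i \<le> j"
  shows "cell_sieve \<Omega> (\<lambda>\<omega> x. (\<forall>h\<in>set (take (j - i) (fst \<omega>)). h x) \<and> snd (snd \<omega>) x) X
    ((1 / real r) ^ (j - i) * (1 / real r1)) \<gamma> (b * real r ^ i / real r1)"
proof
  show "pairwise_sieve \<Omega> (\<lambda>\<omega> x. (\<forall>h\<in>set (take (j - i) (fst \<omega>)). h x) \<and> snd (snd \<omega>) x) X
      ((1 / real r) ^ (j - i) * (1 / real r1))"
    using j_less
    by (intro pairwise_sieve_pair pairwise_sieve_replicate_take H pairwise_sieve_snd H1 finite_H12) simp
  have "(1 / real r) ^ (j - i) * (1 / real r1) * real (card X) = ((1 / real r) ^ (j - i) * real (card X)) / real r1"
    by simp
  then show "(1 / real r) ^ (j - i) * (1 / real r1) * real (card X) = b * real r ^ i / real r1 * pivot \<gamma>"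
    unfolding mean_up[OF assms] by simp
qed (use finite_X \<gamma>_pos \<gamma>_less b_gt r21_pos in auto)

sublocale Cj: cell_sieve \<Omega> "\<lambda>\<omega> x. (\<forall>h\<in>set (take j (fst \<omega>)). h x) \<and> fst (snd \<omega>) x" X
    "(1 / real r) ^ j * (1 / real r2)" \<gamma> "b / real r2"
  using cell_sieve_C[of 0] by simp

sublocale Dj: cell_sieve \<Omega> "\<lambda>\<omega> x. (\<forall>h\<in>set (take j (fst \<omega>)). h x) \<and> snd (snd \<omega>) x" X
    "(1 / real r) ^ j * (1 / real r1)" \<gamma> "b / real r1"
  using cell_sieve_D[of 0] by simp

sublocale An: cell_sieve M "\<lambda>hs x. \<forall>h\<in>set (take (Suc j) hs). h x" X "(1 / real r) ^ Suc j" \<gamma> "b / real r"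
  by (rule cell_sieve_next)

definition low_C :: "nat \<Rightarrow> 'x outcome \<Rightarrow> bool" where
  "low_C i \<omega> \<longleftrightarrow> i \<le> j \<and> C \<omega> (j - i) \<le> (1 - \<gamma>) * (b * real r ^ i / real r2 * pivot \<gamma>)"

definition low_D :: "nat \<Rightarrow> 'x outcome \<Rightarrow> bool" where
  "low_D i \<omega> \<longleftrightarrow> i \<le> j \<and> D \<omega> (j - i) \<le> (1 - \<gamma>) * (b * real r ^ i / real r1 * pivot \<gamma>)"

definition low_A :: "'x outcome \<Rightarrow> bool" where
  "low_A \<omega> \<longleftrightarrow> A (fst \<omega>) j \<le> (1 - \<gamma>) * (b * pivot \<gamma>)"

definition low_next :: "'x outcome \<Rightarrow> bool" where
  "low_next \<omega> \<longleftrightarrow> A (fst \<omega>) (Suc j) \<le> (1 - \<gamma>) * (b / real r * pivot \<gamma>)"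

definition unsat_prev :: "'x outcome \<Rightarrow> bool" where
  "unsat_prev \<omega> \<longleftrightarrow> 1 \<le> j \<and> A (fst \<omega>) (j - 1) < T"

text \<open>Necessary for an underestimate if the search stops at level \<open>j\<close> or below.\<close>

definition early :: "'x outcome \<Rightarrow> bool" where
  "early \<omega> \<longleftrightarrow> A (fst \<omega>) j < T \<and> (low_A \<omega> \<or> low_C 1 \<omega> \<or> low_D 1 \<omega> \<or> unsat_prev \<omega>)"

text \<open>Reduces every underestimate to a few levels around \<open>j\<close>. A search ending
  after \<open>Suc j\<close> saturates the cell at \<open>Suc j\<close>, one ending before
  \<open>j\<close> leaves the cell at \<open>j - 1\<close> unsaturated, and one ending at
  \<open>j\<close> keeps a cell described by \<open>low_A\<close>, \<open>low_C 1\<close> or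
  \<open>low_D 1\<close>.\<close>

lemma bad_low_refined_cases:
  assumes "bad_low_refined \<omega>"
  shows "early \<omega> \<or> T \<le> A (fst \<omega>) (Suc j) \<or> (T \<le> C \<omega> j \<and> low_next \<omega>) \<or>
    (T \<le> D \<omega> j \<and> low_C 0 \<omega>) \<or> (D \<omega> j < T \<and> low_D 0 \<omega>)"
proof -
  consider "T \<le> A (fst \<omega>) N"
    | k where "first_unsat (fst \<omega>) (Suc k)"
       "T \<le> C \<omega> k \<and> A (fst \<omega>) (Suc k) < (1 - \<gamma>) * (real (card X) / real r ^ Suc k) \<or>
       T \<le> D \<omega> k \<and> C \<omega> k < T \<and> C \<omega> k < (1 - \<gamma>) * (real (card X) / (real r ^ k * real r2)) \<or>
       D \<omega> k < T \<and> D \<omega> k < (1 - \<gamma>) * (real (card X) / (real r ^ k * real r1))"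
    using assms unfolding bad_low_refined_def by blast
  then show ?thesis
  proof cases
    case 1
    then show ?thesis using A_antimono[of "Suc j" N "fst \<omega>"] j_less by simp
  next
    case (2 k)
    note first = 2(1)[unfolded first_unsat_def]
    consider "k > j" | "k = j" | "Suc k = j" | "Suc k < j" by linarith
    then show ?thesis
    proof cases
      case 1
      then have "A (fst \<omega>) k \<le> A (fst \<omega>) (Suc j)" by (intro A_antimono) simp
      then show ?thesis using first by simp
    next
      case k: 2
      have sizes: "real (card X) / (real r ^ j * real r2) = b * real r ^ 0 / real r2 * pivot \<gamma>"
        "real (card X) / (real r ^ j * real r1) = b * real r ^ 0 / real r1 * pivot \<gamma>"
        using size_C[of 0] size_D[of 0] by simp_all
      show ?thesis
        using 2(2) unfolding k size_next sizes low_next_def low_C_def low_D_def diff_zero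
        by (auto simp del: power_0)
    next
      case k: 3
      then have j1: "1 \<le> j" "j - 1 = k" by auto
      have sizes: "real (card X) / real r ^ j = b * pivot \<gamma>"
        "real (card X) / (real r ^ k * real r2) = b * real r ^ 1 / real r2 * pivot \<gamma>"
        "real (card X) / (real r ^ k * real r1) = b * real r ^ 1 / real r1 * pivot \<gamma>"
        using size_up[of 0] size_C[OF j1(1)] size_D[OF j1(1)] unfolding j1(2) by simp_all
      have "low_A \<omega> \<or> low_C 1 \<omega> \<or> low_D 1 \<omega>"
        using 2(2) j1(1) unfolding k sizes low_A_def low_C_def low_D_def j1(2)
        by (auto simp del: power_one_right)
      moreover have "A (fst \<omega>) j < T" using first k by simp
      ultimately show ?thesis by (auto simp: early_def)
    next
      case 4
      then have "A (fst \<omega>) (j - 1) \<le> A (fst \<omega>) (Suc k)" "A (fst \<omega>) j \<le> A (fst \<omega>) (Suc k)"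
        by (auto intro!: A_antimono)
      then show ?thesis using first 4 by (auto simp: early_def unsat_prev_def)
    qed
  qed
qed

lemma prob_low_A:
  assumes "0 < w" "w \<le> b"
  shows "measure_pmf.prob \<Omega> {\<omega>. low_A \<omega>} \<le> 1 / (1 + 246/25 * w)"
  using prob_A_low[of w 0] prob_fst[of "\<lambda>hs. A hs j \<le> (1 - \<gamma>) * (b * pivot \<gamma>)"] assms
  by (simp add: low_A_def)

lemma prob_low_C:
  assumes "0 < w" "w \<le> b * real r ^ i / real r2"
  shows "measure_pmf.prob \<Omega> {\<omega>. low_C i \<omega>} \<le> 1 / (1 + 246/25 * w)"
proof (cases "i \<le> j")
  case True
  show ?thesis
    using cell_sieve.prob_low[OF cell_sieve_C[OF True] assms] True by (simp add: low_C_def C_def)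
qed (use assms in \<open>simp add: low_C_def\<close>)

lemma prob_low_D:
  assumes "0 < w" "w \<le> b * real r ^ i / real r1"
  shows "measure_pmf.prob \<Omega> {\<omega>. low_D i \<omega>} \<le> 1 / (1 + 246/25 * w)"
proof (cases "i \<le> j")
  case True
  show ?thesis
    using cell_sieve.prob_low[OF cell_sieve_D[OF True] assms] True by (simp add: low_D_def D_def)
qed (use assms in \<open>simp add: low_D_def\<close>)

lemma prob_unsat_prev:
  assumes "0 < y" "y + 211/100 \<le> w" "w \<le> b * real r"
  shows "measure_pmf.prob \<Omega> {\<omega>. unsat_prev \<omega>} \<le> 1 / (1 + 246/25 * y\<^sup>2 / w)"
  using prob_A_unsat[OF assms(1) unsat_margin[OF assms(2,1)], of 1] assms(3)
    prob_fst[of "\<lambda>hs. 1 \<le> j \<and> A hs (j - 1) < T"]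
  by (simp add: unsat_prev_def)

abbreviation early_bound :: "real \<Rightarrow> real" where "early_bound \<equiv> early_tail r r2 r1"

lemma prob_early:
  assumes "1 \<le> w" "w \<le> b"
  shows "measure_pmf.prob \<Omega> {\<omega>. early \<omega>} \<le> early_bound w"
proof -
  have w: "w * real r \<le> b * real r" using assms by (intro mult_right_mono) auto
  have "1 * 3 \<le> w * real r" using assms ranges by (intro mult_mono) auto
  then have y: "0 < w * real r - 211/100" by simp
  have "measure_pmf.prob \<Omega> {\<omega>. early \<omega>} \<le>
      measure_pmf.prob \<Omega> {\<omega>. low_A \<omega> \<or> low_C 1 \<omega> \<or> low_D 1 \<omega> \<or> unsat_prev \<omega>}"
    by (rule prob_mono_support) (simp add: early_def)
  also have "\<dots> \<le> early_bound w"
    unfolding early_tail_def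
    using assms w r21_pos y
    by (intro prob_disj_le prob_low_A prob_low_C prob_low_D prob_unsat_prev) (auto simp: divide_right_mono)
  finally show ?thesis .
qed

text \<open>\<open>early\<close> demands an unsaturated cell at level \<open>j\<close>. For a mean
  far above the threshold this single condition is cheaper than charging the four ways of stopping
  early.\<close>

lemma prob_early_unsat:
  assumes "0 < y" "1 + \<gamma> + \<gamma>\<^sup>2 / (246/25) + y * \<gamma> \<le> w" "w \<le> b"
  shows "measure_pmf.prob \<Omega> {\<omega>. early \<omega>} \<le> 1 / (1 + 246/25 * y\<^sup>2 / w)"
proof -
  have "measure_pmf.prob \<Omega> {\<omega>. early \<omega>} \<le> measure_pmf.prob \<Omega> {\<omega>. A (fst \<omega>) j < T}"
    by (rule prob_mono_support) (simp add: early_def)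
  also have "\<dots> \<le> 1 / (1 + 246/25 * y\<^sup>2 / w)"
    using prob_A_unsat[OF assms(1,2), of 0] assms(3) prob_fst[of "\<lambda>hs. A hs j < T"] by simp
  finally show ?thesis .
qed

lemma prob_low_D_unsat:
  assumes "0 < y" "1 + \<gamma> + \<gamma>\<^sup>2 / (246/25) + y * \<gamma> \<le> w" "w \<le> b / real r1"
  shows "measure_pmf.prob \<Omega> {\<omega>. D \<omega> j < T \<and> low_D 0 \<omega>} \<le> 1 / (1 + 246/25 * y\<^sup>2 / w)"
proof -
  have "measure_pmf.prob \<Omega> {\<omega>. D \<omega> j < T \<and> low_D 0 \<omega>} \<le> measure_pmf.prob \<Omega> {\<omega>. D \<omega> j < T}"
    by (rule prob_mono_support) simp
  also have "\<dots> \<le> 1 / (1 + 246/25 * y\<^sup>2 / w)"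
    using Dj.prob_unsaturated[OF assms] by (simp add: D_def)
  finally show ?thesis .
qed

lemma prob_low_D_le:
  assumes "0 < w" "w \<le> b / real r1"
  shows "measure_pmf.prob \<Omega> {\<omega>. D \<omega> j < T \<and> low_D 0 \<omega>} \<le> 1 / (1 + 246/25 * w)"
proof -
  have "measure_pmf.prob \<Omega> {\<omega>. D \<omega> j < T \<and> low_D 0 \<omega>} \<le> measure_pmf.prob \<Omega> {\<omega>. low_D 0 \<omega>}"
    by (rule prob_mono_support) simp
  also have "\<dots> \<le> 1 / (1 + 246/25 * w)" using assms by (intro prob_low_D) auto
  finally show ?thesis .
qed

lemma prob_sat_next:
  assumes "b / real r \<le> w" "w \<le> 1"
  shows "measure_pmf.prob \<Omega> {\<omega>. T \<le> A (fst \<omega>) (Suc j)} \<le> sat_tail w"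
  using An.prob_saturated[OF assms] prob_fst[of "\<lambda>hs. T \<le> A hs (Suc j)"]
  by (simp add: A_def sat_tail_def)

lemma prob_sat_C:
  assumes "b / real r2 \<le> w" "w \<le> 1"
  shows "measure_pmf.prob \<Omega> {\<omega>. T \<le> C \<omega> j} \<le> sat_tail w"
  using Cj.prob_saturated[OF assms] by (simp add: C_def sat_tail_def)

definition crit_C :: "'x outcome \<Rightarrow> bool" where
  "crit_C \<omega> \<longleftrightarrow> C \<omega> j \<le> (1 - \<gamma>) * (b / real r2 * pivot \<gamma>) \<or> T \<le> C \<omega> j"

definition crit_D :: "'x outcome \<Rightarrow> bool" where
  "crit_D \<omega> \<longleftrightarrow> D \<omega> j \<le> (1 - \<gamma>) * (b / real r1 * pivot \<gamma>) \<or> T \<le> D \<omega> j"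

definition crit_A :: "'x outcome \<Rightarrow> bool" where
  "crit_A \<omega> \<longleftrightarrow> low_next \<omega> \<or> T \<le> A (fst \<omega>) (Suc j)"

text \<open>Here \<open>C\<close> is the critical cell. Keeping the cell at \<open>Suc j\<close>
  presupposes that \<open>C\<close> is saturated, which \<open>crit_C\<close> contains, so
  \<open>low_next\<close> is not charged separately.\<close>

lemma prob_crit_C_gen:
  assumes C: "measure_pmf.prob \<Omega> {\<omega>. crit_C \<omega>} \<le> p"
    and D: "measure_pmf.prob \<Omega> {\<omega>. D \<omega> j < T \<and> low_D 0 \<omega>} \<le> d"
    and e: "1 \<le> e" "e \<le> b" and w: "b / real r \<le> w" "w \<le> 1"
  shows "measure_pmf.prob \<Omega> {\<omega>. bad_low_refined \<omega>} \<le> p + (d + (early_bound e + sat_tail w))"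
proof -
  have "measure_pmf.prob \<Omega> {\<omega>. bad_low_refined \<omega>} \<le> measure_pmf.prob \<Omega>
      {\<omega>. crit_C \<omega> \<or> (D \<omega> j < T \<and> low_D 0 \<omega>) \<or> early \<omega> \<or> T \<le> A (fst \<omega>) (Suc j)}"
    by (rule prob_mono_support, drule bad_low_refined_cases) (auto simp: crit_C_def low_C_def)
  also have "\<dots> \<le> p + (d + (early_bound e + sat_tail w))"
    by (intro prob_disj_le C D prob_early[OF e] prob_sat_next[OF w])
  finally show ?thesis .
qed

text \<open>Here \<open>D\<close> is the critical cell. Keeping \<open>C\<close> presupposes that
  \<open>D\<close> is saturated, so \<open>crit_D\<close> pays for it; \<open>C\<close> and the cell
  at \<open>Suc j\<close> enter through saturation, which is unlikely at their smaller
  means.\<close>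

lemma prob_bad_low_refined_D:
  assumes v: "0 < v" "v \<le> b / real r1" "v \<le> 78/100" and b: "b \<le> w * real r1" "w \<le> 1"
    and e: "1 \<le> e" "e \<le> b"
  shows "measure_pmf.prob \<Omega> {\<omega>. bad_low_refined \<omega>} \<le>
    1 / (1 + 246/25 * v) + (early_bound e + (sat_tail (w * real r1 / real r2) + sat_tail (w * real r1 / real r)))"
proof -
  have w: "b / real r2 \<le> w * real r1 / real r2" "b / real r \<le> w * real r1 / real r"
    using b r21_pos by (auto simp: divide_right_mono)
  have "w * real r1 \<le> 1 * real r1" using b by (intro mult_right_mono) auto
  then have w1: "w * real r1 / real r2 \<le> 1" "w * real r1 / real r \<le> 1" using ranges by auto
  have "b \<le> 1 * real r1" using b \<open>w * real r1 \<le> 1 * real r1\<close> by linarith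
  then have "b / real r1 \<le> 1" using r21_pos by (simp add: divide_le_eq)
  then have crit: "measure_pmf.prob \<Omega> {\<omega>. crit_D \<omega>} \<le> 1 / (1 + 246/25 * v)"
    using Dj.prob_low_or_saturated[OF v] by (simp add: crit_D_def D_def)
  have "measure_pmf.prob \<Omega> {\<omega>. bad_low_refined \<omega>} \<le> measure_pmf.prob \<Omega>
      {\<omega>. crit_D \<omega> \<or> early \<omega> \<or> T \<le> C \<omega> j \<or> T \<le> A (fst \<omega>) (Suc j)}"
    by (rule prob_mono_support, drule bad_low_refined_cases) (auto simp: crit_D_def low_D_def)
  also have "\<dots> \<le> 1 / (1 + 246/25 * v) + (early_bound e + (sat_tail (w * real r1 / real r2) + sat_tail (w * real r1 / real r)))"
    by (intro prob_disj_le crit prob_early[OF e] prob_sat_C[OF w(1) w1(1)] prob_sat_next[OF w(2) w1(2)])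
  finally show ?thesis .
qed

lemma prob_bad_low_refined_C:
  assumes v: "0 < v" "v \<le> b / real r2" "v \<le> 78/100" and b: "real r1 \<le> b" "b \<le> real r2"
  shows "measure_pmf.prob \<Omega> {\<omega>. bad_low_refined \<omega>} \<le>
    1 / (1 + 246/25 * v) + (1 / (1 + 246/25 * 1) + (early_bound (real r1) + sat_tail (real r2 / real r)))"
proof (rule prob_crit_C_gen)
  have "b / real r2 \<le> 1" using b r21_pos by simp
  then show "measure_pmf.prob \<Omega> {\<omega>. crit_C \<omega>} \<le> 1 / (1 + 246/25 * v)"
    using Cj.prob_low_or_saturated[OF v] by (simp add: crit_C_def C_def)
  show "measure_pmf.prob \<Omega> {\<omega>. D \<omega> j < T \<and> low_D 0 \<omega>} \<le> 1 / (1 + 246/25 * 1)"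
    using b r21_pos by (intro prob_low_D_le) auto
  show "b / real r \<le> real r2 / real r" using b r21_pos by (simp add: divide_right_mono)
qed (use b ranges in auto)

text \<open>\<open>C\<close> stays the critical cell although its mean exceeds the pivot; the excess
  \<open>t * \<gamma>\<close> is taken from the gap of \<open>\<gamma>\<close> pivots below the
  threshold.\<close>

lemma prob_bad_low_refined_C_above_pivot:
  assumes b: "real r2 \<le> b" "b \<le> w * real r2" and t: "w - 1 \<le> t * \<gamma>" "0 \<le> t" "t \<le> 1" "w \<le> 2"
  shows "measure_pmf.prob \<Omega> {\<omega>. bad_low_refined \<omega>} \<le>
    (4 * w / (246/25) + t\<^sup>2) / (2 - t)\<^sup>2 +
    (1 / (1 + 246/25 * (real r2 / real r1)) + (early_bound (real r2) + sat_tail (w * real r2 / real r)))"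
proof (rule prob_crit_C_gen)
  have "1 \<le> b / real r2" "b / real r2 \<le> w" using b r21_pos by (auto simp: divide_le_eq)
  then show "measure_pmf.prob \<Omega> {\<omega>. crit_C \<omega>} \<le> (4 * w / (246/25) + t\<^sup>2) / (2 - t)\<^sup>2"
    using Cj.prob_low_or_saturated_above_pivot[of w t] t by (simp add: crit_C_def C_def)
  show "measure_pmf.prob \<Omega> {\<omega>. D \<omega> j < T \<and> low_D 0 \<omega>} \<le> 1 / (1 + 246/25 * (real r2 / real r1))"
    using b r21_pos by (intro prob_low_D_le) (auto simp: divide_right_mono)
  show "b / real r \<le> w * real r2 / real r" using b r21_pos by (simp add: divide_right_mono)
qed (use b t ranges in auto)

text \<open>With a mean of at least half a pivot at \<open>Suc j\<close>, the critical cell is cheap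
  enough for a plain union bound.\<close>

lemma prob_bad_low_refined_A_easy:
  assumes b: "real r / 2 \<le> b"
  shows "measure_pmf.prob \<Omega> {\<omega>. bad_low_refined \<omega>} \<le> 1 / (1 + 246/25 * (1/2)) +
    (1 / (1 + 246/25 * (real r / 2 / real r2)) + (1 / (1 + 246/25 * (real r / 2 / real r1)) + early_bound (real r / 2)))"
proof -
  have "measure_pmf.prob \<Omega> {\<omega>. crit_A \<omega>} \<le> 1 / (1 + 246/25 * (1/2))"
  proof -
    have "measure_pmf.prob M {hs. A hs (Suc j) \<le> (1 - \<gamma>) * (b / real r * pivot \<gamma>) \<or> T \<le> A hs (Suc j)} \<le>
        1 / (1 + 246/25 * (1/2))"
      unfolding A_def using b b_le r21_pos
      by (intro An.prob_low_or_saturated) (auto simp: le_divide_eq)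
    then show ?thesis
      unfolding crit_A_def low_next_def
      using prob_fst[of "\<lambda>hs. A hs (Suc j) \<le> (1 - \<gamma>) * (b / real r * pivot \<gamma>) \<or> T \<le> A hs (Suc j)"] by simp
  qed
  moreover have "measure_pmf.prob \<Omega> {\<omega>. bad_low_refined \<omega>} \<le> measure_pmf.prob \<Omega>
      {\<omega>. crit_A \<omega> \<or> low_C 0 \<omega> \<or> (D \<omega> j < T \<and> low_D 0 \<omega>) \<or> early \<omega>}"
    by (rule prob_mono_support, drule bad_low_refined_cases) (auto simp: crit_A_def)
  moreover have "measure_pmf.prob \<Omega> {\<omega>. crit_A \<omega> \<or> low_C 0 \<omega> \<or> (D \<omega> j < T \<and> low_D 0 \<omega>) \<or> early \<omega>} \<le>
      1 / (1 + 246/25 * (1/2)) +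
    (1 / (1 + 246/25 * (real r / 2 / real r2)) + (1 / (1 + 246/25 * (real r / 2 / real r1)) + early_bound (real r / 2)))"
  proof (intro prob_disj_le calculation(1) prob_low_C prob_low_D_le prob_early)
    show "real r / 2 / real r2 \<le> b * real r ^ 0 / real r2" "real r / 2 / real r1 \<le> b / real r1"
      using divide_right_mono[OF b, of "real r2"] divide_right_mono[OF b, of "real r1"] by simp_all
  qed (use b r21_pos ranges in auto)
  ultimately show ?thesis by linarith
qed

text \<open>Moves the search hash at position \<open>j\<close>, the last one of the cell at
  \<open>Suc j\<close>, behind everything else, including the refinement hashes.\<close>

lemma map_split_last:
  "map_pmf (\<lambda>\<omega>. ((take j (fst \<omega>), snd \<omega>), fst \<omega> ! j)) \<Omega> =
    pair_pmf (pair_pmf (replicate_pmf j H) (pair_pmf H2 H1)) H"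
proof -
  let ?K = "pair_pmf H2 H1"
  have "map_pmf (\<lambda>\<omega>. ((take j (fst \<omega>), snd \<omega>), fst \<omega> ! j)) \<Omega> =
      do {p \<leftarrow> map_pmf (\<lambda>hs. (take j hs, hs ! j)) M; k \<leftarrow> ?K; return_pmf ((fst p, k), snd p)}"
    by (simp add: map_pmf_def pair_pmf_def bind_assoc_pmf bind_return_pmf)
  also have "\<dots> = do {p \<leftarrow> pair_pmf (replicate_pmf j H) H; k \<leftarrow> ?K; return_pmf ((fst p, k), snd p)}"
    using map_take_nth_replicate_pmf[OF j_less, of H] by simp
  also have "\<dots> = do {xs \<leftarrow> replicate_pmf j H; h \<leftarrow> H; k \<leftarrow> ?K; return_pmf ((xs, k), h)}"
    by (simp add: pair_pmf_def bind_assoc_pmf bind_return_pmf)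
  also have "\<dots> = do {xs \<leftarrow> replicate_pmf j H; k \<leftarrow> ?K; h \<leftarrow> H; return_pmf ((xs, k), h)}"
    by (intro bind_pmf_cong refl bind_commute_pmf)
  also have "\<dots> = pair_pmf (pair_pmf (replicate_pmf j H) ?K) H"
    by (simp add: pair_pmf_def bind_assoc_pmf bind_return_pmf)
  finally show ?thesis .
qed

text \<open>All charges except those for the cell at \<open>Suc j\<close> read only the first
  \<open>j\<close> search hashes and the refinement hashes. They are independent of the search hash
  at position \<open>j\<close>, and the sharpened union bound applies with that hash as the
  last.\<close>

lemma prob_bad_low_refined_A:
  assumes b: "w\<^sub>0 \<le> b" "1 \<le> w\<^sub>0" "b \<le> 89/100 * real r"
    and C: "measure_pmf.prob \<Omega> {\<omega>. low_C 0 \<omega>} \<le> c"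
    and D: "measure_pmf.prob \<Omega> {\<omega>. D \<omega> j < T \<and> low_D 0 \<omega>} \<le> d"
    and e: "measure_pmf.prob \<Omega> {\<omega>. early \<omega>} \<le> e" and le1: "c + (d + e) \<le> 1"
    and s: "s = 1 / (1 + 246/25 * (w\<^sub>0 / real r))"
  shows "measure_pmf.prob \<Omega> {\<omega>. bad_low_refined \<omega>} \<le> s + (1 - (1 - 1 / real r) * (s * (1 - s))) * (c + (d + e))"
proof -
  define E where "E \<omega> \<longleftrightarrow> low_C 0 \<omega> \<or> (D \<omega> j < T \<and> low_D 0 \<omega>) \<or> early \<omega>" for \<omega>
  let ?B = "pair_pmf (replicate_pmf j H) (pair_pmf H2 H1)"
  let ?g = "\<lambda>\<omega>. ((take j (fst \<omega>), snd \<omega>), fst \<omega> ! j)"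
  have E_take: "E (take j hs, k) \<longleftrightarrow> E (hs, k)" for hs k
    unfolding E_def early_def low_A_def low_C_def low_D_def unsat_prev_def
    by (simp add: A_take C_def D_def min_def)
  have PE: "measure_pmf.prob ?B {\<omega>. E \<omega>} = measure_pmf.prob \<Omega> {\<omega>. E \<omega>}"
  proof -
    have "measure_pmf.prob ?B {\<omega>. E \<omega>} = measure_pmf.prob (map_pmf fst (map_pmf ?g \<Omega>)) {\<omega>. E \<omega>}"
      unfolding map_split_last map_fst_pair_pmf ..
    also have "\<dots> = measure_pmf.prob \<Omega> {\<omega>. E (take j (fst \<omega>), snd \<omega>)}"
      by (simp add: vimage_def)
    also have "\<dots> = measure_pmf.prob \<Omega> {\<omega>. E \<omega>}" unfolding E_take by simp
    finally show ?thesis .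
  qed
  have "measure_pmf.prob \<Omega> {\<omega>. E \<omega>} \<le> c + (d + e)"
    unfolding E_def by (intro prob_disj_le C D e)
  then have E: "measure_pmf.prob ?B {\<omega>. E \<omega>} \<le> c + (d + e)" unfolding PE .
  have base: "pairwise_sieve ?B (\<lambda>\<omega> x. \<forall>h\<in>set (fst \<omega>). h x) X ((1 / real r) ^ j)"
    by (intro pairwise_sieve_fst pairwise_sieve_replicate H finite_K)
  have "measure_pmf.prob \<Omega> {\<omega>. bad_low_refined \<omega>} \<le> measure_pmf.prob \<Omega> {\<omega>. E (fst (?g \<omega>)) \<or>
      (let Z = real (card {x\<in>X. (\<forall>h\<in>set (fst (fst (?g \<omega>))). h x) \<and> (snd (?g \<omega>)) x}) in
        Z \<le> (1 - \<gamma>) * (b / real r * pivot \<gamma>) \<or> T \<le> Z)}"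
  proof (rule prob_mono_support)
    fix \<omega> assume \<omega>: "\<omega> \<in> set_pmf \<Omega>" "bad_low_refined \<omega>"
    then have "length (fst \<omega>) = N" by (auto simp: set_replicate_pmf)
    then have "take (Suc j) (fst \<omega>) = take j (fst \<omega>) @ [fst \<omega> ! j]"
      using j_less by (simp add: take_Suc_conv_app_nth)
    then have Z: "real (card {x\<in>X. (\<forall>h\<in>set (fst (fst (?g \<omega>))). h x) \<and> (snd (?g \<omega>)) x}) = A (fst \<omega>) (Suc j)"
      unfolding A_def by (intro arg_cong[of _ _ "\<lambda>S. real (card S)"] Collect_cong) auto
    have "E \<omega> \<or> low_next \<omega> \<or> T \<le> A (fst \<omega>) (Suc j)"
      using bad_low_refined_cases[OF \<omega>(2)] by (auto simp: E_def)
    then show "E (fst (?g \<omega>)) \<or>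
      (let Z = real (card {x\<in>X. (\<forall>h\<in>set (fst (fst (?g \<omega>))). h x) \<and> (snd (?g \<omega>)) x}) in
        Z \<le> (1 - \<gamma>) * (b / real r * pivot \<gamma>) \<or> T \<le> Z)"
      unfolding Z Let_def low_next_def using E_take[of "fst \<omega>" "snd \<omega>"] by simp
  qed
  also have "\<dots> = measure_pmf.prob (map_pmf ?g \<Omega>) {p. E (fst p) \<or>
      (let Z = real (card {x\<in>X. (\<forall>h\<in>set (fst (fst p)). h x) \<and> (snd p) x}) in
        Z \<le> (1 - \<gamma>) * (b / real r * pivot \<gamma>) \<or> T \<le> Z)}"
    unfolding measure_map_pmf vimage_def by simp
  also have "\<dots> \<le> s + (1 - (1 - 1 / real r) * (s * (1 - s))) * (c + (d + e))"
    unfolding map_split_last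
  proof (rule prob_low_or_saturated_union[OF base H finite_X _ _ _ \<gamma>_pos \<gamma>_less _ _ _ _ E le1 s])
    show "(1 / real r) ^ j * (1 / real r) * real (card X) = b / real r * pivot \<gamma>"
      using mean_next by (simp add: mult.commute)
    show "w\<^sub>0 / real r \<le> b / real r" using b by (simp add: divide_right_mono)
    show "b / real r \<le> 89 / 100" using b r21_pos by (simp add: divide_le_eq)
  qed (use b r21_pos r_ge in auto)
  finally show ?thesis .
qed

text \<open>Here the independent last hash is the refinement hash of range parameter 1. The events
  \<open>low_A\<close>, \<open>low_C 1\<close> and \<open>unsat_prev\<close> do not read it, whereas
  \<open>low_D 1\<close> does and stays in the plain union, together with the two saturation
  events.\<close>

lemma prob_bad_low_refined_D_sharp:
  assumes v: "0 < v" "v \<le> b / real r1" and b: "b \<le> w * real r1" "w \<le> 89/100"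
    and s: "s = 1 / (1 + 246/25 * v)"
    and e: "e = 1 / (1 + 246/25 * 1) + (1 / (1 + 246/25 * (real r / real r2)) +
       1 / (1 + 246/25 * (real r - 211/100)\<^sup>2 / real r))" and le1: "e \<le> 1"
  shows "measure_pmf.prob \<Omega> {\<omega>. bad_low_refined \<omega>} \<le> (s + (1 - (1 - 1 / real r1) * (s * (1 - s))) * e) +
    (1 / (1 + 246/25 * (real r / real r1)) +
    (sat_tail (w * real r1 / real r2) + sat_tail (w * real r1 / real r)))"
proof -
  define E where "E \<omega> \<longleftrightarrow> low_A \<omega> \<or> low_C 1 \<omega> \<or> unsat_prev \<omega>" for \<omega>
  let ?B = "pair_pmf M H2"
  let ?g = "\<lambda>\<omega>. ((fst \<omega>, fst (snd \<omega>)), snd (snd \<omega>))"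
  \<comment> \<open>The slot of the refinement hash that \<open>E\<close> does not read is filled
    with an arbitrary value.\<close>
  define E' where "E' p \<longleftrightarrow> E (fst p, snd p, undefined)" for p
  have E': "E' (fst (?g \<omega>)) \<longleftrightarrow> E \<omega>" for \<omega>
    by (simp add: E'_def E_def low_A_def low_C_def unsat_prev_def C_def)
  have map: "map_pmf ?g \<Omega> = pair_pmf ?B H1"
    by (simp add: map_pmf_def pair_pmf_def bind_assoc_pmf bind_return_pmf)
  have w: "b / real r2 \<le> w * real r1 / real r2" "b / real r \<le> w * real r1 / real r"
    using b r21_pos by (auto simp: divide_right_mono)
  have "w * real r1 \<le> 1 * real r1" using b by (intro mult_right_mono) auto
  then have w1: "w * real r1 / real r2 \<le> 1" "w * real r1 / real r \<le> 1" using ranges by auto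
  have r_le: "1 * real r \<le> b * real r" using b_gt by (intro mult_right_mono) auto
  have "measure_pmf.prob \<Omega> {\<omega>. E \<omega>} \<le> e"
    unfolding E_def e
  proof (intro prob_disj_le prob_low_A prob_low_C prob_unsat_prev)
    show "real r / real r2 \<le> b * real r ^ 1 / real r2" using r_le r21_pos by (simp add: divide_right_mono)
  qed (use b_gt r_le r21_pos ranges in auto)
  moreover have "measure_pmf.prob ?B {p. E' p} = measure_pmf.prob \<Omega> {\<omega>. E \<omega>}"
  proof -
    have "measure_pmf.prob ?B {p. E' p} = measure_pmf.prob (map_pmf fst (map_pmf ?g \<Omega>)) {p. E' p}"
      unfolding map map_fst_pair_pmf ..
    also have "\<dots> = measure_pmf.prob \<Omega> {\<omega>. E' (fst (?g \<omega>))}" by (simp add: vimage_def)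
    finally show ?thesis unfolding E' .
  qed
  ultimately have E: "measure_pmf.prob ?B {p. E' p} \<le> e" by simp
  have base: "pairwise_sieve ?B (\<lambda>p x. \<forall>h\<in>set (take j (fst p)). h x) X ((1 / real r) ^ j)"
    using j_less by (intro pairwise_sieve_fst pairwise_sieve_replicate_take H finite_H12) simp
  have "measure_pmf.prob \<Omega> {\<omega>. E \<omega> \<or> crit_D \<omega>} = measure_pmf.prob (map_pmf ?g \<Omega>) {p. E' (fst p) \<or>
      (let Z = real (card {x\<in>X. (\<forall>h\<in>set (take j (fst (fst p))). h x) \<and> (snd p) x}) in
        Z \<le> (1 - \<gamma>) * (b / real r1 * pivot \<gamma>) \<or> T \<le> Z)}"
    unfolding measure_map_pmf vimage_def mem_Collect_eq E' by (simp add: Let_def crit_D_def D_def)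
  also have "\<dots> \<le> s + (1 - (1 - 1 / real r1) * (s * (1 - s))) * e"
    unfolding map
  proof (rule prob_low_or_saturated_union[OF base H1 finite_X _ _ _ \<gamma>_pos \<gamma>_less v _ _ E le1 s])
    show "(1 / real r) ^ j * (1 / real r1) * real (card X) = b / real r1 * pivot \<gamma>"
      using Dj.mean .
    have "b / real r1 \<le> w" using b r21_pos by (simp add: divide_le_eq)
    then show "b / real r1 \<le> 89 / 100" using b(2) by linarith
  qed (use r21_pos ranges in auto)
  finally have crit: "measure_pmf.prob \<Omega> {\<omega>. E \<omega> \<or> crit_D \<omega>} \<le> s + (1 - (1 - 1 / real r1) * (s * (1 - s))) * e" .
  have "measure_pmf.prob \<Omega> {\<omega>. bad_low_refined \<omega>} \<le> measure_pmf.prob \<Omega>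
      {\<omega>. (E \<omega> \<or> crit_D \<omega>) \<or> low_D 1 \<omega> \<or> T \<le> C \<omega> j \<or> T \<le> A (fst \<omega>) (Suc j)}"
    by (rule prob_mono_support, drule bad_low_refined_cases) (auto simp: crit_D_def low_D_def E_def early_def)
  also have "\<dots> \<le> (s + (1 - (1 - 1 / real r1) * (s * (1 - s))) * e) +
    (1 / (1 + 246/25 * (real r / real r1)) +
    (sat_tail (w * real r1 / real r2) + sat_tail (w * real r1 / real r)))"
  proof (rule prob_disj_le[OF crit], intro prob_disj_le prob_low_D prob_sat_C[OF w(1) w1(1)] prob_sat_next[OF w(2) w1(2)])
    show "real r / real r1 \<le> b * real r ^ 1 / real r1" using r_le r21_pos by (simp add: divide_right_mono)
  qed (use r21_pos in simp)
  finally show ?thesis .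
qed

end

section \<open>Numerical case distinctions for underestimates\<close>

context refined_level
begin

text \<open>The margin condition tightens as \<open>\<gamma>\<close> grows, so it is checked at the
  upper end \<open>g\<close> of a range of \<open>\<gamma>\<close>.\<close>

lemma unsat_margin_mono:
  assumes "\<gamma> \<le> g" "1 + g + g\<^sup>2 / (246/25) + y * g \<le> w" "0 \<le> y"
  shows "1 + \<gamma> + \<gamma>\<^sup>2 / (246/25) + y * \<gamma> \<le> w"
proof -
  have "\<gamma>\<^sup>2 / (246/25) \<le> g\<^sup>2 / (246/25)" using assms \<gamma>_pos by (intro divide_right_mono power_mono) auto
  moreover have "y * \<gamma> \<le> y * g" using assms by (intro mult_left_mono) auto
  ultimately show ?thesis using assms(1,2) by linarith
qed

lemma prob_low_C_le: "0 < w \<Longrightarrow> w * real r2 \<le> b \<Longrightarrow> measure_pmf.prob \<Omega> {\<omega>. low_C 0 \<omega>} \<le> 1 / (1 + 246/25 * w)"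
  using r21_pos by (intro prob_low_C) (auto simp: le_divide_eq)

text \<open>
  The case distinction locates the first of the levels \<open>D\<close>, \<open>C\<close>, \<open>A\<close> whose mean drops below the
  pivot. If the mean of \<open>C\<close> is only slightly above the pivot, the level \<open>C\<close> is taken for it; how
  much is tolerated depends on \<open>\<gamma>\<close>.
\<close>

lemma prob_bad_low_refined_multiply_shift:
  assumes r: "r = 16" "r2 = 4" "r1 = 2"
  shows "measure_pmf.prob \<Omega> {\<omega>. bad_low_refined \<omega>} \<le> 378/1000"
proof -
  note defs = early_tail_def sat_tail_def r
  consider "b \<le> 2" | "2 < b" "b \<le> 4" | "8 \<le> b" | "4 < b" "b < 8" by linarith
  then show ?thesis
  proof cases
    case 1
    have "measure_pmf.prob \<Omega> {\<omega>. bad_low_refined \<omega>} \<le> 1 / (1 + 246/25 * (1/2)) +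
        (early_bound 1 + (sat_tail (1 * real r1 / real r2) + sat_tail (1 * real r1 / real r)))"
      by (rule prob_bad_low_refined_D) (use 1 b_gt r in auto)
    also have "\<dots> \<le> 378/1000" unfolding defs by (simp add: power2_eq_square)
    finally show ?thesis .
  next
    case 2
    have "measure_pmf.prob \<Omega> {\<omega>. bad_low_refined \<omega>} \<le> 1 / (1 + 246/25 * (1/2)) +
        (1 / (1 + 246/25 * 1) + (early_bound (real r1) + sat_tail (real r2 / real r)))"
      by (rule prob_bad_low_refined_C) (use 2 r in auto)
    also have "\<dots> \<le> 378/1000" unfolding defs by (simp add: power2_eq_square)
    finally show ?thesis .
  next
    case 3
    have "measure_pmf.prob \<Omega> {\<omega>. bad_low_refined \<omega>} \<le> 1 / (1 + 246/25 * (1/2)) +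
      (1 / (1 + 246/25 * (real r / 2 / real r2)) + (1 / (1 + 246/25 * (real r / 2 / real r1)) + early_bound (real r / 2)))"
      by (rule prob_bad_low_refined_A_easy) (use 3 r in auto)
    also have "\<dots> \<le> 378/1000" unfolding defs by (simp add: power2_eq_square)
    finally show ?thesis .
  next
    case 4
    \<comment> \<open>The mean of \<open>C\<close> is between one and two pivots, the tight range.
      \<open>above\<close> keeps \<open>C\<close> critical; \<open>below\<close> makes the cell at
      \<open>Suc j\<close> critical and relies on the sharpened union bound.\<close>
    have above: ?thesis
      if "b \<le> w * 4" "w - 1 \<le> t * \<gamma>" "0 \<le> t" "t \<le> 1" "w \<le> 2"
        "(4 * w / (246/25) + t\<^sup>2) / (2 - t)\<^sup>2 + (1 / (1 + 246/25 * (real r2 / real r1)) +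
          (early_bound (real r2) + sat_tail (w * real r2 / real r))) \<le> 378/1000" for w t
      by (rule order_trans[OF prob_bad_low_refined_C_above_pivot[of w t]]) (use 4 that r in auto)
    have below: ?thesis
      if "1 \<le> w" "w * 4 \<le> b" "measure_pmf.prob \<Omega> {\<omega>. D \<omega> j < T \<and> low_D 0 \<omega>} \<le> d"
        "measure_pmf.prob \<Omega> {\<omega>. early \<omega>} \<le> e" "1 / (1 + 246/25 * w) + (d + e) \<le> 1"
        "s = 1 / (1 + 246/25 * (w * 4 / real r))"
        "s + (1 - (1 - 1 / real r) * (s * (1 - s))) * (1 / (1 + 246/25 * w) + (d + e)) \<le> 378/1000" for w d e s
    proof -
      have C: "measure_pmf.prob \<Omega> {\<omega>. low_C 0 \<omega>} \<le> 1 / (1 + 246/25 * w)"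
        by (rule prob_low_C_le) (use that(1,2) r(2) in auto)
      have "1 \<le> w * 4" using that(1) by simp
      moreover have "b \<le> 89/100 * real r" using 4 r(1) by simp
      ultimately show ?thesis
        using prob_bad_low_refined_A[OF that(2) _ _ C that(3-6)] that(7) by linarith
    qed
    \<comment> \<open>Except for small \<open>\<gamma>\<close>, the mean of \<open>C\<close> is cut
      at some \<open>w\<close>: \<open>above\<close> serves up to the cut, with \<open>t\<close>
      equal to \<open>w - 1\<close> over the least \<open>\<gamma>\<close>, rounded up, and
      \<open>below\<close> serves beyond it.\<close>
    consider "\<gamma> \<le> 1/5" | "1/5 \<le> \<gamma>" "\<gamma> \<le> 32/100" | "32/100 \<le> \<gamma>" "\<gamma> \<le> 1/2" | "1/2 \<le> \<gamma>" by linarith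
    then show ?thesis
    proof cases
      case 1
      \<comment> \<open>3.97 is the gap \<open>2 - 1 - \<gamma> - \<gamma>\<^sup>2 / 9.84\<close> at
        \<open>\<gamma> = 1/5\<close>, divided by \<open>\<gamma>\<close> and rounded down; the
        other constants of this kind come likewise from their \<open>w\<close> and the largest
        \<open>\<gamma>\<close>.\<close>
      have D: "measure_pmf.prob \<Omega> {\<omega>. D \<omega> j < T \<and> low_D 0 \<omega>} \<le> 1 / (1 + 246/25 * (397/100)\<^sup>2 / 2)"
        by (rule prob_low_D_unsat[OF _ unsat_margin_mono[OF 1]]) (use 4 r in \<open>auto simp: power2_eq_square\<close>)
      have E: "measure_pmf.prob \<Omega> {\<omega>. early \<omega>} \<le> 1 / (1 + 246/25 * (139/10)\<^sup>2 / 4)"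
        by (rule prob_early_unsat[OF _ unsat_margin_mono[OF 1]]) (use 4 in \<open>auto simp: power2_eq_square\<close>)
      show ?thesis
        by (rule below[OF _ _ D E _ refl, of 1]) (use 4 in \<open>auto simp: r power2_eq_square\<close>)
    next
      case 2
      show ?thesis
      proof (cases "b \<le> 108/100 * 4")
        case True
        show ?thesis
          by (rule above[OF True, of "4/10"]) (use 2 in \<open>auto simp: defs power2_eq_square\<close>)
      next
        case False
        have D: "measure_pmf.prob \<Omega> {\<omega>. D \<omega> j < T \<and> low_D 0 \<omega>} \<le> 1 / (1 + 246/25 * (259/100)\<^sup>2 / (216/100))"
          by (rule prob_low_D_unsat[OF _ unsat_margin_mono[OF 2(2)]]) (use False r in \<open>auto simp: power2_eq_square\<close>)
        have E: "measure_pmf.prob \<Omega> {\<omega>. early \<omega>} \<le> 1 / (1 + 246/25 * (93/10)\<^sup>2 / (432/100))"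
          by (rule prob_early_unsat[OF _ unsat_margin_mono[OF 2(2)]]) (use False in \<open>auto simp: power2_eq_square\<close>)
        show ?thesis
          by (rule below[OF _ _ D E _ refl, of "108/100"]) (use False in \<open>auto simp: r power2_eq_square\<close>)
      qed
    next
      case 3
      show ?thesis
      proof (cases "b \<le> 113/100 * 4")
        case True
        show ?thesis
          by (rule above[OF True, of "41/100"]) (use 3 in \<open>auto simp: defs power2_eq_square\<close>)
      next
        case False
        have D: "measure_pmf.prob \<Omega> {\<omega>. D \<omega> j < T \<and> low_D 0 \<omega>} \<le> 1 / (1 + 246/25 * (226/100))"
          by (rule prob_low_D_le) (use False r in auto)
        have E: "measure_pmf.prob \<Omega> {\<omega>. early \<omega>} \<le> 1 / (1 + 246/25 * (598/100)\<^sup>2 / (452/100))"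
          by (rule prob_early_unsat[OF _ unsat_margin_mono[OF 3(2)]]) (use False in \<open>auto simp: power2_eq_square\<close>)
        show ?thesis
          by (rule below[OF _ _ D E _ refl, of "113/100"]) (use False in \<open>auto simp: r power2_eq_square\<close>)
      qed
    next
      case g: 4
      show ?thesis
      proof (cases "b \<le> 121/100 * 4")
        case True
        show ?thesis
          by (rule above[OF True, of "42/100"]) (use g in \<open>auto simp: defs power2_eq_square\<close>)
      next
        case False
        have D: "measure_pmf.prob \<Omega> {\<omega>. D \<omega> j < T \<and> low_D 0 \<omega>} \<le> 1 / (1 + 246/25 * (242/100))"
          by (rule prob_low_D_le) (use False r in auto)
        have E: "measure_pmf.prob \<Omega> {\<omega>. early \<omega>} \<le> early_bound (484/100)"
          by (rule prob_early) (use False in auto)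
        show ?thesis
          by (rule below[OF _ _ D E _ refl, of "121/100"]) (use False in \<open>auto simp: defs power2_eq_square\<close>)
      qed
    qed
  qed
qed

text \<open>A further tight spot arises from range 3: if the mean at level \<open>j\<close> is
  barely above the pivot, \<open>D\<close> has only a third of a pivot, and its charge 0.234
  together with 0.147 for early stopping exceeds 0.378. Hence the sharpened bound for
  \<open>b \<le> 6/5\<close>.\<close>

lemma prob_bad_low_refined_multiply_mod_prime:
  assumes r: "r = 17" "r2 = 5" "r1 = 3"
  shows "measure_pmf.prob \<Omega> {\<omega>. bad_low_refined \<omega>} \<le> 378/1000"
proof -
  note defs = early_tail_def sat_tail_def r
  consider "b \<le> 6/5" | "6/5 \<le> b" "b \<le> 3" | "3 < b" "b \<le> 5" | "17/2 \<le> b" | "5 < b" "b < 17/2" by linarith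
  then show ?thesis
  proof cases
    case 1
    \<comment> \<open>\<open>25/107\<close> is \<open>1 / (1 + 9.84 / 3)\<close>, and
      \<open>2/5\<close> bounds the mean \<open>b / 3\<close> of \<open>D\<close>.\<close>
    have "measure_pmf.prob \<Omega> {\<omega>. bad_low_refined \<omega>} \<le>
        (25/107 + (1 - (1 - 1 / real r1) * (25/107 * (1 - 25/107))) *
          (1 / (1 + 246/25 * 1) + (1 / (1 + 246/25 * (real r / real r2)) +
            1 / (1 + 246/25 * (real r - 211/100)\<^sup>2 / real r)))) +
        (1 / (1 + 246/25 * (real r / real r1)) +
          (sat_tail (2/5 * real r1 / real r2) + sat_tail (2/5 * real r1 / real r)))"
      by (rule prob_bad_low_refined_D_sharp[where v = "1/3", OF _ _ _ _ _ refl])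
         (use 1 b_gt r in \<open>auto simp: power2_eq_square\<close>)
    also have "\<dots> \<le> 378/1000" unfolding defs by (simp add: power2_eq_square)
    finally show ?thesis .
  next
    case 2
    have "measure_pmf.prob \<Omega> {\<omega>. bad_low_refined \<omega>} \<le> 1 / (1 + 246/25 * (2/5)) +
        (early_bound (6/5) + (sat_tail (1 * real r1 / real r2) + sat_tail (1 * real r1 / real r)))"
      by (rule prob_bad_low_refined_D) (use 2 r in auto)
    also have "\<dots> \<le> 378/1000" unfolding defs by (simp add: power2_eq_square)
    finally show ?thesis .
  next
    case 3
    have "measure_pmf.prob \<Omega> {\<omega>. bad_low_refined \<omega>} \<le> 1 / (1 + 246/25 * (3/5)) +
        (1 / (1 + 246/25 * 1) + (early_bound (real r1) + sat_tail (real r2 / real r)))"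
      by (rule prob_bad_low_refined_C) (use 3 r in auto)
    also have "\<dots> \<le> 378/1000" unfolding defs by (simp add: power2_eq_square)
    finally show ?thesis .
  next
    case 4
    have "measure_pmf.prob \<Omega> {\<omega>. bad_low_refined \<omega>} \<le> 1 / (1 + 246/25 * (1/2)) +
      (1 / (1 + 246/25 * (real r / 2 / real r2)) + (1 / (1 + 246/25 * (real r / 2 / real r1)) + early_bound (real r / 2)))"
      by (rule prob_bad_low_refined_A_easy) (use 4 r in auto)
    also have "\<dots> \<le> 378/1000" unfolding defs by (simp add: power2_eq_square)
    finally show ?thesis .
  next
    case 5
    have above: ?thesis
      if "b \<le> w * 5" "w - 1 \<le> t * \<gamma>" "0 \<le> t" "t \<le> 1" "w \<le> 2"
        "(4 * w / (246/25) + t\<^sup>2) / (2 - t)\<^sup>2 + (1 / (1 + 246/25 * (real r2 / real r1)) +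
          (early_bound (real r2) + sat_tail (w * real r2 / real r))) \<le> 378/1000" for w t
      by (rule order_trans[OF prob_bad_low_refined_C_above_pivot[of w t]]) (use 5 that r in auto)
    have below: ?thesis
      if "1 \<le> w" "w * 5 \<le> b" "measure_pmf.prob \<Omega> {\<omega>. D \<omega> j < T \<and> low_D 0 \<omega>} \<le> d"
        "measure_pmf.prob \<Omega> {\<omega>. early \<omega>} \<le> e" "1 / (1 + 246/25 * w) + (d + e) \<le> 1"
        "s = 1 / (1 + 246/25 * (w * 5 / real r))"
        "s + (1 - (1 - 1 / real r) * (s * (1 - s))) * (1 / (1 + 246/25 * w) + (d + e)) \<le> 378/1000" for w d e s
    proof -
      have C: "measure_pmf.prob \<Omega> {\<omega>. low_C 0 \<omega>} \<le> 1 / (1 + 246/25 * w)"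
        by (rule prob_low_C_le) (use that(1,2) r(2) in auto)
      have "1 \<le> w * 5" using that(1) by simp
      moreover have "b \<le> 89/100 * real r" using 5 r(1) by simp
      ultimately show ?thesis
        using prob_bad_low_refined_A[OF that(2) _ _ C that(3-6)] that(7) by linarith
    qed
    consider "\<gamma> \<le> 1/5" | "1/5 \<le> \<gamma>" "\<gamma> \<le> 32/100" | "32/100 \<le> \<gamma>" "\<gamma> \<le> 1/2" | "1/2 \<le> \<gamma>" by linarith
    then show ?thesis
    proof cases
      case 1
      have D: "measure_pmf.prob \<Omega> {\<omega>. D \<omega> j < T \<and> low_D 0 \<omega>} \<le> 1 / (1 + 246/25 * (23/10)\<^sup>2 / (5/3))"
        by (rule prob_low_D_unsat[OF _ unsat_margin_mono[OF 1]]) (use 5 r in \<open>auto simp: power2_eq_square\<close>)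
      have E: "measure_pmf.prob \<Omega> {\<omega>. early \<omega>} \<le> 1 / (1 + 246/25 * (18)\<^sup>2 / 5)"
        by (rule prob_early_unsat[OF _ unsat_margin_mono[OF 1]]) (use 5 in \<open>auto simp: power2_eq_square\<close>)
      show ?thesis
        by (rule below[OF _ _ D E _ refl, of 1]) (use 5 in \<open>auto simp: r power2_eq_square\<close>)
    next
      case 2
      show ?thesis
      proof (cases "b \<le> 108/100 * 5")
        case True
        show ?thesis
          by (rule above[OF True, of "4/10"]) (use 2 in \<open>auto simp: defs power2_eq_square\<close>)
      next
        case False
        have D: "measure_pmf.prob \<Omega> {\<omega>. D \<omega> j < T \<and> low_D 0 \<omega>} \<le> 1 / (1 + 246/25 * (18/10))"
          by (rule prob_low_D_le) (use False r in auto)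
        have E: "measure_pmf.prob \<Omega> {\<omega>. early \<omega>} \<le> 1 / (1 + 246/25 * (127/10)\<^sup>2 / (54/10))"
          by (rule prob_early_unsat[OF _ unsat_margin_mono[OF 2(2)]]) (use False in \<open>auto simp: power2_eq_square\<close>)
        show ?thesis
          by (rule below[OF _ _ D E _ refl, of "108/100"]) (use False in \<open>auto simp: r power2_eq_square\<close>)
      qed
    next
      case 3
      show ?thesis
      proof (cases "b \<le> 113/100 * 5")
        case True
        show ?thesis
          by (rule above[OF True, of "41/100"]) (use 3 in \<open>auto simp: defs power2_eq_square\<close>)
      next
        case False
        have D: "measure_pmf.prob \<Omega> {\<omega>. D \<omega> j < T \<and> low_D 0 \<omega>} \<le> 1 / (1 + 246/25 * (565/300))"
          by (rule prob_low_D_le) (use False r in auto)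
        have E: "measure_pmf.prob \<Omega> {\<omega>. early \<omega>} \<le> 1 / (1 + 246/25 * (82/10)\<^sup>2 / (565/100))"
          by (rule prob_early_unsat[OF _ unsat_margin_mono[OF 3(2)]]) (use False in \<open>auto simp: power2_eq_square\<close>)
        show ?thesis
          by (rule below[OF _ _ D E _ refl, of "113/100"]) (use False in \<open>auto simp: r power2_eq_square\<close>)
      qed
    next
      case g: 4
      show ?thesis
      proof (cases "b \<le> 121/100 * 5")
        case True
        show ?thesis
          by (rule above[OF True, of "42/100"]) (use g in \<open>auto simp: defs power2_eq_square\<close>)
      next
        case False
        have D: "measure_pmf.prob \<Omega> {\<omega>. D \<omega> j < T \<and> low_D 0 \<omega>} \<le> 1 / (1 + 246/25 * (605/300))"
          by (rule prob_low_D_le) (use False r in auto)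
        have E: "measure_pmf.prob \<Omega> {\<omega>. early \<omega>} \<le> early_bound (605/100)"
          by (rule prob_early) (use False in auto)
        show ?thesis
          by (rule below[OF _ _ D E _ refl, of "121/100"]) (use False in \<open>auto simp: defs power2_eq_square\<close>)
      qed
    qed
  qed
qed

section \<open>Overestimates for the refined families\<close>

text \<open>If the search ends at level \<open>j\<close> or earlier, all three candidate cells have
  means of at least one pivot and, being unsaturated when kept, are no overestimates. There remain
  the three candidates on top of \<open>j\<close> constraints, and saturation at
  \<open>Suc j\<close>.\<close>

lemma bad_high_refined_cases:
  assumes "bad_high_refined \<omega>"
  shows "T \<le> A (fst \<omega>) (Suc j) \<or>
    (T \<le> C \<omega> j \<and> b / real r * pivot \<gamma> / (1 - \<gamma>) < A (fst \<omega>) (Suc j)) \<or>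
    (T \<le> D \<omega> j \<and> C \<omega> j < T \<and> b / real r2 * pivot \<gamma> / (1 - \<gamma>) < C \<omega> j) \<or>
    (D \<omega> j < T \<and> b / real r1 * pivot \<gamma> / (1 - \<gamma>) < D \<omega> j)"
proof -
  consider "T \<le> A (fst \<omega>) N"
    | k where "first_unsat (fst \<omega>) (Suc k)"
      "(T \<le> C \<omega> k \<and> real (card X) / real r ^ Suc k / (1 - \<gamma>) < A (fst \<omega>) (Suc k)) \<or>
       (T \<le> D \<omega> k \<and> C \<omega> k < T \<and> real (card X) / (real r ^ k * real r2) / (1 - \<gamma>) < C \<omega> k) \<or>
       (D \<omega> k < T \<and> real (card X) / (real r ^ k * real r1) / (1 - \<gamma>) < D \<omega> k)"
    using assms unfolding bad_high_refined_def by blast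
  then show ?thesis
  proof cases
    case 1
    then show ?thesis using A_antimono[of "Suc j" N "fst \<omega>"] j_less by simp
  next
    case (2 k)
    note first = 2(1)[unfolded first_unsat_def]
    consider "k > j" | "k = j" | "k < j" by linarith
    then show ?thesis
    proof cases
      case 1
      then have "A (fst \<omega>) k \<le> A (fst \<omega>) (Suc j)" by (intro A_antimono) simp
      then show ?thesis using first by simp
    next
      case k: 2
      have sizes: "real (card X) / (real r ^ j * real r2) = b / real r2 * pivot \<gamma>"
        "real (card X) / (real r ^ j * real r1) = b / real r1 * pivot \<gamma>"
        using size_C[of 0] size_D[of 0] by simp_all
      show ?thesis using 2(2) unfolding k size_next sizes by blast
    next
      case 3
      define i where "i = j - k"
      have i: "i \<le> j" "k = j - i" "i = Suc (i - 1)" "Suc k = j - (i - 1)" "i - 1 \<le> j" using 3 by (auto simp: i_def)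
      have pow: "1 \<le> real r ^ n" for n using r_ge by simp
      have "real r * 1 \<le> real r * real r ^ (i - 1)" using pow by (intro mult_left_mono) auto
      then have ri: "real r \<le> real r ^ i" by (subst i(3)) simp
      have "1 * real r \<le> b * real r ^ i" using ri b_gt by (intro mult_mono) auto
      then have "1 \<le> b * real r ^ i / real r2" "1 \<le> b * real r ^ i / real r1"
        using ranges by (auto simp: le_divide_eq)
      from this[THEN sat_bound_le]
      have CD: "T \<le> real (card X) / (real r ^ k * real r2) / (1 - \<gamma>)" "T \<le> real (card X) / (real r ^ k * real r1) / (1 - \<gamma>)"
        unfolding i(2) size_C[OF i(1)] size_D[OF i(1)] .
      have "1 * 1 \<le> b * real r ^ (i - 1)" using pow b_gt by (intro mult_mono) auto
      then have "T \<le> b * real r ^ (i - 1) * pivot \<gamma> / (1 - \<gamma>)" by (intro sat_bound_le) simp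
      then have "T \<le> real (card X) / real r ^ Suc k / (1 - \<gamma>)"
        unfolding i(4) size_up[OF i(5)] .
      with CD show ?thesis using 2(2) first by linarith
    qed
  qed
qed

lemma not_high:
  assumes "z < T" "1 \<le> w"
  shows "\<not> w * pivot \<gamma> / (1 - \<gamma>) < z"
  using sat_bound_le[OF assms(2)] assms(1) by linarith

text \<open>\<open>b\<close> decides which of \<open>D\<close>, \<open>C\<close> and the cell at
  \<open>Suc j\<close>, in this order, is the first of mean at most one pivot. Those before it are
  never too high, it is itself charged by Cantelli's bound, and those after it are kept only if
  their predecessor is saturated.\<close>

lemma prob_bad_high_refined: "measure_pmf.prob \<Omega> {\<omega>. bad_high_refined \<omega>} \<le> 378/1000"
proof -
  have highA: "measure_pmf.prob \<Omega> {\<omega>. (1 + \<gamma>) * (b / real r * pivot \<gamma>) \<le> A (fst \<omega>) (Suc j)} \<le> 1 / (1 + 246/25 * v)"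
    if "0 < v" "v \<le> b / real r" for v
    using An.prob_high[OF that] prob_fst[of "\<lambda>hs. (1 + \<gamma>) * (b / real r * pivot \<gamma>) \<le> A hs (Suc j)"]
    by (simp add: A_def)
  consider "b \<le> real r1" | "real r1 < b" "b \<le> real r2" | "real r2 < b" by linarith
  then show ?thesis
  proof cases
    case 1
    then have le: "b / real r1 \<le> 1" "0 \<le> b / real r1" using r21_pos b_gt by auto
    have "measure_pmf.prob \<Omega> {\<omega>. bad_high_refined \<omega>} \<le> measure_pmf.prob \<Omega>
        {\<omega>. (1 + \<gamma>) * (b / real r1 * pivot \<gamma>) \<le> D \<omega> j \<or> T \<le> C \<omega> j \<or> T \<le> A (fst \<omega>) (Suc j)}"
    proof (rule prob_mono_support)
      fix \<omega> assume "bad_high_refined \<omega>"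
      from bad_high_refined_cases[OF this] show "(1 + \<gamma>) * (b / real r1 * pivot \<gamma>) \<le> D \<omega> j \<or> T \<le> C \<omega> j \<or> T \<le> A (fst \<omega>) (Suc j)"
        using high_le[of "b / real r1" "D \<omega> j"] le by blast
    qed
    also have "\<dots> \<le> 1 / (1 + 246/25 * (1 / real r1)) + (sat_tail (real r1 / real r2) + sat_tail (real r1 / real r))"
    proof (intro prob_disj_le prob_sat_C prob_sat_next)
      show "measure_pmf.prob \<Omega> {\<omega>. (1 + \<gamma>) * (b / real r1 * pivot \<gamma>) \<le> D \<omega> j} \<le> 1 / (1 + 246/25 * (1 / real r1))"
        using Dj.prob_high[of "1 / real r1"] b_gt r21_pos by (simp add: D_def divide_right_mono)
      show "b / real r2 \<le> real r1 / real r2" "b / real r \<le> real r1 / real r"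
        using 1 by (simp_all add: divide_right_mono)
    qed (use ranges in auto)
    also have "\<dots> \<le> 378/1000"
      using ranges by (auto simp: sat_tail_def power2_eq_square)
    finally show ?thesis .
  next
    case 2
    then have le: "b / real r2 \<le> 1" "0 \<le> b / real r2" "1 \<le> b / real r1" using r21_pos b_gt by auto
    have "measure_pmf.prob \<Omega> {\<omega>. bad_high_refined \<omega>} \<le> measure_pmf.prob \<Omega>
        {\<omega>. (1 + \<gamma>) * (b / real r2 * pivot \<gamma>) \<le> C \<omega> j \<or> T \<le> A (fst \<omega>) (Suc j)}"
    proof (rule prob_mono_support)
      fix \<omega> assume "bad_high_refined \<omega>"
      from bad_high_refined_cases[OF this] show "(1 + \<gamma>) * (b / real r2 * pivot \<gamma>) \<le> C \<omega> j \<or> T \<le> A (fst \<omega>) (Suc j)"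
        using high_le[of "b / real r2" "C \<omega> j"] not_high[of "D \<omega> j" "b / real r1"] le by blast
    qed
    also have "\<dots> \<le> 1 / (1 + 246/25 * (real r1 / real r2)) + sat_tail (real r2 / real r)"
    proof (intro prob_disj_le prob_sat_next)
      show "measure_pmf.prob \<Omega> {\<omega>. (1 + \<gamma>) * (b / real r2 * pivot \<gamma>) \<le> C \<omega> j} \<le> 1 / (1 + 246/25 * (real r1 / real r2))"
        using Cj.prob_high[of "real r1 / real r2"] 2 r21_pos by (simp add: C_def divide_right_mono)
      show "b / real r \<le> real r2 / real r"
        using 2 by (simp_all add: divide_right_mono)
    qed (use ranges in auto)
    also have "\<dots> \<le> 378/1000"
      using ranges by (auto simp: sat_tail_def power2_eq_square)
    finally show ?thesis .
  next
    case 3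
    then have le: "1 \<le> b / real r2" "1 \<le> b / real r1" "b / real r \<le> 1" "0 \<le> b / real r"
      using ranges r21_pos b_gt b_le by auto
    have "measure_pmf.prob \<Omega> {\<omega>. bad_high_refined \<omega>} \<le> measure_pmf.prob \<Omega>
        {\<omega>. (1 + \<gamma>) * (b / real r * pivot \<gamma>) \<le> A (fst \<omega>) (Suc j)}"
    proof (rule prob_mono_support)
      fix \<omega> assume "bad_high_refined \<omega>"
      from bad_high_refined_cases[OF this] show "(1 + \<gamma>) * (b / real r * pivot \<gamma>) \<le> A (fst \<omega>) (Suc j)"
        using high_le[of "b / real r" "A (fst \<omega>) (Suc j)"] not_high[of "D \<omega> j" "b / real r1"]
          not_high[of "C \<omega> j" "b / real r2"] le by blast
    qed
    also have "\<dots> \<le> 1 / (1 + 246/25 * (real r2 / real r))"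
      using 3 r21_pos by (intro highA) (auto simp: divide_right_mono)
    also have "\<dots> \<le> 378/1000" using ranges by auto
    finally show ?thesis .
  qed
qed

end

context refined_hashing
begin

lemma iteration_bad:
  "measure_pmf.prob (pair_pmf (replicate_pmf N H) (pair_pmf H2 H1)) {\<omega>. bad_low_refined \<omega>} \<le> 378/1000"
  "measure_pmf.prob (pair_pmf (replicate_pmf N H) (pair_pmf H2 H1)) {\<omega>. bad_high_refined \<omega>} \<le> 378/1000"
proof -
  obtain j b where "j < N" "1 < b" "b \<le> real r" "real (card X) = b * pivot \<gamma> * real r ^ j"
    using ex_level by blast
  then interpret refined_level X H r N \<gamma> H2 H1 r2 r1 j b
    by unfold_locales
  show "measure_pmf.prob \<Omega> {\<omega>. bad_low_refined \<omega>} \<le> 378/1000"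
    using prob_bad_low_refined_multiply_shift prob_bad_low_refined_multiply_mod_prime ranges by blast
  show "measure_pmf.prob \<Omega> {\<omega>. bad_high_refined \<omega>} \<le> 378/1000"
    by (rule prob_bad_high_refined)
qed

end

context hashing
begin

lemma iteration_bad_XOR:
  assumes "r = 2"
  shows "measure_pmf.prob (replicate_pmf N H) {hs. bad_low hs} \<le> 36/100"
    "measure_pmf.prob (replicate_pmf N H) {hs. bad_high hs} \<le> 36/100"
proof -
  obtain j b where "j < N" "1 < b" "b \<le> real r" "real (card X) = b * pivot \<gamma> * real r ^ j"
    using ex_level by blast
  then interpret hashing_level X H r N \<gamma> j b
    by unfold_locales
  show "measure_pmf.prob M {hs. bad_low hs} \<le> 36/100" by (rule prob_bad_low_XOR[OF assms])
  show "measure_pmf.prob M {hs. bad_high hs} \<le> 36/100" by (rule prob_bad_high_XOR[OF assms])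
qed

end

section \<open>One iteration of the algorithm\<close>

text \<open>A constraint has the same value on an assignment and on its restriction, so filtering
  and projecting commute. This identifies the cells of the algorithm with those of the probabilistic
  part.\<close>

lemma proj_Sol_conj_all:
  assumes "\<And>h \<tau>. h \<in> set hs \<Longrightarrow> h (restrict \<tau> S) = h \<tau>"
  shows "proj_Sol V \<Gamma> (conj_all F hs) S = {x\<in>proj_Sol V \<Gamma> F S. \<forall>h\<in>set hs. h x}"
proof -
  have all: "(\<forall>h\<in>set hs. h (restrict \<tau> S)) \<longleftrightarrow> (\<forall>h\<in>set hs. h \<tau>)" for \<tau>
    using assms by (intro ball_cong refl)
  have "proj_Sol V \<Gamma> (conj_all F hs) S =
      (\<lambda>\<tau>. restrict \<tau> S) ` {\<tau>\<in>Sol V \<Gamma> F. \<forall>h\<in>set hs. h (restrict \<tau> S)}"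
    unfolding proj_Sol_def all by (intro arg_cong[of _ _ "image _"]) (simp add: Sol_def conj_all_def conj_assoc)
  also have "\<dots> = {x\<in>proj_Sol V \<Gamma> F S. \<forall>h\<in>set hs. h x}"
    unfolding proj_Sol_def by (simp only: Compr_image_eq)
  finally show ?thesis .
qed

locale pact_run =
  fixes fam :: hash_family and V :: "'v set" and \<Gamma> :: "'v \<Rightarrow> 'a srt" and S :: "'v set"
    and solve :: "('v, 'a) solver" and F :: "('v, 'a) formula" and \<epsilon> :: real
  assumes setting: "pact_setting fam V \<Gamma> S solve" and \<epsilon>_pos: "0 < \<epsilon>"
begin

abbreviation X :: "('v, 'a) assignment set" where "X \<equiv> proj_Sol V \<Gamma> F S"
abbreviation T :: real where "T \<equiv> thresh \<epsilon>"
abbreviation Hash :: "nat \<Rightarrow> ('v, 'a) formula pmf" where "Hash l \<equiv> hash_constraint_pmf fam \<Gamma> S l"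
abbreviation N :: nat where "N \<equiv> total_bits \<Gamma> S"

text \<open>Chosen so that \<open>1 - \<gamma> = 1 / (1 + \<epsilon>)\<close>: the admissible
  factors are \<open>1 - \<gamma>\<close> below and \<open>1 / (1 - \<gamma>)\<close> above.\<close>

definition \<gamma> :: real where "\<gamma> = \<epsilon> / (1 + \<epsilon>)"

lemma \<gamma>_bounds: "0 < \<gamma>" "\<gamma> < 1" using \<epsilon>_pos by (auto simp: \<gamma>_def)

lemma one_minus_\<gamma>: "1 - \<gamma> = 1 / (1 + \<epsilon>)" using \<epsilon>_pos by (simp add: \<gamma>_def field_simps)

lemma T_eq: "T = sat_bound \<gamma>"
proof -
  have "1 + 1 / \<epsilon> = 1 / \<gamma>" using \<epsilon>_pos by (simp add: \<gamma>_def field_simps)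
  then have "T = 1 + 9.84 * (1 + \<gamma>) * (1 / \<gamma>)\<^sup>2" by (simp add: thresh_def \<gamma>_def)
  also have "\<dots> = sat_bound \<gamma>" by (simp add: sat_bound_def pivot_def power_divide)
  finally show ?thesis .
qed

lemma T_gt: "1 < T"
  unfolding T_eq sat_bound_def pivot_def using \<gamma>_bounds by simp

lemma solver: "smt_solver V \<Gamma> solve" and valid: "valid_family fam" and S_sub: "S \<subseteq> V"
  and finite_S: "finite S" and S_bv: "\<forall>v\<in>S. \<exists>w\<ge>1. \<Gamma> v = BitVec w"
  using setting finite_subset unfolding pact_setting_def by auto

lemma X_sub: "X \<subseteq> (\<Pi>\<^sub>E v\<in>S. carrier_of (\<Gamma> v))"
proof
  fix x assume "x \<in> X"
  then obtain \<tau> where "\<tau> \<in> (\<Pi>\<^sub>E v\<in>V. carrier_of (\<Gamma> v))" "x = restrict \<tau> S"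
    unfolding proj_Sol_def Sol_def by auto
  then show "x \<in> (\<Pi>\<^sub>E v\<in>S. carrier_of (\<Gamma> v))" using S_sub by (auto simp: PiE_def Pi_def)
qed

lemma carrier_bv: "v \<in> S \<Longrightarrow> finite (carrier_of (\<Gamma> v)) \<and> card (carrier_of (\<Gamma> v)) = 2 ^ width (\<Gamma> v)"
proof -
  assume "v \<in> S"
  then obtain w where "\<Gamma> v = BitVec w" using S_bv by auto
  then show ?thesis by (simp add: card_image inj_on_def)
qed

lemma finite_X: "finite X"
  using X_sub by (rule finite_subset) (use finite_S carrier_bv in \<open>auto intro!: finite_PiE\<close>)

lemma card_X: "card X \<le> 2 ^ N"
proof -
  have "card X \<le> card (\<Pi>\<^sub>E v\<in>S. carrier_of (\<Gamma> v))"
    using X_sub by (intro card_mono) (use finite_S carrier_bv in \<open>auto intro!: finite_PiE\<close>)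
  also have "\<dots> = (\<Prod>v\<in>S. card (carrier_of (\<Gamma> v)))" using finite_S by (rule card_PiE)
  also have "\<dots> = (\<Prod>v\<in>S. 2 ^ width (\<Gamma> v))" using carrier_bv by (intro prod.cong) auto
  also have "\<dots> = 2 ^ N" by (simp add: total_bits_def power_sum)
  finally show ?thesis .
qed

lemma Hash_sieve: "1 \<le> l \<Longrightarrow> pairwise_sieve (Hash l) (\<lambda>h. h) X (1 / real (range_size fam l))"
  by (rule pairwise_sieve_hash_constraint[OF valid _ finite_S S_bv X_sub])

lemma sat_count_cell:
  assumes "set hs \<subseteq> (\<Union>l. set_pmf (Hash l))"
  shows "fst (sat_count solve S T (conj_all F hs) 0) =
      (if real (card {x\<in>X. \<forall>h\<in>set hs. h x}) < T then Some (card {x\<in>X. \<forall>h\<in>set hs. h x}) else None)"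
proof -
  have loc: "h (restrict \<tau> S) = h \<tau>" if h: "h \<in> set hs" for h \<tau>
  proof -
    obtain l where "h \<in> set_pmf (Hash l)" using subsetD[OF assms h] by auto
    then show ?thesis by (rule hash_constraint_local)
  qed
  have eq: "proj_Sol V \<Gamma> (conj_all F hs) S = {x\<in>X. \<forall>h\<in>set hs. h x}"
    by (rule proj_Sol_conj_all[OF loc])
  have "finite {x\<in>X. \<forall>h\<in>set hs. h x}" using finite_X by simp
  then show ?thesis
    using sat_count_correct[OF solver, of "conj_all F hs" S 0 T] T_gt unfolding eq by simp
qed

lemma conj_all_append: "conj_all (conj_all F hs) [h] = conj_all F (hs @ [h])"
  by (auto simp: conj_all_def fun_eq_iff)

lemma sat_count_calls: "snd (sat_count solve S T G 0) \<le> nat \<lceil>T\<rceil>"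
proof -
  have "proj_Sol V \<Gamma> G S \<subseteq> (\<Pi>\<^sub>E v\<in>S. carrier_of (\<Gamma> v))"
  proof
    fix x assume "x \<in> proj_Sol V \<Gamma> G S"
    then obtain \<tau> where "\<tau> \<in> (\<Pi>\<^sub>E v\<in>V. carrier_of (\<Gamma> v))" "x = restrict \<tau> S"
      unfolding proj_Sol_def Sol_def by auto
    then show "x \<in> (\<Pi>\<^sub>E v\<in>S. carrier_of (\<Gamma> v))" using S_sub by (auto simp: PiE_def Pi_def)
  qed
  then have "finite (proj_Sol V \<Gamma> G S)"
    by (rule finite_subset) (use finite_S carrier_bv in \<open>auto intro!: finite_PiE\<close>)
  then show ?thesis using sat_count_correct[OF solver, of G S 0 T] T_gt by simp
qed

definition cell_card :: "('v, 'a) formula list \<Rightarrow> nat" where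
  "cell_card hs = card {x\<in>X. \<forall>h\<in>set hs. h x}"

lemma saturating_count:
  assumes "set hs \<subseteq> (\<Union>l. set_pmf (Hash l))"
  shows "saturating_count (\<lambda>k. sat_count solve S T (conj_all F (take k hs)) 0)
    (\<lambda>k. cell_card (take k hs)) T (nat \<lceil>T\<rceil>)"
proof
  fix k
  have "set (take k hs) \<subseteq> (\<Union>l. set_pmf (Hash l))" using assms set_take_subset by (rule subset_trans[rotated])
  then show "fst (sat_count solve S T (conj_all F (take k hs)) 0) =
      (if real (cell_card (take k hs)) < T then Some (cell_card (take k hs)) else None)"
    unfolding cell_card_def by (rule sat_count_cell)
  show "snd (sat_count solve S T (conj_all F (take k hs)) 0) \<le> nat \<lceil>T\<rceil>" by (rule sat_count_calls)
qed

definition search :: "('v, 'a) formula list \<Rightarrow> (nat \<times> nat) option \<times> nat" where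
  "search hs = gallop (\<lambda>k. sat_count solve S T (conj_all F (take k hs)) 0) N 0 1"

text \<open>Saturation of the empty conjunction starts the search and also gives
  \<open>1 \<le> N\<close>, since a single point is not saturated. The result is written
  \<open>Suc k\<close> because the refinement works on top of the first \<open>k\<close>
  constraints.\<close>

lemma search_cases:
  assumes hs: "set hs \<subseteq> (\<Union>l. set_pmf (Hash l))" and big: "T \<le> real (card X)"
  obtains k where "fst (search hs) = Some (Suc k, cell_card (take (Suc k) hs))" "Suc k \<le> N"
      "real (cell_card (take (Suc k) hs)) < T" "T \<le> real (cell_card (take k hs))"
    | "fst (search hs) = None" "T \<le> real (cell_card (take N hs))"
proof -
  interpret saturating_count "\<lambda>k. sat_count solve S T (conj_all F (take k hs)) 0"
      "\<lambda>k. cell_card (take k hs)" T "nat \<lceil>T\<rceil>"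
    by (rule saturating_count[OF hs])
  have "N \<noteq> 0"
  proof
    assume "N = 0"
    then have "card X \<le> 1" using card_X by simp
    then show False using big T_gt by simp
  qed
  then have N: "1 \<le> N" by simp
  have "T \<le> real (cell_card (take 0 hs))" using big by (simp add: cell_card_def)
  from gallop_correct[OF this zero_less_one N] show ?thesis
  proof (elim disjE exE conjE)
    fix k assume k: "fst (gallop (\<lambda>k. sat_count solve S T (conj_all F (take k hs)) 0) N 0 1) = Some (k, cell_card (take k hs))"
      "first_below k" "k \<le> N"
    then obtain k' where "k = Suc k'" by (cases k) (auto simp: first_below_def)
    then show ?thesis using k that(1)[of k'] by (simp add: search_def first_below_def)
  qed (use that(2) in \<open>auto simp: search_def\<close>)
qed

lemma pact_iteration_eq:
  "pact_iteration fam solve \<Gamma> S T F = do {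
     hs \<leftarrow> replicate_pmf N (Hash (init_range_param fam));
     case search hs of
       (None, q) \<Rightarrow> return_pmf (None, q)
     | (Some (k, n), q) \<Rightarrow>
         map_pmf (\<lambda>((n', m), q'). (Some (n' * (range_size fam (init_range_param fam) ^ (k - 1) * m)), q + q'))
           (refine fam solve \<Gamma> S T (conj_all F (take (k - 1) hs)) (init_range_param fam) n) }"
  unfolding pact_iteration_def search_def Let_def ..

definition est_low :: "nat option \<Rightarrow> bool" where
  "est_low r \<longleftrightarrow> (case r of None \<Rightarrow> True | Some n \<Rightarrow> real n < real (card X) / (1 + \<epsilon>))"

definition est_high :: "nat option \<Rightarrow> bool" where
  "est_high r \<longleftrightarrow> (case r of None \<Rightarrow> True | Some n \<Rightarrow> (1 + \<epsilon>) * real (card X) < real n)"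

lemma est_low_mult:
  assumes "m > 0"
  shows "est_low (Some (n * m)) \<longleftrightarrow> real n < (1 - \<gamma>) * (real (card X) / real m)"
proof -
  have "real n * real m < real (card X) / (1 + \<epsilon>) \<longleftrightarrow> real n < real (card X) / (1 + \<epsilon>) / real m"
    using assms by (simp only: pos_less_divide_eq of_nat_0_less_iff)
  then show ?thesis unfolding one_minus_\<gamma> by (simp add: est_low_def mult.commute)
qed

lemma est_high_mult:
  assumes "m > 0"
  shows "est_high (Some (n * m)) \<longleftrightarrow> real (card X) / real m / (1 - \<gamma>) < real n"
proof -
  have "(1 + \<epsilon>) * real (card X) < real n * real m \<longleftrightarrow> (1 + \<epsilon>) * real (card X) / real m < real n"
    using assms by (simp only: pos_divide_less_eq of_nat_0_less_iff)
  then show ?thesis unfolding one_minus_\<gamma> by (simp add: est_high_def mult.commute)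
qed

lemma set_replicate_Hash:
  assumes "hs \<in> set_pmf (replicate_pmf N (Hash l))"
  shows "set hs \<subseteq> (\<Union>l. set_pmf (Hash l))"
  using assms by (auto simp: set_replicate_pmf lists_eq_set)

lemma hashing: 
  assumes "1 \<le> l" "2 \<le> range_size fam l" "T \<le> real (card X)"
  shows "hashing X (Hash l) (range_size fam l) N \<gamma>"
  using assms finite_X card_X Hash_sieve[of l] \<gamma>_bounds by unfold_locales (auto simp: T_eq)

end

subsection \<open>XOR\<close>

text \<open>For XOR the range parameter starts at 1, so the refinement stops at once and an
  iteration is a deterministic function of the search hashes.\<close>

lemma (in pact_run) iteration_XOR:
  assumes fam: "fam = XOR" and big: "T \<le> real (card X)"
  shows "measure_pmf.prob (pact_iteration fam solve \<Gamma> S T F) {p. est_low (fst p)} \<le> 36/100"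
    "measure_pmf.prob (pact_iteration fam solve \<Gamma> S T F) {p. est_high (fst p)} \<le> 36/100"
proof -
  interpret H: hashing X "Hash 1" "range_size fam 1" N \<gamma>
    using big fam by (intro hashing) auto
  define out where "out hs = (case search hs of (None, q) \<Rightarrow> (None, q)
      | (Some (k, n), q) \<Rightarrow> (Some (n * 2 ^ k), q))" for hs
  have "pact_iteration fam solve \<Gamma> S T F = bind_pmf (replicate_pmf N (Hash 1)) (\<lambda>hs. return_pmf (out hs))"
    unfolding pact_iteration_eq
  proof (intro bind_pmf_cong)
    fix hs assume "hs \<in> set_pmf (replicate_pmf N (Hash 1))"
    from search_cases[OF set_replicate_Hash[OF this] big]
    show "(case search hs of (None, q) \<Rightarrow> return_pmf (None, q)
       | (Some (k, n), q) \<Rightarrow>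
         map_pmf (\<lambda>((n', m), q'). (Some (n' * (range_size fam (init_range_param fam) ^ (k - 1) * m)), q + q'))
           (refine fam solve \<Gamma> S T (conj_all F (take (k - 1) hs)) (init_range_param fam) n)) = return_pmf (out hs)"
    proof cases
      case (1 k)
      then show ?thesis by (cases "search hs") (simp add: out_def fam refine.simps mult.commute)
    next
      case 2
      then show ?thesis by (cases "search hs") (simp add: out_def)
    qed
  qed (simp add: fam)
  then have eq: "pact_iteration fam solve \<Gamma> S T F = map_pmf out (replicate_pmf N (Hash 1))"
    by (simp add: map_pmf_def)
  have A: "real (cell_card (take k hs)) = H.A hs k" for hs k
    by (simp add: cell_card_def H.A_def)
  have cases: "H.T \<le> H.A hs N \<and> fst (out hs) = None \<or>
      (\<exists>k. H.first_unsat hs k \<and> fst (out hs) = Some (cell_card (take k hs) * 2 ^ k))"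
    if "hs \<in> set_pmf (replicate_pmf N (Hash 1))" for hs
    using search_cases[OF set_replicate_Hash[OF that] big]
  proof cases
    case (1 k)
    then have "H.first_unsat hs (Suc k)" by (simp add: H.first_unsat_def T_eq flip: A)
    moreover have "fst (out hs) = Some (cell_card (take (Suc k) hs) * 2 ^ Suc k)"
      using 1(1) by (cases "search hs") (simp add: out_def)
    ultimately show ?thesis by blast
  next
    case 2
    then show ?thesis by (cases "search hs") (simp add: out_def T_eq flip: A)
  qed
  have r: "range_size fam 1 = 2" using fam by simp
  have "measure_pmf.prob (replicate_pmf N (Hash 1)) {hs. est_low (fst (out hs))} \<le>
      measure_pmf.prob (replicate_pmf N (Hash 1)) {hs. H.bad_low hs}"
  proof (rule prob_mono_support)
    fix hs assume "hs \<in> set_pmf (replicate_pmf N (Hash 1))" and low: "est_low (fst (out hs))"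
    from cases[OF this(1)] show "H.bad_low hs"
    proof (elim disjE exE conjE)
      fix k assume k: "H.first_unsat hs k" "fst (out hs) = Some (cell_card (take k hs) * 2 ^ k)"
      then have "H.A hs k < (1 - \<gamma>) * (real (card X) / real (range_size fam 1) ^ k)"
        using low unfolding k(2) A[symmetric] by (subst (asm) est_low_mult) (auto simp: r[unfolded One_nat_def])
      with k(1) show ?thesis unfolding H.bad_low_def by blast
    qed (unfold H.bad_low_def, blast)
  qed
  also have "\<dots> \<le> 36/100" by (rule H.iteration_bad_XOR(1)[OF r])
  finally show "measure_pmf.prob (pact_iteration fam solve \<Gamma> S T F) {p. est_low (fst p)} \<le> 36/100"
    unfolding eq by (simp add: vimage_def)
  have "measure_pmf.prob (replicate_pmf N (Hash 1)) {hs. est_high (fst (out hs))} \<le>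
      measure_pmf.prob (replicate_pmf N (Hash 1)) {hs. H.bad_high hs}"
  proof (rule prob_mono_support)
    fix hs assume "hs \<in> set_pmf (replicate_pmf N (Hash 1))" and high: "est_high (fst (out hs))"
    from cases[OF this(1)] show "H.bad_high hs"
    proof (elim disjE exE conjE)
      fix k assume k: "H.first_unsat hs k" "fst (out hs) = Some (cell_card (take k hs) * 2 ^ k)"
      then have "real (card X) / real (range_size fam 1) ^ k / (1 - \<gamma>) < H.A hs k"
        using high unfolding k(2) A[symmetric] by (subst (asm) est_high_mult) (auto simp: r[unfolded One_nat_def])
      with k(1) show ?thesis unfolding H.bad_high_def by blast
    qed (unfold H.bad_high_def, blast)
  qed
  also have "\<dots> \<le> 36/100" by (rule H.iteration_bad_XOR(2)[OF r])
  finally show "measure_pmf.prob (pact_iteration fam solve \<Gamma> S T F) {p. est_high (fst p)} \<le> 36/100"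
    unfolding eq by (simp add: vimage_def)
qed

subsection \<open>Families with refinement\<close>

text \<open>The refinement draws its hashes lazily. Drawing both in advance leaves the distribution
  unchanged and makes an iteration a function \<open>out\<close> on the product space for which the
  probability bounds are stated.\<close>

lemma (in pact_run) iteration_refined:
  assumes fam: "fam \<noteq> XOR" and big: "T \<le> real (card X)"
  shows "measure_pmf.prob (pact_iteration fam solve \<Gamma> S T F) {p. est_low (fst p)} \<le> 378/1000"
    "measure_pmf.prob (pact_iteration fam solve \<Gamma> S T F) {p. est_high (fst p)} \<le> 378/1000"
proof -
  have init: "init_range_param fam = 4" using fam by (cases fam) auto
  define r r2 r1 where "r = range_size fam 4" and "r2 = range_size fam 2" and "r1 = range_size fam 1"
  have ranges: "(r = 16 \<and> r2 = 4 \<and> r1 = 2) \<or> (r = 17 \<and> r2 = 5 \<and> r1 = 3)"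
    using fam by (cases fam) (auto simp: r_def r2_def r1_def next_prime_2 next_prime_4 next_prime_16)
  interpret H0: hashing X "Hash 4" r N \<gamma>
    unfolding r_def using big ranges by (intro hashing) (auto simp: r_def)
  interpret H: refined_hashing X "Hash 4" r N \<gamma> "Hash 2" "Hash 1" r2 r1
    using ranges Hash_sieve by unfold_locales (auto simp: r2_def r1_def)
  let ?K = "pair_pmf (Hash 2) (Hash 1)"
  let ?\<Omega> = "pair_pmf (replicate_pmf N (Hash 4)) ?K"
  define cnt where "cnt hs k h = sat_count solve S T (conj_all (conj_all F (take k hs)) [h]) 0"
    for hs k and h :: "('v, 'a) formula"
  define out where "out \<omega> = (case search (fst \<omega>) of (None, q) \<Rightarrow> (None, q)
      | (Some (k, n), q) \<Rightarrow> (case cnt (fst \<omega>) (k - 1) (fst (snd \<omega>)) of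
          (None, q2) \<Rightarrow> (Some (n * (r ^ (k - 1) * r)), q + q2)
        | (Some n2, q2) \<Rightarrow> (case cnt (fst \<omega>) (k - 1) (snd (snd \<omega>)) of
            (None, q1) \<Rightarrow> (Some (n2 * (r ^ (k - 1) * r2)), q + (q2 + q1))
          | (Some n1, q1) \<Rightarrow> (Some (n1 * (r ^ (k - 1) * r1)), q + (q2 + q1)))))" for \<omega>
  have refine1: "refine fam solve \<Gamma> S T G 1 n = return_pmf ((n, r1), 0)" for G n
    by (subst refine.simps) (simp add: r1_def)
  have refine2: "refine fam solve \<Gamma> S T G 2 n = do {
      h1 \<leftarrow> Hash 1;
      return_pmf (case sat_count solve S T (conj_all G [h1]) 0 of
          (None, q) \<Rightarrow> ((n, r2), q) | (Some n', q) \<Rightarrow> ((n', r1), q))}" for G n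
    by (subst refine.simps)
       (auto simp: refine1[unfolded One_nat_def] r2_def intro!: bind_pmf_cong split: prod.split option.split)
  \<comment> \<open>The hash of range parameter 1 is drawn also on the branch that returns without
    reading it.\<close>
  have refine4: "refine fam solve \<Gamma> S T G 4 n = do {
      h2 \<leftarrow> Hash 2; h1 \<leftarrow> Hash 1;
      return_pmf (case sat_count solve S T (conj_all G [h2]) 0 of
          (None, q) \<Rightarrow> ((n, r), q)
        | (Some n2, q) \<Rightarrow> (case sat_count solve S T (conj_all G [h1]) 0 of
            (None, q') \<Rightarrow> ((n2, r2), q + q') | (Some n1, q') \<Rightarrow> ((n1, r1), q + q')))}" for G n
  proof -
    have "refine fam solve \<Gamma> S T G 4 n = do {
        h2 \<leftarrow> Hash 2;
        case sat_count solve S T (conj_all G [h2]) 0 of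
          (None, q) \<Rightarrow> return_pmf ((n, r), q)
        | (Some n', q) \<Rightarrow> map_pmf (\<lambda>(r, q'). (r, q + q')) (refine fam solve \<Gamma> S T G 2 n')}"
    proof -
      have half: "(4::nat) div 2 = 2" by simp
      show ?thesis unfolding refine.simps[of fam solve \<Gamma> S T G 4 n] half r_def by simp
    qed
    also have "\<dots> = do {
      h2 \<leftarrow> Hash 2; h1 \<leftarrow> Hash 1;
      return_pmf (case sat_count solve S T (conj_all G [h2]) 0 of
          (None, q) \<Rightarrow> ((n, r), q)
        | (Some n2, q) \<Rightarrow> (case sat_count solve S T (conj_all G [h1]) 0 of
            (None, q') \<Rightarrow> ((n2, r2), q + q') | (Some n1, q') \<Rightarrow> ((n1, r1), q + q')))}"
      by (intro bind_pmf_cong refl)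
         (auto simp: refine2 map_bind_pmf intro!: bind_pmf_cong split: prod.split option.split)
    finally show ?thesis .
  qed
  have eq: "pact_iteration fam solve \<Gamma> S T F = map_pmf out ?\<Omega>"
  proof -
    have "pact_iteration fam solve \<Gamma> S T F = do {
        hs \<leftarrow> replicate_pmf N (Hash 4); h2 \<leftarrow> Hash 2; h1 \<leftarrow> Hash 1; return_pmf (out (hs, h2, h1))}"
      unfolding pact_iteration_eq init r_def[symmetric]
      by (intro bind_pmf_cong refl)
         (auto simp: refine4 map_bind_pmf out_def cnt_def intro!: bind_pmf_cong split: prod.split option.split)
    then show ?thesis by (simp add: map_pmf_def pair_pmf_def bind_assoc_pmf bind_return_pmf)
  qed
  define cC where "cC \<omega> k = cell_card (take k (fst \<omega>) @ [fst (snd \<omega>)])"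
    for \<omega> :: "('v, 'a) formula list \<times> ('v, 'a) formula \<times> ('v, 'a) formula" and k
  define cD where "cD \<omega> k = cell_card (take k (fst \<omega>) @ [snd (snd \<omega>)])"
    for \<omega> :: "('v, 'a) formula list \<times> ('v, 'a) formula \<times> ('v, 'a) formula" and k
  have A: "real (cell_card (take k hs)) = H0.A hs k" for hs k
    by (simp add: cell_card_def H0.A_def)
  have set_eq: "{x\<in>X. \<forall>h\<in>set (hs @ [g]). h x} = {x\<in>X. (\<forall>h\<in>set hs. h x) \<and> g x}" for hs and g :: "('v, 'a) formula"
    by auto
  have C: "real (cC \<omega> k) = H.C \<omega> k" and D: "real (cD \<omega> k) = H.D \<omega> k" for \<omega> k
    unfolding cC_def cD_def cell_card_def set_eq H.C_def H.D_def by simp_all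
  have cases: "H0.T \<le> H0.A (fst \<omega>) N \<and> fst (out \<omega>) = None \<or>
      (\<exists>k. H0.first_unsat (fst \<omega>) (Suc k) \<and>
        (H0.T \<le> H.C \<omega> k \<and> fst (out \<omega>) = Some (cell_card (take (Suc k) (fst \<omega>)) * (r ^ Suc k)) \<or>
         H0.T \<le> H.D \<omega> k \<and> H.C \<omega> k < H0.T \<and> fst (out \<omega>) = Some (cC \<omega> k * (r ^ k * r2)) \<or>
         H.D \<omega> k < H0.T \<and> fst (out \<omega>) = Some (cD \<omega> k * (r ^ k * r1))))"
    if \<omega>: "\<omega> \<in> set_pmf ?\<Omega>" for \<omega>
  proof -
    have hs: "set (fst \<omega>) \<subseteq> (\<Union>l. set_pmf (Hash l))"
      using \<omega> by (intro set_replicate_Hash[of _ 4]) auto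
    have cnt: "fst (cnt (fst \<omega>) k g) = (if real (cell_card (take k (fst \<omega>) @ [g])) < T
        then Some (cell_card (take k (fst \<omega>) @ [g])) else None)"
      if g: "g \<in> (\<Union>l. set_pmf (Hash l))" for k g
    proof -
      have "set (take k (fst \<omega>)) \<subseteq> (\<Union>l. set_pmf (Hash l))"
        using set_take_subset hs by (rule subset_trans)
      then have "set (take k (fst \<omega>) @ [g]) \<subseteq> (\<Union>l. set_pmf (Hash l))" using g by simp
      from sat_count_cell[OF this] show ?thesis
        unfolding cnt_def conj_all_append cell_card_def .
    qed
    have g: "fst (snd \<omega>) \<in> (\<Union>l. set_pmf (Hash l))" "snd (snd \<omega>) \<in> (\<Union>l. set_pmf (Hash l))"
      using \<omega> by auto
    note cntC = cnt[OF g(1), folded cC_def] and cntD = cnt[OF g(2), folded cD_def]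
    show ?thesis
      using search_cases[OF hs big]
    proof cases
      case (1 k)
      then have first: "H0.first_unsat (fst \<omega>) (Suc k)" by (simp add: H0.first_unsat_def T_eq flip: A)
      obtain q where q: "search (fst \<omega>) = (Some (Suc k, cell_card (take (Suc k) (fst \<omega>))), q)"
        using 1(1) by (cases "search (fst \<omega>)") auto
      obtain c2 q2 where c2: "cnt (fst \<omega>) k (fst (snd \<omega>)) = (c2, q2)" by fastforce
      obtain c1 q1 where c1: "cnt (fst \<omega>) k (snd (snd \<omega>)) = (c1, q1)" by fastforce
      show ?thesis
      proof (cases "real (cC \<omega> k) < T")
        case False
        then have "fst (out \<omega>) = Some (cell_card (take (Suc k) (fst \<omega>)) * (r ^ Suc k))"
          using cntC[of k] c2 by (simp add: out_def q mult.commute)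
        moreover have "H0.T \<le> H.C \<omega> k" using False by (simp add: T_eq flip: C)
        ultimately show ?thesis using first by blast
      next
        case True
        note c2' = True
        show ?thesis
        proof (cases "real (cD \<omega> k) < T")
          case False
          then have "fst (out \<omega>) = Some (cC \<omega> k * (r ^ k * r2))"
            using cntC[of k] cntD[of k] c2 c1 True by (simp add: out_def q)
          moreover have "H0.T \<le> H.D \<omega> k" "H.C \<omega> k < H0.T" using False True by (simp_all add: T_eq flip: C D)
          ultimately show ?thesis using first by blast
        next
          case True
          then have "fst (out \<omega>) = Some (cD \<omega> k * (r ^ k * r1))"
            using cntC[of k] cntD[of k] c2 c1 c2' by (simp add: out_def q)
          moreover have "H.D \<omega> k < H0.T" using True by (simp_all add: T_eq flip: D)
          ultimately show ?thesis using first by blast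
        qed
      qed
    next
      case 2
      then show ?thesis by (cases "search (fst \<omega>)") (simp add: out_def T_eq flip: A)
    qed
  qed
  have pos: "r > 0" "r2 > 0" "r1 > 0" using ranges by auto
  have "measure_pmf.prob ?\<Omega> {\<omega>. est_low (fst (out \<omega>))} \<le> measure_pmf.prob ?\<Omega> {\<omega>. H.bad_low_refined \<omega>}"
  proof (rule prob_mono_support)
    fix \<omega> assume \<omega>: "\<omega> \<in> set_pmf ?\<Omega>" and low: "est_low (fst (out \<omega>))"
    have e: "fst (out \<omega>) = Some (n * m) \<Longrightarrow> 0 < m \<Longrightarrow> real n < (1 - \<gamma>) * (real (card X) / real m)" for n m
      using low est_low_mult[of m n] by simp
    have e1: "fst (out \<omega>) = Some (cell_card (take (Suc k) (fst \<omega>)) * (r ^ Suc k)) \<Longrightarrow>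
        H0.A (fst \<omega>) (Suc k) < (1 - \<gamma>) * (real (card X) / real r ^ Suc k)" for k
      using e[of "cell_card (take (Suc k) (fst \<omega>))" "r ^ Suc k"] pos unfolding A by simp
    have e2: "fst (out \<omega>) = Some (cC \<omega> k * (r ^ k * r2)) \<Longrightarrow>
        H.C \<omega> k < (1 - \<gamma>) * (real (card X) / (real r ^ k * real r2))" for k
      using e[of "cC \<omega> k" "r ^ k * r2"] pos unfolding C by simp
    have e3: "fst (out \<omega>) = Some (cD \<omega> k * (r ^ k * r1)) \<Longrightarrow>
        H.D \<omega> k < (1 - \<gamma>) * (real (card X) / (real r ^ k * real r1))" for k
      using e[of "cD \<omega> k" "r ^ k * r1"] pos unfolding D by simp
    from cases[OF \<omega>] show "H.bad_low_refined \<omega>"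
      unfolding H.bad_low_refined_def using e1 e2 e3 by blast
  qed
  also have "\<dots> \<le> 378/1000" by (rule H.iteration_bad(1))
  finally show "measure_pmf.prob (pact_iteration fam solve \<Gamma> S T F) {p. est_low (fst p)} \<le> 378/1000"
    unfolding eq by (simp add: vimage_def)
  have "measure_pmf.prob ?\<Omega> {\<omega>. est_high (fst (out \<omega>))} \<le> measure_pmf.prob ?\<Omega> {\<omega>. H.bad_high_refined \<omega>}"
  proof (rule prob_mono_support)
    fix \<omega> assume \<omega>: "\<omega> \<in> set_pmf ?\<Omega>" and high: "est_high (fst (out \<omega>))"
    have e: "fst (out \<omega>) = Some (n * m) \<Longrightarrow> 0 < m \<Longrightarrow> real (card X) / real m / (1 - \<gamma>) < real n" for n m
      using high est_high_mult[of m n] by simp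
    have e1: "fst (out \<omega>) = Some (cell_card (take (Suc k) (fst \<omega>)) * (r ^ Suc k)) \<Longrightarrow>
        real (card X) / real r ^ Suc k / (1 - \<gamma>) < H0.A (fst \<omega>) (Suc k)" for k
      using e[of "cell_card (take (Suc k) (fst \<omega>))" "r ^ Suc k"] pos unfolding A by simp
    have e2: "fst (out \<omega>) = Some (cC \<omega> k * (r ^ k * r2)) \<Longrightarrow>
        real (card X) / (real r ^ k * real r2) / (1 - \<gamma>) < H.C \<omega> k" for k
      using e[of "cC \<omega> k" "r ^ k * r2"] pos unfolding C by simp
    have e3: "fst (out \<omega>) = Some (cD \<omega> k * (r ^ k * r1)) \<Longrightarrow>
        real (card X) / (real r ^ k * real r1) / (1 - \<gamma>) < H.D \<omega> k" for k
      using e[of "cD \<omega> k" "r ^ k * r1"] pos unfolding D by simp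
    from cases[OF \<omega>] show "H.bad_high_refined \<omega>"
      unfolding H.bad_high_refined_def using e1 e2 e3 by blast
  qed
  also have "\<dots> \<le> 378/1000" by (rule H.iteration_bad(2))
  finally show "measure_pmf.prob (pact_iteration fam solve \<Gamma> S T F) {p. est_high (fst p)} \<le> 378/1000"
    unfolding eq by (simp add: vimage_def)
qed

section \<open>Median amplification\<close>

lemma map_map_replicate_pmf: "map_pmf (map f) (replicate_pmf n p) = replicate_pmf n (map_pmf f p)"
proof (induction n)
  case (Suc n)
  have "map_pmf (map f) (replicate_pmf (Suc n) p) =
      do {x \<leftarrow> p; xs \<leftarrow> map_pmf (map f) (replicate_pmf n p); return_pmf (f x # xs)}"
    by (simp add: map_pmf_def bind_assoc_pmf bind_return_pmf)
  also have "\<dots> = replicate_pmf (Suc n) (map_pmf f p)"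
    unfolding Suc by (simp add: map_pmf_def bind_assoc_pmf bind_return_pmf)
  finally show ?case .
qed simp

lemma expectation_replicate_pmf_prod_list:
  fixes w :: "'a \<Rightarrow> real"
  assumes "finite (set_pmf p)"
  shows "measure_pmf.expectation (replicate_pmf n p) (\<lambda>xs. prod_list (map w xs)) =
    measure_pmf.expectation p w ^ n"
proof (induction n)
  case (Suc n)
  have "replicate_pmf (Suc n) p = map_pmf (\<lambda>q. fst q # snd q) (pair_pmf p (replicate_pmf n p))"
    by (simp add: pair_pmf_def map_bind_pmf)
  then have "measure_pmf.expectation (replicate_pmf (Suc n) p) (\<lambda>xs. prod_list (map w xs)) =
      measure_pmf.expectation (pair_pmf p (replicate_pmf n p)) (\<lambda>q. w (fst q) * prod_list (map w (snd q)))"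
    by simp
  also have "\<dots> = measure_pmf.expectation p
      (\<lambda>x. measure_pmf.expectation (replicate_pmf n p) (\<lambda>xs. w x * prod_list (map w xs)))"
    using assms by (simp add: expectation_pair_pmf_finite finite_set_replicate_pmf)
  also have "\<dots> = measure_pmf.expectation p w ^ Suc n"
    using Suc by simp
  finally show ?case .
qed simp

text \<open>The product is \<open>a\<close> to the excess of true over false entries.\<close>

lemma prod_list_bool_weight:
  fixes a :: real
  assumes "1 \<le> a" "length bs \<le> 2 * length (filter id bs)"
  shows "1 \<le> prod_list (map (\<lambda>b. if b then a else 1 / a) bs)"
proof -
  have eq: "prod_list (map (\<lambda>b. if b then a else 1 / a) bs) * a ^ length (filter Not bs) = a ^ length (filter id bs)"
    using assms(1) by (induction bs) (auto simp: field_simps)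
  have "length (filter id bs) + length (filter Not bs) = length bs"
    using sum_length_filter_compl[of id bs] by (simp add: id_def)
  then have "length (filter Not bs) \<le> length (filter id bs)" using assms(2) by simp
  then have "1 * a ^ length (filter Not bs) \<le> prod_list (map (\<lambda>b. if b then a else 1 / a) bs) * a ^ length (filter Not bs)"
    unfolding eq using assms(1) by (simp add: power_increasing)
  then show ?thesis by (rule mult_right_le_imp_le) (use assms(1) in simp)
qed

text \<open>Chernoff bound: the indicator of a bad majority, ties included, is dominated by the
  product of weights, whose expectation factorises over the independent draws.\<close>

lemma prob_majority_le:
  assumes p: "measure_pmf.prob p {x. P x} \<le> u" and a: "1 \<le> a"
  shows "measure_pmf.prob (replicate_pmf n p) {xs. n \<le> 2 * length (filter P xs)} \<le> (u * a + (1 - u) / a) ^ n"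
proof -
  define q where "q = map_pmf P p"
  have fin: "finite (set_pmf q)" by (rule finite_subset[of _ UNIV]) auto
  have len: "length (filter P xs) = length (filter id (map P xs))" for xs
    by (simp add: filter_map o_def)
  let ?w = "\<lambda>b. if b then a else 1 / a"
  have qT: "pmf q True = measure_pmf.prob p {x. P x}"
    unfolding q_def pmf_map by (simp add: vimage_def)
  have "measure_pmf.prob (replicate_pmf n p) {xs. n \<le> 2 * length (filter P xs)} =
      measure_pmf.prob (map_pmf (map P) (replicate_pmf n p)) {bs. n \<le> 2 * length (filter id bs)}"
    unfolding measure_map_pmf vimage_def len by simp
  also have "\<dots> = measure_pmf.expectation (replicate_pmf n q) (\<lambda>bs. of_bool (n \<le> 2 * length (filter id bs)))"
    unfolding map_map_replicate_pmf q_def[symmetric] by (rule prob_eq_expectation_of_bool)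
  also have "\<dots> \<le> measure_pmf.expectation (replicate_pmf n q) (\<lambda>bs. prod_list (map ?w bs))"
  proof (rule integral_mono_AE)
    show "AE bs in measure_pmf (replicate_pmf n q). of_bool (n \<le> 2 * length (filter id bs)) \<le> prod_list (map ?w bs)"
    proof (rule AE_pmfI)
      fix bs assume "bs \<in> set_pmf (replicate_pmf n q)"
      then have "length bs = n" by (simp add: set_replicate_pmf)
      moreover have "0 \<le> prod_list (map ?w bs)" using a by (intro prod_list_nonneg) auto
      ultimately show "of_bool (n \<le> 2 * length (filter id bs)) \<le> prod_list (map ?w bs)"
        using prod_list_bool_weight[OF a, of bs] by simp
    qed
  qed (auto intro!: integrable_measure_pmf_finite finite_set_replicate_pmf fin)
  also have "\<dots> = measure_pmf.expectation q ?w ^ n"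
    by (rule expectation_replicate_pmf_prod_list[OF fin])
  also have "measure_pmf.expectation q ?w = pmf q True * a + (1 - pmf q True) / a"
    by (subst integral_measure_pmf_real[of UNIV]) (auto simp: UNIV_bool pmf_False_conv_True)
  also have "(pmf q True * a + (1 - pmf q True) / a) ^ n \<le> (u * a + (1 - u) / a) ^ n"
  proof (rule power_mono)
    \<comment> \<open>The bound increases with the error probability, as
      \<open>a \<ge> 1 / a\<close>.\<close>
    have "0 \<le> (u - pmf q True) * (a - 1 / a)"
      using p a by (intro mult_nonneg_nonneg) (auto simp: qT divide_le_eq mult_le_one intro: order_trans)
    then show "pmf q True * a + (1 - pmf q True) / a \<le> u * a + (1 - u) / a"
      by (simp add: algebra_simps diff_divide_distrib)
    show "0 \<le> pmf q True * a + (1 - pmf q True) / a"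
      using a by (simp add: pmf_le_1)
  qed
  finally show ?thesis .
qed

text \<open>Every \<open>k\<close> draws halve the bound, and \<open>t\<close> draws contain at
  least \<open>L\<close> such blocks. With \<open>L = log 2 (3 / \<delta>)\<close> the result is
  \<open>\<delta> / 3\<close>.\<close>

lemma power_le_powr_log:
  fixes \<rho> L :: real
  assumes "0 < \<rho>" "\<rho> ^ k \<le> 1 / 2" "\<rho> \<le> 1" "real k * L \<le> real t" "0 \<le> L"
  shows "\<rho> ^ t \<le> 2 powr (- L)"
proof -
  have "\<rho> ^ t = \<rho> powr real t" using assms(1) by (simp add: powr_realpow)
  also have "\<dots> \<le> \<rho> powr (real k * L)" using assms by (intro powr_mono') auto
  also have "\<dots> = (\<rho> ^ k) powr L" using assms(1) by (simp add: powr_powr flip: powr_realpow)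
  also have "\<dots> \<le> (1 / 2) powr L" using assms by (intro powr_mono2) auto
  also have "(1 / 2) powr L = 1 powr L / (2::real) powr L" by (rule powr_divide)
  also have "\<dots> = 2 powr (- L)" by (simp add: powr_minus_divide)
  finally show ?thesis .
qed

section \<open>The median of the surviving estimates\<close>

text \<open>If the sorted list is below \<open>l\<close> at index \<open>i\<close>, then so are all
  \<open>i + 1\<close> entries up to there. With fewer than half of the entries below
  \<open>l\<close>, both middle entries reach it.\<close>

lemma median_ge:
  assumes "2 * length (filter (\<lambda>x. x < l) xs) < length xs"
  shows "l \<le> median xs"
proof -
  let ?ys = "sort xs" and ?n = "length xs"
  have ge: "l \<le> ?ys ! i" if i: "i < ?n" "length (filter (\<lambda>x. x < l) xs) \<le> i" for i
  proof (rule ccontr)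
    assume "\<not> l \<le> ?ys ! i"
    have "{..i} \<subseteq> {k. k < length ?ys \<and> ?ys ! k < l}"
    proof (intro subsetI CollectI conjI)
      fix k assume "k \<in> {..i}"
      then show "k < length ?ys" using i(1) by simp
      have "?ys ! k \<le> ?ys ! i" by (rule sorted_nth_mono) (use i(1) \<open>k \<in> {..i}\<close> in auto)
      then show "?ys ! k < l" using \<open>\<not> l \<le> ?ys ! i\<close> by simp
    qed
    then have "card {..i} \<le> card {k. k < length ?ys \<and> ?ys ! k < l}" by (rule card_mono[rotated]) simp
    also have "\<dots> = length (filter (\<lambda>x. x < l) ?ys)" by (rule length_filter_conv_card[symmetric])
    also have "\<dots> = length (filter (\<lambda>x. x < l) xs)" by (simp add: filter_sort)
    finally show False using i(2) by simp
  qed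
  have "xs \<noteq> []" using assms by auto
  moreover have "l \<le> ?ys ! ((?n - 1) div 2)" "l \<le> ?ys ! (?n div 2)"
    using assms by (auto intro!: ge)
  ultimately show ?thesis unfolding median_def by simp
qed

lemma median_le:
  assumes "2 * length (filter (\<lambda>x. u < x) xs) < length xs"
  shows "median xs \<le> u"
proof -
  let ?ys = "sort xs" and ?n = "length xs"
  have le: "?ys ! i \<le> u" if i: "i < ?n" "length (filter (\<lambda>x. u < x) xs) < ?n - i" for i
  proof (rule ccontr)
    assume "\<not> ?ys ! i \<le> u"
    have "{i..<?n} \<subseteq> {k. k < length ?ys \<and> u < ?ys ! k}"
    proof (intro subsetI CollectI conjI)
      fix k assume "k \<in> {i..<?n}"
      then show "k < length ?ys" by simp
      have "?ys ! i \<le> ?ys ! k" by (rule sorted_nth_mono) (use \<open>k \<in> {i..<?n}\<close> in auto)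
      then show "u < ?ys ! k" using \<open>\<not> ?ys ! i \<le> u\<close> by simp
    qed
    then have "card {i..<?n} \<le> card {k. k < length ?ys \<and> u < ?ys ! k}" by (rule card_mono[rotated]) simp
    also have "\<dots> = length (filter (\<lambda>x. u < x) ?ys)" by (rule length_filter_conv_card[symmetric])
    also have "\<dots> = length (filter (\<lambda>x. u < x) xs)" by (simp add: filter_sort)
    finally show False using i(2) by simp
  qed
  have "xs \<noteq> []" using assms by auto
  moreover have "?ys ! ((?n - 1) div 2) \<le> u" "?ys ! (?n div 2) \<le> u"
    using assms by (auto intro!: le)
  ultimately show ?thesis unfolding median_def by simp
qed

text \<open>A failed iteration is missing from the list of estimates but counts as bad; the identity
  reconciles the two counts.\<close>

lemma length_map_filter_count:
  fixes P :: "real \<Rightarrow> bool"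
  shows "length (filter (\<lambda>p. case fst p of None \<Rightarrow> True | Some n \<Rightarrow> P (real n)) rs) + length (List.map_filter fst rs) =
    length rs + length (filter P (map real (List.map_filter fst rs)))"
  by (induction rs) (auto simp: List.map_filter_simps split: option.splits)

lemma length_map_filter_le: "length (List.map_filter f xs) \<le> length xs"
  by (induction xs) (auto simp: List.map_filter_simps split: option.splits)

context pact_run
begin

text \<open>Dropping \<open>f\<close> failed iterations lowers both the number of bad entries and
  the length by \<open>f\<close>, so the bad ones remain a strict minority.\<close>

lemma median_estimate:
  assumes "2 * length (filter (\<lambda>p. est_low (fst p)) rs) < length rs"
    "2 * length (filter (\<lambda>p. est_high (fst p)) rs) < length rs"
  shows "real (card X) / (1 + \<epsilon>) \<le> median (map real (List.map_filter fst rs))"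
    "median (map real (List.map_filter fst rs)) \<le> (1 + \<epsilon>) * real (card X)"
proof -
  note n = length_map_filter_le[of fst rs]
  show "real (card X) / (1 + \<epsilon>) \<le> median (map real (List.map_filter fst rs))"
    using length_map_filter_count[of "\<lambda>x. x < real (card X) / (1 + \<epsilon>)" rs] n assms(1)
    by (intro median_ge) (simp add: est_low_def)
  show "median (map real (List.map_filter fst rs)) \<le> (1 + \<epsilon>) * real (card X)"
    using length_map_filter_count[of "\<lambda>x. (1 + \<epsilon>) * real (card X) < x" rs] n assms(2)
    by (intro median_le) (simp add: est_high_def)
qed

text \<open>
  The weights \<open>4/3\<close> and \<open>1.28\<close> approximate \<open>sqrt ((1 - u) / u)\<close>, which optimises the Chernoff bound for
  error probability \<open>u\<close>. With them, 17 and 23 iterations just suffice to halve the bound.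
\<close>

lemma prob_majority_bad:
  assumes \<delta>: "0 < \<delta>" "\<delta> < 1" and big: "T \<le> real (card X)"
  shows "measure_pmf.prob (replicate_pmf (num_iterations fam \<delta>) (pact_iteration fam solve \<Gamma> S T F))
      {rs. num_iterations fam \<delta> \<le> 2 * length (filter (\<lambda>p. est_low (fst p)) rs)} \<le> \<delta> / 3"
    "measure_pmf.prob (replicate_pmf (num_iterations fam \<delta>) (pact_iteration fam solve \<Gamma> S T F))
      {rs. num_iterations fam \<delta> \<le> 2 * length (filter (\<lambda>p. est_high (fst p)) rs)} \<le> \<delta> / 3"
proof -
  define t L where "t = num_iterations fam \<delta>" and "L = log 2 (3 / \<delta>)"
  have "1 \<le> 3 / \<delta>" using \<delta> by simp
  then have L: "0 \<le> L" unfolding L_def using \<delta> by (subst zero_le_log_cancel_iff) auto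
  have \<delta>3: "2 powr (- L) = \<delta> / 3" using \<delta> by (simp add: L_def powr_minus)
  obtain u a k where uak: "measure_pmf.prob (pact_iteration fam solve \<Gamma> S T F) {p. est_low (fst p)} \<le> u"
    "measure_pmf.prob (pact_iteration fam solve \<Gamma> S T F) {p. est_high (fst p)} \<le> u"
    "1 \<le> a" "(u * a + (1 - u) / a) ^ k \<le> 1 / 2" "u * a + (1 - u) / a \<le> 1" "0 < u * a + (1 - u) / a"
    "real k * L \<le> real t"
  proof (cases "fam = XOR")
    case True
    have "17 * L \<le> real t" using True L by (simp add: t_def L_def)
    \<comment> \<open>The base is \<open>0.48 + 0.48 = 0.96\<close>, and \<open>0.96 ^ 17\<close> is
      about 0.4996.\<close>
    moreover have "(36/100 * (4/3) + (1 - 36/100) / (4/3)) ^ 17 \<le> (1 / 2 :: real)" by (simp add: power_divide)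
    ultimately show ?thesis using iteration_XOR[OF True big] by (intro that[of "36/100" "4/3" 17]) auto
  next
    case False
    have "23 * L \<le> real t" using False L by (cases fam) (simp_all add: t_def L_def)
    moreover have "(378/1000 * (128/100) + (1 - 378/1000) / (128/100)) ^ 23 \<le> (1 / 2 :: real)" by (simp add: power_divide)
    ultimately show ?thesis using iteration_refined[OF False big] by (intro that[of "378/1000" "128/100" 23]) auto
  qed
  have bound: "(u * a + (1 - u) / a) ^ t \<le> \<delta> / 3"
    using power_le_powr_log[OF uak(6,4,5,7) L] unfolding \<delta>3 .
  show "measure_pmf.prob (replicate_pmf (num_iterations fam \<delta>) (pact_iteration fam solve \<Gamma> S T F))
      {rs. num_iterations fam \<delta> \<le> 2 * length (filter (\<lambda>p. est_low (fst p)) rs)} \<le> \<delta> / 3"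
    using prob_majority_le[OF uak(1,3), of t] bound unfolding t_def by linarith
  show "measure_pmf.prob (replicate_pmf (num_iterations fam \<delta>) (pact_iteration fam solve \<Gamma> S T F))
      {rs. num_iterations fam \<delta> \<le> 2 * length (filter (\<lambda>p. est_high (fst p)) rs)} \<le> \<delta> / 3"
    using prob_majority_le[OF uak(2,3), of t] bound unfolding t_def by linarith
qed

lemma sat_count_F:
  "fst (sat_count solve S T F 0) = (if real (card X) < T then Some (card X) else None)"
  using sat_count_correct[OF solver finite_X, of 0 T] T_gt by simp

lemma pact_correct:
  assumes \<delta>: "0 < \<delta>" "\<delta> < 1"
  shows "1 - \<delta> \<le> measure_pmf.prob (pact fam solve \<Gamma> F S \<epsilon> \<delta>)
    {(est, calls). real (card X) / (1 + \<epsilon>) \<le> est \<and> est \<le> (1 + \<epsilon>) * real (card X)}"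
proof (cases "real (card X) < T")
  case True
  then obtain q where q: "sat_count solve S T F 0 = (Some (card X), q)"
    using sat_count_F by (cases "sat_count solve S T F 0") auto
  have "real (card X) * 1 \<le> real (card X) * (1 + \<epsilon>)" using \<epsilon>_pos by (intro mult_left_mono) auto
  then have "real (card X) / (1 + \<epsilon>) \<le> real (card X)" "real (card X) \<le> (1 + \<epsilon>) * real (card X)"
    using \<epsilon>_pos by (auto simp: divide_le_eq mult.commute)
  then show ?thesis unfolding pact_def q using \<delta> by (simp add: indicator_def)
next
  case False
  then obtain q where q: "sat_count solve S T F 0 = (None, q)"
    using sat_count_F by (cases "sat_count solve S T F 0") auto
  define R where "R = replicate_pmf (num_iterations fam \<delta>) (pact_iteration fam solve \<Gamma> S T F)"
  let ?t = "num_iterations fam \<delta>"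
  define out where "out rs = (median (map real (List.map_filter fst rs)), q + sum_list (map snd rs))"
    for rs :: "(nat option \<times> nat) list"
  define good where "good rs \<longleftrightarrow> real (card X) / (1 + \<epsilon>) \<le> fst (out rs) \<and> fst (out rs) \<le> (1 + \<epsilon>) * real (card X)" for rs
  have pact: "pact fam solve \<Gamma> F S \<epsilon> \<delta> = map_pmf out R"
    unfolding pact_def q R_def out_def by (simp add: map_pmf_def)
  have "measure_pmf.prob R {rs. \<not> good rs} \<le> measure_pmf.prob R
      {rs. ?t \<le> 2 * length (filter (\<lambda>p. est_low (fst p)) rs) \<or> ?t \<le> 2 * length (filter (\<lambda>p. est_high (fst p)) rs)}"
  proof (rule prob_mono_support)
    fix rs assume "rs \<in> set_pmf R" and bad: "\<not> good rs"
    then have "length rs = ?t" by (simp add: R_def set_replicate_pmf)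
    then show "?t \<le> 2 * length (filter (\<lambda>p. est_low (fst p)) rs) \<or> ?t \<le> 2 * length (filter (\<lambda>p. est_high (fst p)) rs)"
      using median_estimate[of rs] bad unfolding good_def out_def fst_conv by linarith
  qed
  also have "\<dots> \<le> \<delta> / 3 + \<delta> / 3"
    unfolding R_def using False by (intro prob_disj_le prob_majority_bad \<delta>) auto
  finally have "measure_pmf.prob R {rs. \<not> good rs} \<le> \<delta>" using \<delta> by simp
  moreover have "measure_pmf.prob R {rs. \<not> good rs} = 1 - measure_pmf.prob R {rs. good rs}"
    using measure_pmf.prob_compl[of "{rs. good rs}" R] by (simp add: Collect_neg_eq Compl_eq_Diff_UNIV)
  moreover have "measure_pmf.prob (map_pmf out R)
      {(est, calls). real (card X) / (1 + \<epsilon>) \<le> est \<and> est \<le> (1 + \<epsilon>) * real (card X)} = measure_pmf.prob R {rs. good rs}"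
    by (simp add: vimage_def good_def case_prod_beta)
  ultimately show ?thesis unfolding pact by linarith
qed

section \<open>Number of solver calls\<close>

text \<open>\<open>e + 1\<close> galloping probes, \<open>e\<close> bisection probes and at most 4
  refinement steps, each of them one saturating count.\<close>

lemma pact_iteration_calls:
  assumes N: "1 \<le> N" "N \<le> 2 ^ e" and p: "p \<in> set_pmf (pact_iteration fam solve \<Gamma> S T F)"
  shows "snd p \<le> nat \<lceil>T\<rceil> * (2 * e + 5)"
proof -
  let ?l = "init_range_param fam" and ?Q = "nat \<lceil>T\<rceil>"
  obtain hs where hs: "hs \<in> set_pmf (replicate_pmf N (Hash ?l))"
    and p: "p \<in> set_pmf (case search hs of
       (None, q) \<Rightarrow> return_pmf (None, q)
     | (Some (k, n), q) \<Rightarrow>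
         map_pmf (\<lambda>((n', m), q'). (Some (n' * (range_size fam ?l ^ (k - 1) * m)), q + q'))
           (refine fam solve \<Gamma> S T (conj_all F (take (k - 1) hs)) ?l n))"
    using p unfolding pact_iteration_eq set_bind_pmf by blast
  interpret saturating_count "\<lambda>k. sat_count solve S T (conj_all F (take k hs)) 0"
      "\<lambda>k. cell_card (take k hs)" T ?Q
    by (rule saturating_count[OF set_replicate_Hash[OF hs]])
  have s: "snd (search hs) \<le> ?Q * (Suc e + e)"
    unfolding search_def by (rule gallop_calls) (use N in auto)
  have l: "?l \<le> 4" by (cases fam) auto
  obtain kn q where kn: "search hs = (kn, q)" by fastforce
  have "snd p \<le> q + ?Q * 4"
  proof (cases kn)
    case None
    then show ?thesis using p kn by simp
  next
    case (Some kn')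
    then obtain k n where kn': "kn = Some (k, n)" by (cases kn') auto
    then obtain p' where p': "p' \<in> set_pmf (refine fam solve \<Gamma> S T (conj_all F (take (k - 1) hs)) ?l n)"
      "snd p = q + snd p'"
      using p kn by (auto simp: case_prod_beta)
    have "snd p' \<le> ?Q * ?l"
      using bspec[OF refine_calls[OF sat_count_calls] p'(1)] .
    also have "\<dots> \<le> ?Q * 4" using l by (rule mult_le_mono2)
    finally show ?thesis using p' by simp
  qed
  also have "\<dots> \<le> ?Q * (Suc e + e) + ?Q * 4" using s kn by simp
  also have "\<dots> = ?Q * (2 * e + 5)" by (simp add: algebra_simps)
  finally show ?thesis .
qed

lemma pact_calls:
  assumes N: "1 \<le> N" "N \<le> 2 ^ e" and p: "p \<in> set_pmf (pact fam solve \<Gamma> F S \<epsilon> \<delta>)"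
  shows "snd p \<le> nat \<lceil>T\<rceil> * (1 + num_iterations fam \<delta> * (2 * e + 5))"
proof -
  let ?Q = "nat \<lceil>T\<rceil>"
  obtain c q where cq: "sat_count solve S T F 0 = (c, q)" by fastforce
  have q: "q \<le> ?Q" using sat_count_calls[of F] cq by simp
  show ?thesis
  proof (cases c)
    case (Some n)
    then show ?thesis using p q unfolding pact_def cq by (simp add: trans_le_add1)
  next
    case None
    then obtain rs where rs: "rs \<in> set_pmf (replicate_pmf (num_iterations fam \<delta>) (pact_iteration fam solve \<Gamma> S T F))"
      and p: "snd p = q + sum_list (map snd rs)"
      using p unfolding pact_def cq by auto
    have len: "length rs = num_iterations fam \<delta>" and "set rs \<subseteq> set_pmf (pact_iteration fam solve \<Gamma> S T F)"
      using rs by (auto simp: set_replicate_pmf lists_eq_set)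
    then have "\<forall>x\<in>set rs. snd x \<le> ?Q * (2 * e + 5)" using pact_iteration_calls[OF N] by blast
    then have "sum_list (map snd rs) \<le> length rs * (?Q * (2 * e + 5))"
      by (induction rs) auto
    then show ?thesis using p q len by (simp add: algebra_simps)
  qed
qed

end

section \<open>Asymptotic form of the call bound\<close>

text \<open>Since \<open>log 2 3 \<le> 2\<close>, splitting off the 3 costs 46, and rounding up
  costs 1.\<close>

lemma num_iterations_le:
  assumes "0 < \<delta>" "\<delta> < 1"
  shows "real (num_iterations fam \<delta>) \<le> 47 + 23 * log 2 (1 / \<delta>)"
proof -
  define L where "L = log 2 (3 / \<delta>)"
  have eq: "L = log 2 3 + log 2 (1 / \<delta>)" using assms by (simp add: L_def log_divide)
  have "log 2 3 \<le> log 2 (4::real)" by simp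
  also have "log 2 4 = (2::real)" using log_pow_cancel[of 2 2] by simp
  finally have "L \<le> 2 + log 2 (1 / \<delta>)" unfolding eq by simp
  moreover have L: "0 \<le> L" using assms by (simp add: L_def)
  moreover have "real (num_iterations fam \<delta>) \<le> 23 * L + 1"
    using L by (cases fam) (simp_all add: L_def[symmetric], linarith+)
  ultimately show ?thesis by simp
qed

text \<open>Merging additive terms into one product needs its factors bounded below:
  \<open>log 2 N \<ge> 1\<close>, \<open>log 2 (1 / \<delta>)\<close> is at least its value at
  \<open>\<delta>\<^sub>0\<close>, and \<open>\<epsilon> \<le> \<epsilon>\<^sub>0\<close> lets
  \<open>1 / \<epsilon>\<^sup>2\<close> absorb the lower-order terms of the threshold.\<close>

lemma calls_bound:
  fixes \<epsilon> \<epsilon>\<^sub>0 \<delta> \<delta>\<^sub>0 :: real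
  assumes \<epsilon>: "0 < \<epsilon>" "\<epsilon> \<le> \<epsilon>\<^sub>0" and \<delta>: "0 < \<delta>" "\<delta> \<le> \<delta>\<^sub>0" "\<delta>\<^sub>0 < 1" and N: "2 \<le> N"
    and e: "e = nat \<lceil>log 2 (real N)\<rceil>"
  shows "real (nat \<lceil>thresh \<epsilon>\<rceil> * (1 + num_iterations fam \<delta> * (2 * e + 5))) \<le>
    ((2 * \<epsilon>\<^sub>0\<^sup>2 + 20 * (1 + \<epsilon>\<^sub>0)\<^sup>2) * (1 / log 2 (1 / \<delta>\<^sub>0) + 9 * (47 / log 2 (1 / \<delta>\<^sub>0) + 23))) *
    (log 2 (real N) * (1 / \<epsilon>\<^sup>2) * log 2 (1 / \<delta>))"
proof -
  define n d d0 where "n = log 2 (real N)" and "d = log 2 (1 / \<delta>)" and "d0 = log 2 (1 / \<delta>\<^sub>0)"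
  have n: "1 \<le> n" using N by (simp add: n_def)
  have d0: "0 < d0" using \<delta> by (simp add: d0_def)
  have d: "d0 \<le> d" using \<delta> by (simp add: d_def d0_def frac_le)
  have one: "1 \<le> d / d0" using d d0 by simp
  have Q: "real (nat \<lceil>thresh \<epsilon>\<rceil>) \<le> (2 * \<epsilon>\<^sub>0\<^sup>2 + 20 * (1 + \<epsilon>\<^sub>0)\<^sup>2) * (1 / \<epsilon>\<^sup>2)"
  proof -
    have frac: "0 \<le> \<epsilon> / (1 + \<epsilon>)" "\<epsilon> / (1 + \<epsilon>) \<le> 1" using \<epsilon> by auto
    have "thresh \<epsilon> = 1 + (9.84 * (1 + \<epsilon> / (1 + \<epsilon>))) * (1 + 1 / \<epsilon>)\<^sup>2" by (simp add: thresh_def)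
    also have "\<dots> \<le> 1 + 20 * (1 + 1 / \<epsilon>)\<^sup>2"
      using frac by (intro add_left_mono mult_right_mono) auto
    finally have T: "thresh \<epsilon> \<le> 1 + 20 * (1 + 1 / \<epsilon>)\<^sup>2" .
    have "0 \<le> thresh \<epsilon>" using frac by (simp add: thresh_def)
    then have "real (nat \<lceil>thresh \<epsilon>\<rceil>) \<le> thresh \<epsilon> + 1" by linarith
    also have "\<dots> \<le> 2 + 20 * (1 + 1 / \<epsilon>)\<^sup>2" using T by simp
    also have "\<dots> = (2 * \<epsilon>\<^sup>2 + 20 * (1 + \<epsilon>)\<^sup>2) * (1 / \<epsilon>\<^sup>2)"
      using \<epsilon> by (simp add: power2_eq_square field_simps)
    also have "\<dots> \<le> (2 * \<epsilon>\<^sub>0\<^sup>2 + 20 * (1 + \<epsilon>\<^sub>0)\<^sup>2) * (1 / \<epsilon>\<^sup>2)"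
      using \<epsilon> by (intro mult_right_mono add_mono mult_left_mono power_mono) auto
    finally show ?thesis .
  qed
  have "real e \<le> n + 1" using n unfolding e n_def[symmetric] by linarith
  then have e9: "real (2 * e + 5) \<le> 9 * n" using n by simp
  have t: "real (num_iterations fam \<delta>) \<le> (47 / d0 + 23) * d"
  proof -
    have "real (num_iterations fam \<delta>) \<le> 47 * 1 + 23 * d"
      using num_iterations_le[of \<delta> fam] \<delta> by (simp add: d_def)
    also have "\<dots> \<le> 47 * (d / d0) + 23 * d" using one by (intro add_right_mono mult_left_mono) auto
    finally show ?thesis by (simp add: algebra_simps)
  qed
  have t0: "0 \<le> (47 / d0 + 23) * d" using d d0 by simp
  have "real (1 + num_iterations fam \<delta> * (2 * e + 5)) = 1 + real (num_iterations fam \<delta>) * real (2 * e + 5)"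
    by simp
  also have "\<dots> \<le> (d / d0) * n + ((47 / d0 + 23) * d) * (9 * n)"
  proof (intro add_mono mult_mono t e9 t0)
    have "1 * 1 \<le> (d / d0) * n" using one n by (intro mult_mono) auto
    then show "1 \<le> (d / d0) * n" by simp
  qed auto
  also have "\<dots> = (1 / d0 + 9 * (47 / d0 + 23)) * (n * d)" by (simp add: algebra_simps)
  finally have rest: "real (1 + num_iterations fam \<delta> * (2 * e + 5)) \<le> (1 / d0 + 9 * (47 / d0 + 23)) * (n * d)" .
  have "real (nat \<lceil>thresh \<epsilon>\<rceil> * (1 + num_iterations fam \<delta> * (2 * e + 5))) =
      real (nat \<lceil>thresh \<epsilon>\<rceil>) * real (1 + num_iterations fam \<delta> * (2 * e + 5))"
    by (rule of_nat_mult)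
  also have "\<dots> \<le> ((2 * \<epsilon>\<^sub>0\<^sup>2 + 20 * (1 + \<epsilon>\<^sub>0)\<^sup>2) * (1 / \<epsilon>\<^sup>2)) * ((1 / d0 + 9 * (47 / d0 + 23)) * (n * d))"
    by (intro mult_mono Q rest) auto
  finally show ?thesis unfolding n_def d_def d0_def by (simp only: mult_ac)
qed

text \<open>Nonnegativity of the constant is recorded for the passage to \<open>card S\<close>,
  where the logarithm it multiplies is enlarged.\<close>

lemma pact_calls_bound:
  fixes \<epsilon>\<^sub>0 \<delta>\<^sub>0 :: real
  assumes "\<delta>\<^sub>0 < 1"
  shows "\<exists>C\<ge>0. \<forall>fam (V :: 'v set) (\<Gamma> :: 'v \<Rightarrow> 'a srt) F S solve \<epsilon> \<delta>.
    pact_setting fam V \<Gamma> S solve \<longrightarrow> 0 < \<epsilon> \<longrightarrow> \<epsilon> \<le> \<epsilon>\<^sub>0 \<longrightarrow> 0 < \<delta> \<longrightarrow> \<delta> \<le> \<delta>\<^sub>0 \<longrightarrow>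
    2 \<le> total_bits \<Gamma> S \<longrightarrow>
    (\<forall>(est, calls) \<in> set_pmf (pact fam solve \<Gamma> F S \<epsilon> \<delta>).
      real calls \<le> C * (log 2 (real (total_bits \<Gamma> S)) * (1 / \<epsilon>\<^sup>2) * log 2 (1 / \<delta>)))"
proof -
  define C where "C = (2 * \<epsilon>\<^sub>0\<^sup>2 + 20 * (1 + \<epsilon>\<^sub>0)\<^sup>2) * (1 / log 2 (1 / \<delta>\<^sub>0) + 9 * (47 / log 2 (1 / \<delta>\<^sub>0) + 23))"
  have main: "real calls \<le> C * (log 2 (real (total_bits \<Gamma> S)) * (1 / \<epsilon>\<^sup>2) * log 2 (1 / \<delta>))"
    if set: "pact_setting fam V \<Gamma> S solve" and \<epsilon>: "0 < \<epsilon>" "\<epsilon> \<le> \<epsilon>\<^sub>0" and \<delta>: "0 < \<delta>" "\<delta> \<le> \<delta>\<^sub>0"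
      and N: "2 \<le> total_bits \<Gamma> S" and p: "(est, calls) \<in> set_pmf (pact fam solve \<Gamma> F S \<epsilon> \<delta>)"
    for fam and V :: "'v set" and \<Gamma> :: "'v \<Rightarrow> 'a srt" and F S solve \<epsilon> \<delta> est calls
  proof -
    interpret pact_run fam V \<Gamma> S solve F \<epsilon> using set \<epsilon>(1) by unfold_locales
    define e where "e = nat \<lceil>log 2 (real N)\<rceil>"
    have "real N = 2 powr log 2 (real N)" using N by simp
    also have "\<dots> \<le> 2 powr real e" unfolding e_def by (intro powr_mono) (linarith, simp)
    also have "\<dots> = real (2 ^ e)" by (simp add: powr_realpow)
    finally have "N \<le> 2 ^ e" by (simp only: of_nat_le_iff)
    moreover have "1 \<le> N" using N by simp
    ultimately have "calls \<le> nat \<lceil>T\<rceil> * (1 + num_iterations fam \<delta> * (2 * e + 5))"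
      using pact_calls[OF _ _ p] by simp
    then have "real calls \<le> real (nat \<lceil>T\<rceil> * (1 + num_iterations fam \<delta> * (2 * e + 5)))"
      by (simp only: of_nat_le_iff)
    also have "\<dots> \<le> C * (log 2 (real N) * (1 / \<epsilon>\<^sup>2) * log 2 (1 / \<delta>))"
      unfolding C_def by (rule calls_bound[OF \<epsilon> \<delta> assms N e_def])
    finally show ?thesis .
  qed
  show ?thesis
  proof (cases "0 < \<delta>\<^sub>0")
    case True
    have "0 \<le> log 2 (1 / \<delta>\<^sub>0)" using True assms by simp
    then have "0 \<le> C" unfolding C_def by (intro mult_nonneg_nonneg add_nonneg_nonneg) auto
    then show ?thesis using main by blast
  next
    \<comment> \<open>No \<open>\<delta>\<close> satisfies the hypotheses, so any constant will
      do.\<close>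
    case False
    then show ?thesis by (intro exI[of _ 0]) auto
  qed
qed

text \<open>The search ranges over bits, not variables. With widths at most \<open>W\<close> the
  logarithm of the number of bits is at most \<open>log 2 W + log 2 (card S)\<close>, and
  \<open>log 2 (card S) \<ge> 1\<close> turns this sum into a multiple of
  \<open>log 2 (card S)\<close>.\<close>

lemma pact_calls_bound_card:
  fixes \<epsilon>\<^sub>0 \<delta>\<^sub>0 :: real
  assumes "\<delta>\<^sub>0 < 1"
  shows "\<exists>C. \<forall>fam (V :: 'v set) (\<Gamma> :: 'v \<Rightarrow> 'a srt) F S solve \<epsilon> \<delta>.
    pact_setting fam V \<Gamma> S solve \<longrightarrow> 0 < \<epsilon> \<longrightarrow> \<epsilon> \<le> \<epsilon>\<^sub>0 \<longrightarrow> 0 < \<delta> \<longrightarrow> \<delta> \<le> \<delta>\<^sub>0 \<longrightarrow>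
    2 \<le> card S \<longrightarrow> (\<forall>v\<in>S. width (\<Gamma> v) \<le> W) \<longrightarrow>
    (\<forall>(est, calls) \<in> set_pmf (pact fam solve \<Gamma> F S \<epsilon> \<delta>).
      real calls \<le> C * (log 2 (real (card S)) * (1 / \<epsilon>\<^sup>2) * log 2 (1 / \<delta>)))"
proof -
  obtain C where C: "0 \<le> C" and main: "\<And>fam (V :: 'v set) (\<Gamma> :: 'v \<Rightarrow> 'a srt) F S solve \<epsilon> \<delta> est calls.
    pact_setting fam V \<Gamma> S solve \<Longrightarrow> 0 < \<epsilon> \<Longrightarrow> \<epsilon> \<le> \<epsilon>\<^sub>0 \<Longrightarrow> 0 < \<delta> \<Longrightarrow> \<delta> \<le> \<delta>\<^sub>0 \<Longrightarrow>
    2 \<le> total_bits \<Gamma> S \<Longrightarrow> (est, calls) \<in> set_pmf (pact fam solve \<Gamma> F S \<epsilon> \<delta>) \<Longrightarrow>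
      real calls \<le> C * (log 2 (real (total_bits \<Gamma> S)) * (1 / \<epsilon>\<^sup>2) * log 2 (1 / \<delta>))"
    using pact_calls_bound[OF assms, of \<epsilon>\<^sub>0, where 'v = 'v and 'a = 'a] by fast
  have "real calls \<le> (C * (1 + log 2 (real W))) * (log 2 (real (card S)) * (1 / \<epsilon>\<^sup>2) * log 2 (1 / \<delta>))"
    if set: "pact_setting fam V \<Gamma> S solve" and \<epsilon>: "0 < \<epsilon>" "\<epsilon> \<le> \<epsilon>\<^sub>0" and \<delta>: "0 < \<delta>" "\<delta> \<le> \<delta>\<^sub>0"
      and card: "2 \<le> card S" and W: "\<forall>v\<in>S. width (\<Gamma> v) \<le> W"
      and p: "(est, calls) \<in> set_pmf (pact fam solve \<Gamma> F S \<epsilon> \<delta>)"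
    for fam and V :: "'v set" and \<Gamma> :: "'v \<Rightarrow> 'a srt" and F S solve \<epsilon> \<delta> est calls
  proof -
    have bv: "\<forall>v\<in>S. \<exists>w\<ge>1. \<Gamma> v = BitVec w" using set by (simp add: pact_setting_def)
    have width: "1 \<le> width (\<Gamma> v)" if "v \<in> S" for v using bspec[OF bv that] by auto
    have "card S = (\<Sum>v\<in>S. 1)" by simp
    also have "\<dots> \<le> total_bits \<Gamma> S" unfolding total_bits_def using width by (intro sum_mono)
    finally have N: "card S \<le> total_bits \<Gamma> S" .
    have "total_bits \<Gamma> S \<le> (\<Sum>v\<in>S. W)" unfolding total_bits_def using W by (intro sum_mono) auto
    then have NW: "total_bits \<Gamma> S \<le> W * card S" by (simp add: mult.commute)
    obtain v where "v \<in> S" using card by fastforce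
    then have W1: "1 \<le> W" using width W by (meson order_trans)
    have lW: "0 \<le> log 2 (real W)" using W1 by simp
    have lS: "1 \<le> log 2 (real (card S))" using card by simp
    have "log 2 (real (total_bits \<Gamma> S)) \<le> log 2 (real (W * card S))"
      using NW N card W1 by (subst log_le_cancel_iff) (auto simp only: of_nat_le_iff of_nat_0_less_iff)
    also have "\<dots> = log 2 (real W) + log 2 (real (card S))"
      using W1 card by (simp add: log_mult)
    also have "\<dots> \<le> log 2 (real W) * log 2 (real (card S)) + log 2 (real (card S))"
      using mult_left_mono[OF lS lW] by simp
    finally have log: "log 2 (real (total_bits \<Gamma> S)) \<le> (1 + log 2 (real W)) * log 2 (real (card S))"
      by (simp add: algebra_simps)
    have d: "0 \<le> log 2 (1 / \<delta>)" using \<delta> assms by simp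
    have "real calls \<le> C * (log 2 (real (total_bits \<Gamma> S)) * (1 / \<epsilon>\<^sup>2) * log 2 (1 / \<delta>))"
      using main[OF set \<epsilon> \<delta> _ p] N card by simp
    also have "\<dots> \<le> C * (((1 + log 2 (real W)) * log 2 (real (card S))) * (1 / \<epsilon>\<^sup>2) * log 2 (1 / \<delta>))"
      using C log d by (intro mult_left_mono mult_right_mono) auto
    also have "\<dots> = (C * (1 + log 2 (real W))) * (log 2 (real (card S)) * (1 / \<epsilon>\<^sup>2) * log 2 (1 / \<delta>))"
      by (simp only: mult_ac)
    finally show ?thesis .
  qed
  then show ?thesis by blast
qed

text \<open>The size of \<open>S\<close> is read as its number of bits and, at bounded width, as its
  number of variables. The constants depend on the limits \<open>\<epsilon>\<^sub>0\<close>,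
  \<open>\<delta>\<^sub>0 < 1\<close> and, in the second reading, \<open>W\<close>: as
  \<open>\<epsilon>\<close> grows or \<open>\<delta>\<close> tends to 1 the product tends to 0,
  while at least one call is always made.\<close>

theorem theorem1:
  shows
    "(\<forall>fam (V :: 'v set) (\<Gamma> :: 'v \<Rightarrow> 'a srt) F S solve \<epsilon> \<delta>.
        pact_setting fam V \<Gamma> S solve \<longrightarrow> 0 < \<epsilon> \<longrightarrow> 0 < \<delta> \<longrightarrow> \<delta> < 1 \<longrightarrow>
        measure_pmf.prob (pact fam solve \<Gamma> F S \<epsilon> \<delta>)
          {(est, calls). real (card (proj_Sol V \<Gamma> F S)) / (1 + \<epsilon>) \<le> est \<and>
                         est \<le> (1 + \<epsilon>) * real (card (proj_Sol V \<Gamma> F S))} \<ge> 1 - \<delta>)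
     \<and> (\<forall>\<epsilon>\<^sub>0 \<delta>\<^sub>0. \<delta>\<^sub>0 < 1 \<longrightarrow>
          (\<exists>C. \<forall>fam (V :: 'v set) (\<Gamma> :: 'v \<Rightarrow> 'a srt) F S solve \<epsilon> \<delta>.
             pact_setting fam V \<Gamma> S solve \<longrightarrow> 0 < \<epsilon> \<longrightarrow> \<epsilon> \<le> \<epsilon>\<^sub>0 \<longrightarrow> 0 < \<delta> \<longrightarrow> \<delta> \<le> \<delta>\<^sub>0 \<longrightarrow>
             2 \<le> total_bits \<Gamma> S \<longrightarrow>
             (\<forall>(est, calls) \<in> set_pmf (pact fam solve \<Gamma> F S \<epsilon> \<delta>).
                real calls \<le> C * (log 2 (real (total_bits \<Gamma> S)) * (1 / \<epsilon>\<^sup>2) * log 2 (1 / \<delta>)))))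
     \<and> (\<forall>W \<epsilon>\<^sub>0 \<delta>\<^sub>0. \<delta>\<^sub>0 < 1 \<longrightarrow>
          (\<exists>C. \<forall>fam (V :: 'v set) (\<Gamma> :: 'v \<Rightarrow> 'a srt) F S solve \<epsilon> \<delta>.
             pact_setting fam V \<Gamma> S solve \<longrightarrow> 0 < \<epsilon> \<longrightarrow> \<epsilon> \<le> \<epsilon>\<^sub>0 \<longrightarrow> 0 < \<delta> \<longrightarrow> \<delta> \<le> \<delta>\<^sub>0 \<longrightarrow>
             2 \<le> card S \<longrightarrow> (\<forall>v\<in>S. width (\<Gamma> v) \<le> W) \<longrightarrow>
             (\<forall>(est, calls) \<in> set_pmf (pact fam solve \<Gamma> F S \<epsilon> \<delta>).
                real calls \<le> C * (log 2 (real (card S)) * (1 / \<epsilon>\<^sup>2) * log 2 (1 / \<delta>)))))"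
proof (intro conjI allI impI)
  fix fam and V :: "'v set" and \<Gamma> :: "'v \<Rightarrow> 'a srt" and F S solve and \<epsilon> \<delta> :: real
  assume "pact_setting fam V \<Gamma> S solve" "0 < \<epsilon>" and \<delta>: "0 < \<delta>" "\<delta> < 1"
  then interpret pact_run fam V \<Gamma> S solve F \<epsilon> by unfold_locales
  show "1 - \<delta> \<le> measure_pmf.prob (pact fam solve \<Gamma> F S \<epsilon> \<delta>)
      {(est, calls). real (card (proj_Sol V \<Gamma> F S)) / (1 + \<epsilon>) \<le> est \<and>
                     est \<le> (1 + \<epsilon>) * real (card (proj_Sol V \<Gamma> F S))}"
    by (rule pact_correct[OF \<delta>])
next
  fix \<epsilon>\<^sub>0 \<delta>\<^sub>0 :: real assume "\<delta>\<^sub>0 < 1"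
  from pact_calls_bound[OF this, of \<epsilon>\<^sub>0, where 'v = 'v and 'a = 'a]
  show "\<exists>C. \<forall>fam (V :: 'v set) (\<Gamma> :: 'v \<Rightarrow> 'a srt) F S solve \<epsilon> \<delta>.
     pact_setting fam V \<Gamma> S solve \<longrightarrow> 0 < \<epsilon> \<longrightarrow> \<epsilon> \<le> \<epsilon>\<^sub>0 \<longrightarrow> 0 < \<delta> \<longrightarrow> \<delta> \<le> \<delta>\<^sub>0 \<longrightarrow>
     2 \<le> total_bits \<Gamma> S \<longrightarrow>
     (\<forall>(est, calls) \<in> set_pmf (pact fam solve \<Gamma> F S \<epsilon> \<delta>).
        real calls \<le> C * (log 2 (real (total_bits \<Gamma> S)) * (1 / \<epsilon>\<^sup>2) * log 2 (1 / \<delta>)))"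
    by (elim exE conjE) (rule exI)
next
  fix W and \<epsilon>\<^sub>0 \<delta>\<^sub>0 :: real assume "\<delta>\<^sub>0 < 1"
  then show "\<exists>C. \<forall>fam (V :: 'v set) (\<Gamma> :: 'v \<Rightarrow> 'a srt) F S solve \<epsilon> \<delta>.
     pact_setting fam V \<Gamma> S solve \<longrightarrow> 0 < \<epsilon> \<longrightarrow> \<epsilon> \<le> \<epsilon>\<^sub>0 \<longrightarrow> 0 < \<delta> \<longrightarrow> \<delta> \<le> \<delta>\<^sub>0 \<longrightarrow>
     2 \<le> card S \<longrightarrow> (\<forall>v\<in>S. width (\<Gamma> v) \<le> W) \<longrightarrow>
     (\<forall>(est, calls) \<in> set_pmf (pact fam solve \<Gamma> F S \<epsilon> \<delta>).
        real calls \<le> C * (log 2 (real (card S)) * (1 / \<epsilon>\<^sup>2) * log 2 (1 / \<delta>)))"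
    by (rule pact_calls_bound_card)
qed

end
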